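(* Let $V$ be an object in an abelian braided category, $B=B_+(V)$, $\Lambda=\Lambda(V)$ and let $\Omega^{p,q}=\Lambda^p\underline\otimes B\underline\otimes\Lambda^q$ be the bigraded algebra described in the context. Then $\wedge:\Omega^{p,0}\otimes_B\Omega^{0,q}\to\Omega^{p,q}$ is a $B$-bimodule isomorphism, by the canonical identification $B\otimes_BB=B$. Moreover, $\wedge:\Omega^{0,q}\otimes_B\Omega^{p,0}\to\Omega^{p,q}$ is also a $B$-bimodule isomorphism.
   Context: The category is a ($k$-linear) abelian braided monoidal category with braiding $\Psi_{X,Y}:X\otimes Y\to Y\otimes X$, in which the tensor algebra and the quotients below make sense; the main example is right comodules over a coquasitriangular Hopf algebra. The braided tensor product of algebras has product $(b\otimes c)(b'\otimes c')=b\,\Psi(c\otimes b')\,c'$, with an additional sign $(-1)^{|c||b'|}$ in the graded (super) case. The braided factorial is $[n,\Psi]!=\sum_{\sigma\in S_n}\Psi_\sigma$ on $V^{\otimes n}$, where $\Psi_\sigma$ is obtained from a reduced expression of $\sigma$ by replacing simple transpositions by $\Psi_{V,V}$ in the corresponding adjacent positions. $B_+(V)=TV/\oplus_n\ker[n,\Psi]!$ and $\Lambda(V)=TV/\langle\mathrm{Im}(\mathrm{id}+\Psi_{V,V})\rangle$, where $TV$ is the tensor algebra. $\Omega=\oplus_{p,q}\Omega^{p,q}=\Lambda\underline\otimes B\underline\otimes\Lambda$ is the braided super tensor product algebra ($B$ in degree $0$), with product denoted $\wedge$; $\Omega^{p,0}=\Lambda^p\underline\otimes B$, $\Omega^{0,q}=B\underline\otimes\Lambda^q$.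 The $B$-bimodule structure is by multiplication by $1\otimes b\otimes1$ in this algebra. *)

theory Defs
  imports "HOL-Algebra.FiniteProduct" "HOL-Combinatorics.Permutations"
begin

section \<open>Abelian braided monoidal categories\<close>

text \<open>
  \<open>Comp\<close>, \<open>Add\<close> and \<open>TenA\<close> are only constrained on composable, parallel and arbitrary
  arrows respectively; composition is written in the usual right-to-left order.
\<close>

record ('o, 'a) braided_data =
  Obj :: "'o set"
  Arr :: "'a set"
  Dom :: "'a \<Rightarrow> 'o"
  Cod :: "'a \<Rightarrow> 'o"
  Ide :: "'o \<Rightarrow> 'a"
  Comp :: "'a \<Rightarrow> 'a \<Rightarrow> 'a"  (infixr "\<cdot>\<index>" 70)
  Zero :: "'o \<Rightarrow> 'o \<Rightarrow> 'a"
  Add :: "'a \<Rightarrow> 'a \<Rightarrow> 'a"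
  Unit :: "'o"
  TenO :: "'o \<Rightarrow> 'o \<Rightarrow> 'o"  (infixl "\<boxdot>\<index>" 80)
  TenA :: "'a \<Rightarrow> 'a \<Rightarrow> 'a"  (infixl "\<boxtimes>\<index>" 80)
  Assoc :: "'o \<Rightarrow> 'o \<Rightarrow> 'o \<Rightarrow> 'a"
  LUnit :: "'o \<Rightarrow> 'a"
  RUnit :: "'o \<Rightarrow> 'a"
  Braid :: "'o \<Rightarrow> 'o \<Rightarrow> 'a"

definition Hom :: "('o, 'a) braided_data \<Rightarrow> 'o \<Rightarrow> 'o \<Rightarrow> 'a set" where
  "Hom C x y = {f \<in> Arr C. Dom C f = x \<and> Cod C f = y}"

definition is_inverse :: "('o, 'a) braided_data \<Rightarrow> 'a \<Rightarrow> 'a \<Rightarrow> bool" where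
  "is_inverse C f g \<longleftrightarrow> f \<in> Arr C \<and> g \<in> Hom C (Cod C f) (Dom C f) \<and>
     g \<cdot>\<^bsub>C\<^esub> f = Ide C (Dom C f) \<and> f \<cdot>\<^bsub>C\<^esub> g = Ide C (Cod C f)"

definition is_invertible :: "('o, 'a) braided_data \<Rightarrow> 'a \<Rightarrow> bool" where
  "is_invertible C f \<longleftrightarrow> (\<exists>g. is_inverse C f g)"

definition Inv :: "('o, 'a) braided_data \<Rightarrow> 'a \<Rightarrow> 'a" where
  "Inv C f = (THE g. is_inverse C f g)"

definition is_mono :: "('o, 'a) braided_data \<Rightarrow> 'a \<Rightarrow> bool" where
  "is_mono C f \<longleftrightarrow> f \<in> Arr C \<and>
     (\<forall>x\<in>Obj C. \<forall>g\<in>Hom C x (Dom C f). \<forall>h\<in>Hom C x (Dom C f). f \<cdot>\<^bsub>C\<^esub> g = f \<cdot>\<^bsub>C\<^esub> h \<longrightarrow> g = h)"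

definition is_epi :: "('o, 'a) braided_data \<Rightarrow> 'a \<Rightarrow> bool" where
  "is_epi C f \<longleftrightarrow> f \<in> Arr C \<and>
     (\<forall>x\<in>Obj C. \<forall>g\<in>Hom C (Cod C f) x. \<forall>h\<in>Hom C (Cod C f) x. g \<cdot>\<^bsub>C\<^esub> f = h \<cdot>\<^bsub>C\<^esub> f \<longrightarrow> g = h)"

definition is_kernel :: "('o, 'a) braided_data \<Rightarrow> 'a \<Rightarrow> 'a \<Rightarrow> bool" where
  "is_kernel C k f \<longleftrightarrow> f \<in> Arr C \<and> k \<in> Arr C \<and> Cod C k = Dom C f \<and>
     f \<cdot>\<^bsub>C\<^esub> k = Zero C (Dom C k) (Cod C f) \<and>
     (\<forall>x\<in>Obj C. \<forall>h\<in>Hom C x (Dom C f). f \<cdot>\<^bsub>C\<^esub> h = Zero C x (Cod C f) \<longrightarrow>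
        (\<exists>!u. u \<in> Hom C x (Dom C k) \<and> k \<cdot>\<^bsub>C\<^esub> u = h))"

definition is_cokernel :: "('o, 'a) braided_data \<Rightarrow> 'a \<Rightarrow> 'a \<Rightarrow> bool" where
  "is_cokernel C c f \<longleftrightarrow> f \<in> Arr C \<and> c \<in> Arr C \<and> Dom C c = Cod C f \<and>
     c \<cdot>\<^bsub>C\<^esub> f = Zero C (Dom C f) (Cod C c) \<and>
     (\<forall>x\<in>Obj C. \<forall>h\<in>Hom C (Cod C f) x. h \<cdot>\<^bsub>C\<^esub> f = Zero C (Dom C f) x \<longrightarrow>
        (\<exists>!u. u \<in> Hom C (Cod C c) x \<and> u \<cdot>\<^bsub>C\<^esub> c = h))"

definition is_coproduct :: "('o, 'a) braided_data \<Rightarrow> ('i \<Rightarrow> 'o) \<Rightarrow> 'o \<Rightarrow> ('i \<Rightarrow> 'a) \<Rightarrow> bool" where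
  "is_coproduct C D S s \<longleftrightarrow> S \<in> Obj C \<and> (\<forall>i. s i \<in> Hom C (D i) S) \<and>
     (\<forall>x\<in>Obj C. \<forall>f. (\<forall>i. f i \<in> Hom C (D i) x) \<longrightarrow>
        (\<exists>!h. h \<in> Hom C S x \<and> (\<forall>i. h \<cdot>\<^bsub>C\<^esub> s i = f i)))"

text \<open>The additive group of arrows from \<open>x\<close> to \<open>y\<close>, written as an HOL-Algebra monoid.\<close>

definition hom_grp :: "('o, 'a) braided_data \<Rightarrow> 'o \<Rightarrow> 'o \<Rightarrow> 'a monoid" where
  "hom_grp C x y = \<lparr>carrier = Hom C x y, monoid.mult = Add C, one = Zero C x y\<rparr>"

locale category =
  fixes C :: "('o, 'a) braided_data" (structure)
  assumes dom_cod: "f \<in> Arr C \<Longrightarrow> Dom C f \<in> Obj C \<and> Cod C f \<in> Obj C"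
    and ide_hom: "x \<in> Obj C \<Longrightarrow> Ide C x \<in> Hom C x x"
    and comp_hom: "\<lbrakk>f \<in> Hom C x y; g \<in> Hom C y z\<rbrakk> \<Longrightarrow> g \<cdot> f \<in> Hom C x z"
    and comp_assoc: "\<lbrakk>f \<in> Hom C w x; g \<in> Hom C x y; h \<in> Hom C y z\<rbrakk> \<Longrightarrow> (h \<cdot> g) \<cdot> f = h \<cdot> (g \<cdot> f)"
    and comp_ide_left: "f \<in> Hom C x y \<Longrightarrow> Ide C y \<cdot> f = f"
    and comp_ide_right: "f \<in> Hom C x y \<Longrightarrow> f \<cdot> Ide C x = f"

locale abelian_category = category +
  assumes hom_comm_group: "\<lbrakk>x \<in> Obj C; y \<in> Obj C\<rbrakk> \<Longrightarrow> comm_group (hom_grp C x y)"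
    and comp_add_left: "\<lbrakk>f \<in> Hom C x y; g \<in> Hom C y z; h \<in> Hom C y z\<rbrakk> \<Longrightarrow>
          Add C g h \<cdot> f = Add C (g \<cdot> f) (h \<cdot> f)"
    and comp_add_right: "\<lbrakk>f \<in> Hom C x y; g \<in> Hom C x y; h \<in> Hom C y z\<rbrakk> \<Longrightarrow>
          h \<cdot> Add C f g = Add C (h \<cdot> f) (h \<cdot> g)"
    and zero_object: "\<exists>z\<in>Obj C. Ide C z = Zero C z z"
    and binary_coproduct: "\<lbrakk>x \<in> Obj C; y \<in> Obj C\<rbrakk> \<Longrightarrow>
          \<exists>S s. is_coproduct C (\<lambda>b::bool. if b then x else y) S s"
    and has_kernel: "f \<in> Arr C \<Longrightarrow> \<exists>k. is_kernel C k f"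
    and has_cokernel: "f \<in> Arr C \<Longrightarrow> \<exists>c. is_cokernel C c f"
    and mono_normal: "is_mono C f \<Longrightarrow> \<exists>g. is_kernel C f g"
    and epi_normal: "is_epi C f \<Longrightarrow> \<exists>g. is_cokernel C f g"

locale monoidal_category = category +
  assumes unit_obj: "Unit C \<in> Obj C"
    and tensor_obj: "\<lbrakk>x \<in> Obj C; y \<in> Obj C\<rbrakk> \<Longrightarrow> x \<boxdot> y \<in> Obj C"
    and tensor_hom: "\<lbrakk>f \<in> Hom C x y; g \<in> Hom C x' y'\<rbrakk> \<Longrightarrow> f \<boxtimes> g \<in> Hom C (x \<boxdot> x') (y \<boxdot> y')"
    and tensor_ide: "\<lbrakk>x \<in> Obj C; y \<in> Obj C\<rbrakk> \<Longrightarrow> Ide C x \<boxtimes> Ide C y = Ide C (x \<boxdot> y)"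
    and tensor_comp: "\<lbrakk>f \<in> Hom C x y; g \<in> Hom C y z; f' \<in> Hom C x' y'; g' \<in> Hom C y' z'\<rbrakk> \<Longrightarrow>
          (g \<cdot> f) \<boxtimes> (g' \<cdot> f') = (g \<boxtimes> g') \<cdot> (f \<boxtimes> f')"
    and assoc_hom: "\<lbrakk>x \<in> Obj C; y \<in> Obj C; z \<in> Obj C\<rbrakk> \<Longrightarrow>
          Assoc C x y z \<in> Hom C (x \<boxdot> y \<boxdot> z) (x \<boxdot> (y \<boxdot> z)) \<and> is_invertible C (Assoc C x y z)"
    and lunit_hom: "x \<in> Obj C \<Longrightarrow> LUnit C x \<in> Hom C (Unit C \<boxdot> x) x \<and> is_invertible C (LUnit C x)"
    and runit_hom: "x \<in> Obj C \<Longrightarrow> RUnit C x \<in> Hom C (x \<boxdot> Unit C) x \<and> is_invertible C (RUnit C x)"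
    and assoc_natural: "\<lbrakk>f \<in> Hom C x x'; g \<in> Hom C y y'; h \<in> Hom C z z'\<rbrakk> \<Longrightarrow>
          Assoc C x' y' z' \<cdot> (f \<boxtimes> g \<boxtimes> h) = (f \<boxtimes> (g \<boxtimes> h)) \<cdot> Assoc C x y z"
    and lunit_natural: "f \<in> Hom C x y \<Longrightarrow> LUnit C y \<cdot> (Ide C (Unit C) \<boxtimes> f) = f \<cdot> LUnit C x"
    and runit_natural: "f \<in> Hom C x y \<Longrightarrow> RUnit C y \<cdot> (f \<boxtimes> Ide C (Unit C)) = f \<cdot> RUnit C x"
    and pentagon: "\<lbrakk>w \<in> Obj C; x \<in> Obj C; y \<in> Obj C; z \<in> Obj C\<rbrakk> \<Longrightarrow>
          Assoc C w x (y \<boxdot> z) \<cdot> Assoc C (w \<boxdot> x) y z =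
          (Ide C w \<boxtimes> Assoc C x y z) \<cdot> Assoc C w (x \<boxdot> y) z \<cdot> (Assoc C w x y \<boxtimes> Ide C z)"
    and triangle: "\<lbrakk>x \<in> Obj C; y \<in> Obj C\<rbrakk> \<Longrightarrow>
          (Ide C x \<boxtimes> LUnit C y) \<cdot> Assoc C x (Unit C) y = RUnit C x \<boxtimes> Ide C y"

locale braided_category = monoidal_category +
  assumes braid_hom: "\<lbrakk>x \<in> Obj C; y \<in> Obj C\<rbrakk> \<Longrightarrow>
          Braid C x y \<in> Hom C (x \<boxdot> y) (y \<boxdot> x) \<and> is_invertible C (Braid C x y)"
    and braid_natural: "\<lbrakk>f \<in> Hom C x x'; g \<in> Hom C y y'\<rbrakk> \<Longrightarrow>
          Braid C x' y' \<cdot> (f \<boxtimes> g) = (g \<boxtimes> f) \<cdot> Braid C x y"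
    and hexagon1: "\<lbrakk>x \<in> Obj C; y \<in> Obj C; z \<in> Obj C\<rbrakk> \<Longrightarrow>
          Assoc C y z x \<cdot> Braid C x (y \<boxdot> z) \<cdot> Assoc C x y z =
          (Ide C y \<boxtimes> Braid C x z) \<cdot> Assoc C y x z \<cdot> (Braid C x y \<boxtimes> Ide C z)"
    and hexagon2: "\<lbrakk>x \<in> Obj C; y \<in> Obj C; z \<in> Obj C\<rbrakk> \<Longrightarrow>
          Inv C (Assoc C z x y) \<cdot> Braid C (x \<boxdot> y) z \<cdot> Inv C (Assoc C x y z) =
          (Braid C x z \<boxtimes> Ide C y) \<cdot> Inv C (Assoc C x z y) \<cdot> (Ide C x \<boxtimes> Braid C y z)"

locale abelian_braided_category = abelian_category + braided_category +
  assumes tensor_add_left: "\<lbrakk>f \<in> Hom C x y; g \<in> Hom C x y; h \<in> Hom C x' y'\<rbrakk> \<Longrightarrow>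
          Add C f g \<boxtimes> h = Add C (f \<boxtimes> h) (g \<boxtimes> h)"
    and tensor_add_right: "\<lbrakk>f \<in> Hom C x y; g \<in> Hom C x' y'; h \<in> Hom C x' y'\<rbrakk> \<Longrightarrow>
          f \<boxtimes> Add C g h = Add C (f \<boxtimes> g) (f \<boxtimes> h)"


section \<open>Algebras and bimodules\<close>

record ('o, 'a) algebra_data =
  carr :: "'o"
  mul :: "'a"
  uni :: "'a"

definition is_algebra :: "('o, 'a) braided_data \<Rightarrow> ('o, 'a) algebra_data \<Rightarrow> bool" where
  "is_algebra C A \<longleftrightarrow> (let X = carr A in
     X \<in> Obj C \<and> mul A \<in> Hom C (X \<boxdot>\<^bsub>C\<^esub> X) X \<and> uni A \<in> Hom C (Unit C) X \<and>
     mul A \<cdot>\<^bsub>C\<^esub> (mul A \<boxtimes>\<^bsub>C\<^esub> Ide C X) = mul A \<cdot>\<^bsub>C\<^esub> (Ide C X \<boxtimes>\<^bsub>C\<^esub> mul A) \<cdot>\<^bsub>C\<^esub> Assoc C X X X \<and>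
     mul A \<cdot>\<^bsub>C\<^esub> (uni A \<boxtimes>\<^bsub>C\<^esub> Ide C X) = LUnit C X \<and>
     mul A \<cdot>\<^bsub>C\<^esub> (Ide C X \<boxtimes>\<^bsub>C\<^esub> uni A) = RUnit C X)"

definition is_algebra_hom ::
    "('o, 'a) braided_data \<Rightarrow> ('o, 'a) algebra_data \<Rightarrow> ('o, 'a) algebra_data \<Rightarrow> 'a \<Rightarrow> bool" where
  "is_algebra_hom C A A' f \<longleftrightarrow> f \<in> Hom C (carr A) (carr A') \<and>
     f \<cdot>\<^bsub>C\<^esub> mul A = mul A' \<cdot>\<^bsub>C\<^esub> (f \<boxtimes>\<^bsub>C\<^esub> f) \<and> f \<cdot>\<^bsub>C\<^esub> uni A = uni A'"

definition factors_through :: "('o, 'a) braided_data \<Rightarrow> 'a \<Rightarrow> 'a \<Rightarrow> bool" where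
  "factors_through C f k \<longleftrightarrow> (\<exists>g\<in>Hom C (Dom C f) (Dom C k). k \<cdot>\<^bsub>C\<^esub> g = f)"

text \<open>Two-sided ideals are represented by their inclusion monomorphisms.\<close>

definition is_ideal :: "('o, 'a) braided_data \<Rightarrow> ('o, 'a) algebra_data \<Rightarrow> 'a \<Rightarrow> bool" where
  "is_ideal C A k \<longleftrightarrow> is_mono C k \<and> Cod C k = carr A \<and>
     factors_through C (mul A \<cdot>\<^bsub>C\<^esub> (Ide C (carr A) \<boxtimes>\<^bsub>C\<^esub> k)) k \<and>
     factors_through C (mul A \<cdot>\<^bsub>C\<^esub> (k \<boxtimes>\<^bsub>C\<^esub> Ide C (carr A))) k"

text \<open>
  \<open>k\<close> is the ideal generated by the image of \<open>r\<close>: the least one containing it. The image of \<open>r\<close>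
  is contained in the subobject \<open>k\<close> exactly when \<open>r\<close> factors through \<open>k\<close>.
\<close>

definition is_ideal_generated_by_image ::
    "('o, 'a) braided_data \<Rightarrow> ('o, 'a) algebra_data \<Rightarrow> 'a \<Rightarrow> 'a \<Rightarrow> bool" where
  "is_ideal_generated_by_image C A r k \<longleftrightarrow> is_ideal C A k \<and> factors_through C r k \<and>
     (\<forall>k'. is_ideal C A k' \<and> factors_through C r k' \<longrightarrow> factors_through C k k')"

record ('o, 'a) bimodule_data =
  mobj :: "'o"
  lact :: "'a"
  ract :: "'a"

definition is_bimodule ::
    "('o, 'a) braided_data \<Rightarrow> ('o, 'a) algebra_data \<Rightarrow> ('o, 'a) bimodule_data \<Rightarrow> bool" where
  "is_bimodule C B M \<longleftrightarrow> (let b = carr B; m = mobj M in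
     m \<in> Obj C \<and> lact M \<in> Hom C (b \<boxdot>\<^bsub>C\<^esub> m) m \<and> ract M \<in> Hom C (m \<boxdot>\<^bsub>C\<^esub> b) m \<and>
     lact M \<cdot>\<^bsub>C\<^esub> (mul B \<boxtimes>\<^bsub>C\<^esub> Ide C m) = lact M \<cdot>\<^bsub>C\<^esub> (Ide C b \<boxtimes>\<^bsub>C\<^esub> lact M) \<cdot>\<^bsub>C\<^esub> Assoc C b b m \<and>
     lact M \<cdot>\<^bsub>C\<^esub> (uni B \<boxtimes>\<^bsub>C\<^esub> Ide C m) = LUnit C m \<and>
     ract M \<cdot>\<^bsub>C\<^esub> (ract M \<boxtimes>\<^bsub>C\<^esub> Ide C b) = ract M \<cdot>\<^bsub>C\<^esub> (Ide C m \<boxtimes>\<^bsub>C\<^esub> mul B) \<cdot>\<^bsub>C\<^esub> Assoc C m b b \<and>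
     ract M \<cdot>\<^bsub>C\<^esub> (Ide C m \<boxtimes>\<^bsub>C\<^esub> uni B) = RUnit C m \<and>
     ract M \<cdot>\<^bsub>C\<^esub> (lact M \<boxtimes>\<^bsub>C\<^esub> Ide C b) = lact M \<cdot>\<^bsub>C\<^esub> (Ide C b \<boxtimes>\<^bsub>C\<^esub> ract M) \<cdot>\<^bsub>C\<^esub> Assoc C b m b)"

definition is_bimodule_iso ::
    "('o, 'a) braided_data \<Rightarrow> ('o, 'a) algebra_data \<Rightarrow>
     ('o, 'a) bimodule_data \<Rightarrow> ('o, 'a) bimodule_data \<Rightarrow> 'a \<Rightarrow> bool" where
  "is_bimodule_iso C B M N f \<longleftrightarrow> is_bimodule C B M \<and> is_bimodule C B N \<and>
     f \<in> Hom C (mobj M) (mobj N) \<and>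
     f \<cdot>\<^bsub>C\<^esub> lact M = lact N \<cdot>\<^bsub>C\<^esub> (Ide C (carr B) \<boxtimes>\<^bsub>C\<^esub> f) \<and>
     f \<cdot>\<^bsub>C\<^esub> ract M = ract N \<cdot>\<^bsub>C\<^esub> (f \<boxtimes>\<^bsub>C\<^esub> Ide C (carr B)) \<and>
     is_invertible C f"

definition regular_bimodule :: "('o, 'a) algebra_data \<Rightarrow> ('o, 'a) bimodule_data" where
  "regular_bimodule B = \<lparr>mobj = carr B, lact = mul B, ract = mul B\<rparr>"

text \<open>
  \<open>M\<close> with \<open>\<pi> : X \<otimes> Y \<rightarrow> M\<close> is the relative tensor product \<open>X \<otimes>\<^sub>B Y\<close>: the coequalizer of the
  two maps \<open>X \<otimes> B \<otimes> Y \<rightarrow> X \<otimes> Y\<close>, with the bimodule structure induced by the outer actions.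
\<close>

definition is_tensor_over ::
    "('o, 'a) braided_data \<Rightarrow> ('o, 'a) algebra_data \<Rightarrow>
     ('o, 'a) bimodule_data \<Rightarrow> ('o, 'a) bimodule_data \<Rightarrow> ('o, 'a) bimodule_data \<Rightarrow> 'a \<Rightarrow> bool" where
  "is_tensor_over C B X Y M \<pi> \<longleftrightarrow> (let x = mobj X; y = mobj Y; b = carr B;
       u = ract X \<boxtimes>\<^bsub>C\<^esub> Ide C y; v = (Ide C x \<boxtimes>\<^bsub>C\<^esub> lact Y) \<cdot>\<^bsub>C\<^esub> Assoc C x b y in
     is_bimodule C B X \<and> is_bimodule C B Y \<and> is_bimodule C B M \<and>
     \<pi> \<in> Hom C (x \<boxdot>\<^bsub>C\<^esub> y) (mobj M) \<and> \<pi> \<cdot>\<^bsub>C\<^esub> u = \<pi> \<cdot>\<^bsub>C\<^esub> v \<and>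
     (\<forall>z\<in>Obj C. \<forall>h\<in>Hom C (x \<boxdot>\<^bsub>C\<^esub> y) z. h \<cdot>\<^bsub>C\<^esub> u = h \<cdot>\<^bsub>C\<^esub> v \<longrightarrow>
        (\<exists>!f. f \<in> Hom C (mobj M) z \<and> f \<cdot>\<^bsub>C\<^esub> \<pi> = h)) \<and>
     lact M \<cdot>\<^bsub>C\<^esub> (Ide C b \<boxtimes>\<^bsub>C\<^esub> \<pi>) \<cdot>\<^bsub>C\<^esub> Assoc C b x y = \<pi> \<cdot>\<^bsub>C\<^esub> (lact X \<boxtimes>\<^bsub>C\<^esub> Ide C y) \<and>
     ract M \<cdot>\<^bsub>C\<^esub> (\<pi> \<boxtimes>\<^bsub>C\<^esub> Ide C b) = \<pi> \<cdot>\<^bsub>C\<^esub> (Ide C x \<boxtimes>\<^bsub>C\<^esub> ract Y) \<cdot>\<^bsub>C\<^esub> Assoc C x y b)"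

text \<open>
  The relative tensor product \<open>X \<otimes>\<^sub>B Y\<close> exists, and \<open>w : X \<otimes> Y \<rightarrow> Z\<close> descends to an isomorphism
  of bimodules \<open>X \<otimes>\<^sub>B Y \<rightarrow> Z\<close>.
\<close>

definition descends_to_bimodule_iso ::
    "('o, 'a) braided_data \<Rightarrow> ('o, 'a) algebra_data \<Rightarrow>
     ('o, 'a) bimodule_data \<Rightarrow> ('o, 'a) bimodule_data \<Rightarrow> ('o, 'a) bimodule_data \<Rightarrow> 'a \<Rightarrow> bool" where
  "descends_to_bimodule_iso C B X Y Z w \<longleftrightarrow>
     (\<exists>M \<pi>. is_tensor_over C B X Y M \<pi>) \<and>
     (\<forall>M \<pi>. is_tensor_over C B X Y M \<pi> \<longrightarrow> (\<exists>f. f \<cdot>\<^bsub>C\<^esub> \<pi> = w \<and> is_bimodule_iso C B M Z f))"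


section \<open>The tensor algebra and its quotients\<close>

fun tpow :: "('o, 'a) braided_data \<Rightarrow> 'o \<Rightarrow> nat \<Rightarrow> 'o" where
  "tpow C V 0 = Unit C"
| "tpow C V (Suc n) = tpow C V n \<boxdot>\<^bsub>C\<^esub> V"

text \<open>The canonical isomorphism from \<open>tpow C V m \<otimes> tpow C V n\<close> to \<open>tpow C V (m + n)\<close>.\<close>

fun tcat :: "('o, 'a) braided_data \<Rightarrow> 'o \<Rightarrow> nat \<Rightarrow> nat \<Rightarrow> 'a" where
  "tcat C V m 0 = RUnit C (tpow C V m)"
| "tcat C V m (Suc n) =
     (tcat C V m n \<boxtimes>\<^bsub>C\<^esub> Ide C V) \<cdot>\<^bsub>C\<^esub> Inv C (Assoc C (tpow C V m) (tpow C V n) V)"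

text \<open>
  The tensor algebra is the countable coproduct of the tensor powers with multiplication by
  concatenation. For this to make sense the coproduct must be preserved by tensoring with
  objects; this is what makes the multiplication determined by its components.
\<close>

definition is_tensor_algebra ::
    "('o, 'a) braided_data \<Rightarrow> 'o \<Rightarrow> ('o, 'a) algebra_data \<Rightarrow> (nat \<Rightarrow> 'a) \<Rightarrow> bool" where
  "is_tensor_algebra C V T \<iota> \<longleftrightarrow> is_algebra C T \<and>
     is_coproduct C (tpow C V) (carr T) \<iota> \<and>
     (\<forall>X\<in>Obj C.
        is_coproduct C (\<lambda>n. X \<boxdot>\<^bsub>C\<^esub> tpow C V n) (X \<boxdot>\<^bsub>C\<^esub> carr T) (\<lambda>n. Ide C X \<boxtimes>\<^bsub>C\<^esub> \<iota> n) \<and>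
        is_coproduct C (\<lambda>n. tpow C V n \<boxdot>\<^bsub>C\<^esub> X) (carr T \<boxdot>\<^bsub>C\<^esub> X) (\<lambda>n. \<iota> n \<boxtimes>\<^bsub>C\<^esub> Ide C X)) \<and>
     (\<forall>m n. mul T \<cdot>\<^bsub>C\<^esub> (\<iota> m \<boxtimes>\<^bsub>C\<^esub> \<iota> n) = \<iota> (m + n) \<cdot>\<^bsub>C\<^esub> tcat C V m n) \<and>
     uni T = \<iota> 0"

text \<open>
  \<open>adj_braid C V n i\<close> is the braiding acting in the tensor positions \<open>i\<close> and \<open>i + 1\<close> of
  \<open>tpow C V n\<close>, positions being counted from 0. It is only meaningful for \<open>i + 1 < n\<close>.
\<close>

fun adj_braid :: "('o, 'a) braided_data \<Rightarrow> 'o \<Rightarrow> nat \<Rightarrow> nat \<Rightarrow> 'a" where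
  "adj_braid C V (Suc (Suc n)) i =
     (if i = n
      then Inv C (Assoc C (tpow C V n) V V) \<cdot>\<^bsub>C\<^esub> (Ide C (tpow C V n) \<boxtimes>\<^bsub>C\<^esub> Braid C V V) \<cdot>\<^bsub>C\<^esub>
             Assoc C (tpow C V n) V V
      else adj_braid C V (Suc n) i \<boxtimes>\<^bsub>C\<^esub> Ide C V)"
| "adj_braid C V n i = undefined"

text \<open>The word \<open>[i\<^sub>1, \<dots>, i\<^sub>k]\<close> stands for the product \<open>s\<^sub>i\<^sub>1 \<cdots> s\<^sub>i\<^sub>k\<close> of simple transpositions.\<close>

definition word_perm :: "nat list \<Rightarrow> nat \<Rightarrow> nat" where
  "word_perm w = foldr (\<lambda>i p. Transposition.transpose i (Suc i) \<circ> p) w id"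

definition is_expression :: "nat \<Rightarrow> (nat \<Rightarrow> nat) \<Rightarrow> nat list \<Rightarrow> bool" where
  "is_expression n \<sigma> w \<longleftrightarrow> (\<forall>i\<in>set w. Suc i < n) \<and> word_perm w = \<sigma>"

definition is_reduced_expression :: "nat \<Rightarrow> (nat \<Rightarrow> nat) \<Rightarrow> nat list \<Rightarrow> bool" where
  "is_reduced_expression n \<sigma> w \<longleftrightarrow> is_expression n \<sigma> w \<and>
     (\<forall>w'. is_expression n \<sigma> w' \<longrightarrow> length w \<le> length w')"

definition word_braid :: "('o, 'a) braided_data \<Rightarrow> 'o \<Rightarrow> nat \<Rightarrow> nat list \<Rightarrow> 'a" where
  "word_braid C V n w = foldr (\<lambda>i f. adj_braid C V n i \<cdot>\<^bsub>C\<^esub> f) w (Ide C (tpow C V n))"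

definition perm_braid :: "('o, 'a) braided_data \<Rightarrow> 'o \<Rightarrow> nat \<Rightarrow> (nat \<Rightarrow> nat) \<Rightarrow> 'a" where
  "perm_braid C V n \<sigma> = word_braid C V n (SOME w. is_reduced_expression n \<sigma> w)"

text \<open>The product in the additively read group \<open>hom_grp\<close> is a sum of arrows.\<close>

definition braided_factorial :: "('o, 'a) braided_data \<Rightarrow> 'o \<Rightarrow> nat \<Rightarrow> 'a" where
  "braided_factorial C V n =
     finprod (hom_grp C (tpow C V n) (tpow C V n)) (perm_braid C V n) {\<sigma>. \<sigma> permutes {..<n}}"

text \<open>
  \<open>B = TV / \<Oplus>\<^sub>n ker [n,\<Psi>]!\<close> as a quotient algebra: \<open>u\<close> is the map from the coproduct of the
  kernels \<open>k n\<close> to \<open>TV\<close>, and \<open>\<pi>\<close> is its cokernel.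
\<close>

definition is_B_plus :: "('o, 'a) braided_data \<Rightarrow> 'o \<Rightarrow> ('o, 'a) algebra_data \<Rightarrow> bool" where
  "is_B_plus C V B \<longleftrightarrow> (\<exists>T \<iota> k K s u \<pi>.
     is_tensor_algebra C V T \<iota> \<and>
     (\<forall>n. is_kernel C (k n) (braided_factorial C V n)) \<and>
     is_coproduct C (\<lambda>n. Dom C (k n)) K s \<and>
     u \<in> Hom C K (carr T) \<and> (\<forall>n. u \<cdot>\<^bsub>C\<^esub> s n = \<iota> n \<cdot>\<^bsub>C\<^esub> k n) \<and>
     is_algebra C B \<and> is_algebra_hom C T B \<pi> \<and> is_cokernel C \<pi> u)"


section \<open>Graded algebras and braided super tensor products\<close>

text \<open>
  A graded algebra is given by its homogeneous components \<open>gobj x\<close>, the components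
  \<open>gobj x \<otimes> gobj y \<rightarrow> gobj (x + y)\<close> of its product, and its unit into \<open>gobj 0\<close>; \<open>gdeg\<close> is the
  degree that governs the signs.
\<close>

record ('g, 'o, 'a) graded_algebra =
  gobj :: "'g \<Rightarrow> 'o"
  gmul :: "'g \<Rightarrow> 'g \<Rightarrow> 'a"
  guni :: "'a"
  gdeg :: "'g \<Rightarrow> nat"

text \<open>An ungraded algebra, placed in degree 0.\<close>

definition in_degree_zero :: "('o, 'a) algebra_data \<Rightarrow> (unit, 'o, 'a) graded_algebra" where
  "in_degree_zero A =
     \<lparr>gobj = (\<lambda>_. carr A), gmul = (\<lambda>_ _. mul A), guni = uni A, gdeg = (\<lambda>_. 0)\<rparr>"

text \<open>\<open>(-1)\<^sup>n f\<close>\<close>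

definition signed :: "('o, 'a) braided_data \<Rightarrow> nat \<Rightarrow> 'a \<Rightarrow> 'a" where
  "signed C n f = (if even n then f else inv\<^bsub>hom_grp C (Dom C f) (Cod C f)\<^esub> f)"

text \<open>\<open>(a \<otimes> b) \<otimes> (c \<otimes> d) \<rightarrow> (a \<otimes> c) \<otimes> (b \<otimes> d)\<close>, using \<open>\<Psi>\<close> on \<open>b \<otimes> c\<close>.\<close>

definition middle_braid :: "('o, 'a) braided_data \<Rightarrow> 'o \<Rightarrow> 'o \<Rightarrow> 'o \<Rightarrow> 'o \<Rightarrow> 'a" where
  "middle_braid C a b c d =
     Inv C (Assoc C a c (b \<boxdot>\<^bsub>C\<^esub> d)) \<cdot>\<^bsub>C\<^esub>
     (Ide C a \<boxtimes>\<^bsub>C\<^esub> (Assoc C c b d \<cdot>\<^bsub>C\<^esub> (Braid C b c \<boxtimes>\<^bsub>C\<^esub> Ide C d) \<cdot>\<^bsub>C\<^esub> Inv C (Assoc C b c d))) \<cdot>\<^bsub>C\<^esub>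
     Assoc C a b (c \<boxdot>\<^bsub>C\<^esub> d)"

text \<open>The product is \<open>(b \<otimes> c) (b' \<otimes> c') = (-1)\<^bsup>|c| |b'|\<^esup> b \<Psi>(c \<otimes> b') c'\<close>.\<close>

definition super_tensor ::
    "('o, 'a) braided_data \<Rightarrow> ('g, 'o, 'a) graded_algebra \<Rightarrow> ('h, 'o, 'a) graded_algebra \<Rightarrow>
     ('g \<times> 'h, 'o, 'a) graded_algebra" where
  "super_tensor C A D =
     \<lparr>gobj = (\<lambda>(x, y). gobj A x \<boxdot>\<^bsub>C\<^esub> gobj D y),
      gmul = (\<lambda>(x, y) (x', y'). signed C (gdeg D y * gdeg A x')
        ((gmul A x x' \<boxtimes>\<^bsub>C\<^esub> gmul D y y') \<cdot>\<^bsub>C\<^esub>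
         middle_braid C (gobj A x) (gobj D y) (gobj A x') (gobj D y'))),
      guni = (guni A \<boxtimes>\<^bsub>C\<^esub> guni D) \<cdot>\<^bsub>C\<^esub> Inv C (LUnit C (Unit C)),
      gdeg = (\<lambda>(x, y). gdeg A x + gdeg D y)\<rparr>"

text \<open>
  \<open>\<Lambda>(V) = TV / \<langle>Im(id + \<Psi>)\<rangle>\<close> as a graded algebra. Here \<open>L\<close> is the quotient of the algebra
  \<open>TV\<close> by the ideal generated by the image of \<open>id + \<Psi> : V \<otimes> V \<rightarrow> V \<otimes> V\<close> (embedded in \<open>TV\<close> via
  \<open>tpow C V 2 = (1 \<otimes> V) \<otimes> V\<close>). The component in degree \<open>p\<close> is the image in \<open>L\<close> of the \<open>p\<close>-th
  tensor power, with epi-mono factorization \<open>j p \<cdot> e p\<close>, and the product is restricted from \<open>L\<close>.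
\<close>

definition is_Lambda :: "('o, 'a) braided_data \<Rightarrow> 'o \<Rightarrow> (nat, 'o, 'a) graded_algebra \<Rightarrow> bool" where
  "is_Lambda C V \<Lambda> \<longleftrightarrow> (\<exists>T \<iota> k L \<pi> e j.
     is_tensor_algebra C V T \<iota> \<and>
     is_ideal_generated_by_image C T
       (\<iota> 2 \<cdot>\<^bsub>C\<^esub> (Inv C (LUnit C V) \<boxtimes>\<^bsub>C\<^esub> Ide C V) \<cdot>\<^bsub>C\<^esub> Add C (Ide C (V \<boxdot>\<^bsub>C\<^esub> V)) (Braid C V V)) k \<and>
     is_algebra C L \<and> is_algebra_hom C T L \<pi> \<and> is_cokernel C \<pi> k \<and>
     (\<forall>p. is_epi C (e p) \<and> e p \<in> Hom C (tpow C V p) (gobj \<Lambda> p) \<and>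
          is_mono C (j p) \<and> j p \<in> Hom C (gobj \<Lambda> p) (carr L) \<and>
          j p \<cdot>\<^bsub>C\<^esub> e p = \<pi> \<cdot>\<^bsub>C\<^esub> \<iota> p) \<and>
     (\<forall>p q. gmul \<Lambda> p q \<in> Hom C (gobj \<Lambda> p \<boxdot>\<^bsub>C\<^esub> gobj \<Lambda> q) (gobj \<Lambda> (p + q)) \<and>
            j (p + q) \<cdot>\<^bsub>C\<^esub> gmul \<Lambda> p q = mul L \<cdot>\<^bsub>C\<^esub> (j p \<boxtimes>\<^bsub>C\<^esub> j q)) \<and>
     guni \<Lambda> \<in> Hom C (Unit C) (gobj \<Lambda> 0) \<and> j 0 \<cdot>\<^bsub>C\<^esub> guni \<Lambda> = uni L \<and>
     (\<forall>p. gdeg \<Lambda> p = p))"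


section \<open>The bigraded algebra \<open>\<Omega>\<close>\<close>

definition Omega_alg ::
    "('o, 'a) braided_data \<Rightarrow> (nat, 'o, 'a) graded_algebra \<Rightarrow> ('o, 'a) algebra_data \<Rightarrow>
     ((nat \<times> unit) \<times> nat, 'o, 'a) graded_algebra" where
  "Omega_alg C \<Lambda> B = super_tensor C (super_tensor C \<Lambda> (in_degree_zero B)) \<Lambda>"

definition Omega ::
    "('o, 'a) braided_data \<Rightarrow> (nat, 'o, 'a) graded_algebra \<Rightarrow> ('o, 'a) algebra_data \<Rightarrow>
     nat \<Rightarrow> nat \<Rightarrow> 'o" where
  "Omega C \<Lambda> B p q = gobj (Omega_alg C \<Lambda> B) ((p, ()), q)"

text \<open>The component of the product from bidegrees \<open>(p, q)\<close>, \<open>(p', q')\<close> to \<open>(p + p', q + q')\<close>.\<close>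

definition wedge ::
    "('o, 'a) braided_data \<Rightarrow> (nat, 'o, 'a) graded_algebra \<Rightarrow> ('o, 'a) algebra_data \<Rightarrow>
     nat \<Rightarrow> nat \<Rightarrow> nat \<Rightarrow> nat \<Rightarrow> 'a" where
  "wedge C \<Lambda> B p q p' q' = gmul (Omega_alg C \<Lambda> B) ((p, ()), q) ((p', ()), q')"

text \<open>
  The canonical embeddings of \<open>\<Lambda>\<^sup>p \<otimes> B\<close>, \<open>B \<otimes> \<Lambda>\<^sup>q\<close> and \<open>B\<close> (as \<open>1 \<otimes> b \<otimes> 1\<close>) into the algebra,
  landing in bidegrees \<open>(p, 0)\<close>, \<open>(0, q)\<close> and \<open>(0, 0)\<close>.
\<close>

definition left_embed ::
    "('o, 'a) braided_data \<Rightarrow> (nat, 'o, 'a) graded_algebra \<Rightarrow> ('o, 'a) algebra_data \<Rightarrow> nat \<Rightarrow> 'a" where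
  "left_embed C \<Lambda> B p =
     (Ide C (gobj \<Lambda> p \<boxdot>\<^bsub>C\<^esub> carr B) \<boxtimes>\<^bsub>C\<^esub> guni \<Lambda>) \<cdot>\<^bsub>C\<^esub> Inv C (RUnit C (gobj \<Lambda> p \<boxdot>\<^bsub>C\<^esub> carr B))"

definition right_embed ::
    "('o, 'a) braided_data \<Rightarrow> (nat, 'o, 'a) graded_algebra \<Rightarrow> ('o, 'a) algebra_data \<Rightarrow> nat \<Rightarrow> 'a" where
  "right_embed C \<Lambda> B q =
     ((guni \<Lambda> \<boxtimes>\<^bsub>C\<^esub> Ide C (carr B)) \<cdot>\<^bsub>C\<^esub> Inv C (LUnit C (carr B))) \<boxtimes>\<^bsub>C\<^esub> Ide C (gobj \<Lambda> q)"

definition middle_embed ::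
    "('o, 'a) braided_data \<Rightarrow> (nat, 'o, 'a) graded_algebra \<Rightarrow> ('o, 'a) algebra_data \<Rightarrow> 'a" where
  "middle_embed C \<Lambda> B =
     (((guni \<Lambda> \<boxtimes>\<^bsub>C\<^esub> Ide C (carr B)) \<cdot>\<^bsub>C\<^esub> Inv C (LUnit C (carr B))) \<boxtimes>\<^bsub>C\<^esub> guni \<Lambda>) \<cdot>\<^bsub>C\<^esub>
     Inv C (RUnit C (carr B))"

definition Omega_bimodule ::
    "('o, 'a) braided_data \<Rightarrow> (nat, 'o, 'a) graded_algebra \<Rightarrow> ('o, 'a) algebra_data \<Rightarrow>
     nat \<Rightarrow> nat \<Rightarrow> ('o, 'a) bimodule_data" where
  "Omega_bimodule C \<Lambda> B p q =
     \<lparr>mobj = Omega C \<Lambda> B p q,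
      lact = wedge C \<Lambda> B 0 0 p q \<cdot>\<^bsub>C\<^esub> (middle_embed C \<Lambda> B \<boxtimes>\<^bsub>C\<^esub> Ide C (Omega C \<Lambda> B p q)),
      ract = wedge C \<Lambda> B p q 0 0 \<cdot>\<^bsub>C\<^esub> (Ide C (Omega C \<Lambda> B p q) \<boxtimes>\<^bsub>C\<^esub> middle_embed C \<Lambda> B)\<rparr>"

text \<open>
  \<open>id \<otimes> (product of B) \<otimes> id : (\<Lambda>\<^sup>p \<otimes> B) \<otimes> (B \<otimes> \<Lambda>\<^sup>q) \<rightarrow> (\<Lambda>\<^sup>p \<otimes> B) \<otimes> \<Lambda>\<^sup>q\<close>. It induces the
  identification of \<open>\<Lambda>\<^sup>p \<otimes> (B \<otimes>\<^sub>B B) \<otimes> \<Lambda>\<^sup>q\<close> with \<open>\<Lambda>\<^sup>p \<otimes> B \<otimes> \<Lambda>\<^sup>q\<close>.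
\<close>

definition middle_mult ::
    "('o, 'a) braided_data \<Rightarrow> (nat, 'o, 'a) graded_algebra \<Rightarrow> ('o, 'a) algebra_data \<Rightarrow>
     nat \<Rightarrow> nat \<Rightarrow> 'a" where
  "middle_mult C \<Lambda> B p q = (let x = gobj \<Lambda> p; b = carr B; y = gobj \<Lambda> q in
     ((Ide C x \<boxtimes>\<^bsub>C\<^esub> mul B) \<boxtimes>\<^bsub>C\<^esub> Ide C y) \<cdot>\<^bsub>C\<^esub> (Assoc C x b b \<boxtimes>\<^bsub>C\<^esub> Ide C y) \<cdot>\<^bsub>C\<^esub>
     Inv C (Assoc C (x \<boxdot>\<^bsub>C\<^esub> b) b y))"

end

theory Submission
  imports Defs
begin

text \<open>
  Write \<open>x\<close>, \<open>b\<close>, \<open>y\<close> for elements of \<open>\<Lambda>\<^sup>p\<close>, \<open>B\<close>, \<open>\<Lambda>\<^sup>q\<close>, regarded as elements of \<open>\<Omega>\<close>. Since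
  \<open>1 \<rightarrow> \<Lambda>\<^sup>0\<close> is an isomorphism, \<open>\<Omega>\<^sup>p\<^sup>,\<^sup>0\<close> is freely generated over \<open>B\<close> by the products \<open>x b\<close> and
  \<open>\<Omega>\<^sup>0\<^sup>,\<^sup>q\<close> by the products \<open>b y\<close>, and \<open>x \<otimes> b \<otimes> y \<mapsto> x b y\<close> is the identity of \<open>\<Omega>\<^sup>p\<^sup>,\<^sup>q\<close>. For
  bimodules that are free in this way the coequalizer defining \<open>\<otimes>\<^sub>B\<close> is split. As
  \<open>b x = \<Psi>(b \<otimes> x)\<close>, \<open>y b = \<Psi>(y \<otimes> b)\<close> and \<open>y x = \<plusminus>\<Psi>(y \<otimes> x)\<close> with \<open>\<Psi>\<close> invertible, the products in
  the opposite order \<open>y b x\<close> are free generators as well, which gives the second isomorphism.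
\<close>

section \<open>Arrows in categories and monoidal categories\<close>

text \<open>The tensor product is only additive, not exact, so a coequalizer need not survive
  tensoring with B. A splitting is an equation between arrows and therefore does survive; it is what
  makes the comparison of two models of a relative tensor product linear over B. The category is not
  strict, and a direct proof that a braided tensor product of algebras is associative would be
  buried under associators. Hence all identities are proved for arrows acting on a nested product
  with a spectator object w at its end; finally w = 1 is chosen and removed, since tensoring with 1
  is faithful. That 1 \<rightarrow> \<Lambda>^0 is an isomorphism is a real step: \<Lambda>^0 is
  only given as the image of 1 in a quotient of TV, and this image could collapse a priori. The
  augmentation of TV excludes it. To pass from x b y to y b x, neighbouring generators are exchanged
  one pair at a time. Each exchange composes a product map with an invertible braiding and each
  change of brackets with an associator, so invertibility persists and no explicit formula for y b x
  is required.\<close>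

context category
begin

lemma homI: "\<lbrakk>f \<in> Arr C; Dom C f = x; Cod C f = y\<rbrakk> \<Longrightarrow> f \<in> Hom C x y"
  by (simp add: Hom_def)

lemma homD:
  assumes "f \<in> Hom C x y"
  shows "f \<in> Arr C" "Dom C f = x" "Cod C f = y" "x \<in> Obj C" "y \<in> Obj C"
  using assms dom_cod by (auto simp: Hom_def)

lemma arr_hom: "f \<in> Arr C \<Longrightarrow> f \<in> Hom C (Dom C f) (Cod C f)"
  by (simp add: Hom_def)

lemma obj_dom_cod [simp]: "f \<in> Arr C \<Longrightarrow> Dom C f \<in> Obj C" "f \<in> Arr C \<Longrightarrow> Cod C f \<in> Obj C"
  using dom_cod by auto

lemma ide_arr [simp]:
  assumes "x \<in> Obj C"
  shows "Ide C x \<in> Arr C" "Dom C (Ide C x) = x" "Cod C (Ide C x) = x"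
  using homD[OF ide_hom[OF assms]] by auto

lemma comp_arr [simp]:
  assumes "f \<in> Arr C" "g \<in> Arr C" "Dom C g = Cod C f"
  shows "g \<cdot> f \<in> Arr C" "Dom C (g \<cdot> f) = Dom C f" "Cod C (g \<cdot> f) = Cod C g"
  using homD[OF comp_hom[OF arr_hom[OF assms(1)], of g]] assms by (auto simp: Hom_def)

text \<open>The axioms are phrased with \<open>Hom\<close> and leave the end objects as unknowns.
  With \<open>Dom\<close> and \<open>Cod\<close> all side conditions become equations that rewriting
  can settle, and composites are normalised to right-nested form.\<close>

lemma comp_assoc' [simp]:
  "\<lbrakk>f \<in> Arr C; g \<in> Arr C; h \<in> Arr C; Dom C g = Cod C f; Dom C h = Cod C g\<rbrakk>
    \<Longrightarrow> (h \<cdot> g) \<cdot> f = h \<cdot> g \<cdot> f"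
  by (rule comp_assoc) (auto simp: Hom_def)

lemma comp_ide [simp]:
  "\<lbrakk>f \<in> Arr C; Cod C f = y\<rbrakk> \<Longrightarrow> Ide C y \<cdot> f = f"
  "\<lbrakk>f \<in> Arr C; Dom C f = x\<rbrakk> \<Longrightarrow> f \<cdot> Ide C x = f"
  using comp_ide_left comp_ide_right by (auto simp: Hom_def)

text \<open>In a right-nested composite \<open>a \<cdot> b \<cdot> t\<close> the subterm
  \<open>a \<cdot> b\<close> does not occur, so an equation for it cannot be used for rewriting.
  \<open>comp_apply[OF eq]\<close> is the form of \<open>eq\<close> that can.\<close>

lemma comp_apply:
  "\<lbrakk>a \<cdot> b = c; a \<in> Arr C; b \<in> Arr C; t \<in> Arr C; Dom C a = Cod C b; Dom C b = Cod C t\<rbrakk>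
    \<Longrightarrow> a \<cdot> b \<cdot> t = c \<cdot> t"
  by (metis comp_assoc')

lemma is_inverse_unique:
  assumes "is_inverse C f g" "is_inverse C f h"
  shows "g = h"
proof -
  have gh: "f \<in> Arr C" "g \<in> Arr C" "Dom C g = Cod C f" "Cod C g = Dom C f"
      "h \<in> Arr C" "Dom C h = Cod C f" "Cod C h = Dom C f"
      and e: "g \<cdot> f = Ide C (Dom C f)" "f \<cdot> h = Ide C (Cod C f)"
    using assms by (auto simp: is_inverse_def Hom_def)
  have "g = g \<cdot> (f \<cdot> h)"
    using gh e by simp
  also have "\<dots> = (g \<cdot> f) \<cdot> h"
    using gh by simp
  also have "\<dots> = h"
    using gh e by simp
  finally show ?thesis .
qed

lemma inv_inverse:
  assumes "is_invertible C f"
  shows "is_inverse C f (Inv C f)"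
  using assms is_inverse_unique unfolding is_invertible_def Inv_def by (metis theI)

lemma inv_arr [simp]:
  assumes "is_invertible C f"
  shows "Inv C f \<in> Arr C" "Dom C (Inv C f) = Cod C f" "Cod C (Inv C f) = Dom C f"
    "Inv C f \<cdot> f = Ide C (Dom C f)" "f \<cdot> Inv C f = Ide C (Cod C f)"
  using inv_inverse[OF assms] by (auto simp: is_inverse_def Hom_def)

lemma invertible_arr: "is_invertible C f \<Longrightarrow> f \<in> Arr C"
  by (auto simp: is_invertible_def is_inverse_def)

lemma invertibleI:
  "\<lbrakk>f \<in> Arr C; g \<in> Arr C; Dom C g = Cod C f; Cod C g = Dom C f;
    g \<cdot> f = Ide C (Dom C f); f \<cdot> g = Ide C (Cod C f)\<rbrakk> \<Longrightarrow> is_invertible C f"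
  by (auto simp: is_invertible_def is_inverse_def Hom_def)

lemma inv_comp [simp]:
  assumes "is_invertible C f" "t \<in> Arr C"
  shows "Cod C t = Dom C f \<Longrightarrow> Inv C f \<cdot> f \<cdot> t = t" "Cod C t = Cod C f \<Longrightarrow> f \<cdot> Inv C f \<cdot> t = t"
  using assms invertible_arr[OF assms(1)] by (auto simp: comp_apply[OF inv_arr(4)] comp_apply[OF inv_arr(5)])

lemma invertible_comp [simp]:
  assumes "is_invertible C f" "is_invertible C g" "Dom C g = Cod C f"
  shows "is_invertible C (g \<cdot> f)"
  using assms invertible_arr[OF assms(1)] invertible_arr[OF assms(2)]
  by (intro invertibleI[where g = "Inv C f \<cdot> Inv C g"]) auto

lemma invertible_ide [simp]: "x \<in> Obj C \<Longrightarrow> is_invertible C (Ide C x)"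
  by (rule invertibleI[where g = "Ide C x"]) auto

lemma invertible_inv [simp]: "is_invertible C f \<Longrightarrow> is_invertible C (Inv C f)"
  by (rule invertibleI[where g = f]) (auto simp: invertible_arr)

text \<open>The usual exit from a calculation: an equation is proved after composing with an
  invertible coherence arrow, and this rule strips that arrow off.\<close>

lemma epi_cancel:
  assumes "is_invertible C e" "f \<cdot> e = g \<cdot> e" "f \<in> Arr C" "g \<in> Arr C" "Dom C f = Cod C e" "Dom C g = Cod C e"
  shows "f = g"
proof -
  have "(f \<cdot> e) \<cdot> Inv C e = (g \<cdot> e) \<cdot> Inv C e"
    using assms by simp
  then show ?thesis
    using assms(1,3-) invertible_arr[OF assms(1)] by simp
qed

lemma mono_cancel:
  assumes "is_invertible C e" "e \<cdot> f = e \<cdot> g" "f \<in> Arr C" "g \<in> Arr C" "Cod C f = Dom C e" "Cod C g = Dom C e"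
  shows "f = g"
proof -
  have "Inv C e \<cdot> e \<cdot> f = Inv C e \<cdot> e \<cdot> g"
    using assms by simp
  then show ?thesis
    using assms(1,3-) by simp
qed

lemma mono_eq:
  assumes "is_mono C j" "j \<cdot> f = j \<cdot> g" "f \<in> Arr C" "g \<in> Arr C" "Cod C f = Dom C j" "Cod C g = Dom C j"
    "Dom C f = Dom C g"
  shows "f = g"
proof -
  have "f \<in> Hom C (Dom C f) (Dom C j)" "g \<in> Hom C (Dom C f) (Dom C j)"
    using assms by (auto intro: homI)
  then show ?thesis
    using assms(1,2) obj_dom_cod(1)[OF assms(3)] unfolding is_mono_def by blast
qed

lemma epi_eq:
  assumes "is_epi C j" "f \<cdot> j = g \<cdot> j" "f \<in> Arr C" "g \<in> Arr C" "Dom C f = Cod C j" "Dom C g = Cod C j"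
    "Cod C f = Cod C g"
  shows "f = g"
proof -
  have "f \<in> Hom C (Cod C j) (Cod C f)" "g \<in> Hom C (Cod C j) (Cod C f)"
    using assms by (auto intro: homI)
  then show ?thesis
    using assms(1,2) obj_dom_cod(2)[OF assms(3)] unfolding is_epi_def by blast
qed

lemma coproduct_universal:
  assumes "is_coproduct C D S s" "x \<in> Obj C" "\<And>i. f i \<in> Hom C (D i) x"
  shows "\<exists>!h. h \<in> Hom C S x \<and> (\<forall>i. h \<cdot> s i = f i)"
  using assms by (simp add: is_coproduct_def)

lemma coproduct_eq:
  assumes "is_coproduct C D S s" "f \<in> Hom C S x" "g \<in> Hom C S x" "\<And>i. f \<cdot> s i = g \<cdot> s i"
  shows "f = g"
proof -
  have "\<forall>i. f \<cdot> s i \<in> Hom C (D i) x" "x \<in> Obj C"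
    using assms(1,2) comp_hom homD(5) unfolding is_coproduct_def by blast+
  then have "\<exists>!h. h \<in> Hom C S x \<and> (\<forall>i. h \<cdot> s i = f \<cdot> s i)"
    by (intro coproduct_universal[OF assms(1)]) auto
  then show ?thesis
    using assms(2-4) by auto
qed

end


section \<open>Typing and naturality rules in a monoidal category\<close>

context monoidal_category
begin

declare unit_obj [simp] tensor_obj [simp]

lemma tensor_arr [simp]:
  assumes "f \<in> Arr C" "g \<in> Arr C"
  shows "f \<boxtimes> g \<in> Arr C" "Dom C (f \<boxtimes> g) = Dom C f \<boxdot> Dom C g" "Cod C (f \<boxtimes> g) = Cod C f \<boxdot> Cod C g"
  using homD[OF tensor_hom[OF arr_hom[OF assms(1)] arr_hom[OF assms(2)]]] by auto

declare tensor_ide [simp]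

lemma tensor_comp':
  "\<lbrakk>f \<in> Arr C; g \<in> Arr C; f' \<in> Arr C; g' \<in> Arr C; Dom C g = Cod C f; Dom C g' = Cod C f'\<rbrakk> \<Longrightarrow>
    (g \<boxtimes> g') \<cdot> (f \<boxtimes> f') = (g \<cdot> f) \<boxtimes> (g' \<cdot> f')"
  by (rule tensor_comp[symmetric]) (auto simp: Hom_def)

lemma assoc_arr [simp]:
  assumes "x \<in> Obj C" "y \<in> Obj C" "z \<in> Obj C"
  shows "Assoc C x y z \<in> Arr C" "Dom C (Assoc C x y z) = x \<boxdot> y \<boxdot> z"
    "Cod C (Assoc C x y z) = x \<boxdot> (y \<boxdot> z)" "is_invertible C (Assoc C x y z)"
  using assoc_hom[OF assms] by (auto simp: Hom_def)

lemma lunit_arr [simp]: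
  assumes "x \<in> Obj C"
  shows "LUnit C x \<in> Arr C" "Dom C (LUnit C x) = Unit C \<boxdot> x" "Cod C (LUnit C x) = x"
    "is_invertible C (LUnit C x)"
  using lunit_hom[OF assms] by (auto simp: Hom_def)

lemma runit_arr [simp]:
  assumes "x \<in> Obj C"
  shows "RUnit C x \<in> Arr C" "Dom C (RUnit C x) = x \<boxdot> Unit C" "Cod C (RUnit C x) = x"
    "is_invertible C (RUnit C x)"
  using runit_hom[OF assms] by (auto simp: Hom_def)

lemma invertible_tensor [simp]:
  assumes "is_invertible C f" "is_invertible C g"
  shows "is_invertible C (f \<boxtimes> g)"
  using assms invertible_arr[OF assms(1)] invertible_arr[OF assms(2)]
  by (intro invertibleI[where g = "Inv C f \<boxtimes> Inv C g"]) (auto simp: tensor_comp')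

lemma assoc_natural':
  "\<lbrakk>f \<in> Arr C; g \<in> Arr C; h \<in> Arr C; Cod C f = x; Cod C g = y; Cod C h = z\<rbrakk> \<Longrightarrow>
    Assoc C x y z \<cdot> (f \<boxtimes> g \<boxtimes> h) = (f \<boxtimes> (g \<boxtimes> h)) \<cdot> Assoc C (Dom C f) (Dom C g) (Dom C h)"
  using assoc_natural[OF arr_hom arr_hom arr_hom] by blast

lemma lunit_natural':
  "\<lbrakk>f \<in> Arr C; Cod C f = y\<rbrakk> \<Longrightarrow> LUnit C y \<cdot> (Ide C (Unit C) \<boxtimes> f) = f \<cdot> LUnit C (Dom C f)"
  using lunit_natural[OF arr_hom] by blast

lemma runit_natural':
  "\<lbrakk>f \<in> Arr C; Cod C f = y\<rbrakk> \<Longrightarrow> RUnit C y \<cdot> (f \<boxtimes> Ide C (Unit C)) = f \<cdot> RUnit C (Dom C f)"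
  using runit_natural[OF arr_hom] by blast


end


section \<open>Actions on right-nested tensor products\<close>

context monoidal_category
begin

text \<open>A product of two nontrivial arrows splits into one-sided actions in two orders. Working
  with one-sided actions only, in the order fixed by \<open>tensor_whisk\<close> and
  \<open>whisk_exchange\<close>, gives composites a common shape.\<close>

definition lwhisk :: "'a \<Rightarrow> 'b \<Rightarrow> 'b"  (infixr "\<rhd>" 75)
  where "x \<rhd> f = Ide C x \<boxtimes> f"

definition rwhisk :: "'b \<Rightarrow> 'a \<Rightarrow> 'b"  (infixl "\<lhd>" 75)
  where "f \<lhd> w = f \<boxtimes> Ide C w"

lemma lwhisk_arr [simp]:
  assumes "x \<in> Obj C" "f \<in> Arr C"
  shows "x \<rhd> f \<in> Arr C" "Dom C (x \<rhd> f) = x \<boxdot> Dom C f" "Cod C (x \<rhd> f) = x \<boxdot> Cod C f"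
  using assms by (auto simp: lwhisk_def)

lemma rwhisk_arr [simp]:
  assumes "x \<in> Obj C" "f \<in> Arr C"
  shows "f \<lhd> x \<in> Arr C" "Dom C (f \<lhd> x) = Dom C f \<boxdot> x" "Cod C (f \<lhd> x) = Cod C f \<boxdot> x"
  using assms by (auto simp: rwhisk_def)

lemma whisk_ide [simp]:
  assumes "x \<in> Obj C" "y \<in> Obj C"
  shows "x \<rhd> Ide C y = Ide C (x \<boxdot> y)" "Ide C x \<lhd> y = Ide C (x \<boxdot> y)"
  using assms by (auto simp: lwhisk_def rwhisk_def)

lemma lwhisk_comp:
  "\<lbrakk>x \<in> Obj C; f \<in> Arr C; g \<in> Arr C; Dom C g = Cod C f\<rbrakk> \<Longrightarrow> x \<rhd> (g \<cdot> f) = (x \<rhd> g) \<cdot> (x \<rhd> f)"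
  by (simp add: lwhisk_def tensor_comp')

lemma lwhisk_fuse:
  assumes "x \<in> Obj C" "f \<in> Arr C" "g \<in> Arr C" "Dom C g = Cod C f"
  shows "(x \<rhd> g) \<cdot> (x \<rhd> f) = x \<rhd> (g \<cdot> f)"
    "\<lbrakk>t \<in> Arr C; Cod C t = x \<boxdot> Dom C f\<rbrakk> \<Longrightarrow> (x \<rhd> g) \<cdot> (x \<rhd> f) \<cdot> t = (x \<rhd> (g \<cdot> f)) \<cdot> t"
  using assms by (simp_all add: lwhisk_comp)

lemma rwhisk_comp:
  "\<lbrakk>x \<in> Obj C; f \<in> Arr C; g \<in> Arr C; Dom C g = Cod C f\<rbrakk> \<Longrightarrow> (g \<cdot> f) \<lhd> x = (g \<lhd> x) \<cdot> (f \<lhd> x)"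
  by (simp add: rwhisk_def tensor_comp')

lemma invertible_whisk [simp]:
  "\<lbrakk>x \<in> Obj C; is_invertible C f\<rbrakk> \<Longrightarrow> is_invertible C (x \<rhd> f)"
  "\<lbrakk>x \<in> Obj C; is_invertible C f\<rbrakk> \<Longrightarrow> is_invertible C (f \<lhd> x)"
  by (simp_all add: lwhisk_def rwhisk_def)

lemma tensor_whisk:
  "\<lbrakk>f \<in> Arr C; g \<in> Arr C\<rbrakk> \<Longrightarrow> f \<boxtimes> g = (f \<lhd> Cod C g) \<cdot> (Dom C f \<rhd> g)"
  by (simp add: lwhisk_def rwhisk_def tensor_comp')

lemma whisk_exchange:
  "\<lbrakk>f \<in> Arr C; g \<in> Arr C; Cod C f = x; Dom C g = w\<rbrakk>
    \<Longrightarrow> (x \<rhd> g) \<cdot> (f \<lhd> w) = (f \<lhd> Cod C g) \<cdot> (Dom C f \<rhd> g)"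
  by (auto simp add: lwhisk_def rwhisk_def tensor_comp')

lemma assoc_rr:
  "\<lbrakk>f \<in> Arr C; y \<in> Obj C; z \<in> Obj C; Cod C f = x\<rbrakk> \<Longrightarrow>
    Assoc C x y z \<cdot> ((f \<lhd> y) \<lhd> z) = (f \<lhd> (y \<boxdot> z)) \<cdot> Assoc C (Dom C f) y z"
  using assoc_natural'[of f "Ide C y" "Ide C z"] by (simp add: rwhisk_def)

lemma assoc_lr:
  "\<lbrakk>f \<in> Arr C; x \<in> Obj C; z \<in> Obj C; Cod C f = y\<rbrakk> \<Longrightarrow>
    Assoc C x y z \<cdot> ((x \<rhd> f) \<lhd> z) = (x \<rhd> (f \<lhd> z)) \<cdot> Assoc C x (Dom C f) z"
  using assoc_natural'[of "Ide C x" f "Ide C z"] by (simp add: rwhisk_def lwhisk_def)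

lemma assoc_ll:
  "\<lbrakk>f \<in> Arr C; x \<in> Obj C; y \<in> Obj C; Cod C f = z\<rbrakk> \<Longrightarrow>
    Assoc C x y z \<cdot> ((x \<boxdot> y) \<rhd> f) = (x \<rhd> y \<rhd> f) \<cdot> Assoc C x y (Dom C f)"
  using assoc_natural'[of "Ide C x" "Ide C y" f x y z] by (simp add: lwhisk_def)

lemma lunit_whisk:
  "\<lbrakk>f \<in> Arr C; Cod C f = y\<rbrakk> \<Longrightarrow> LUnit C y \<cdot> (Unit C \<rhd> f) = f \<cdot> LUnit C (Dom C f)"
  by (simp add: lunit_natural' lwhisk_def)

lemma runit_whisk:
  "\<lbrakk>f \<in> Arr C; Cod C f = y\<rbrakk> \<Longrightarrow> RUnit C y \<cdot> (f \<lhd> Unit C) = f \<cdot> RUnit C (Dom C f)"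
  by (simp add: runit_natural' rwhisk_def)

lemma pentagon_whisk:
  "\<lbrakk>w \<in> Obj C; x \<in> Obj C; y \<in> Obj C; z \<in> Obj C\<rbrakk> \<Longrightarrow>
    (w \<rhd> Assoc C x y z) \<cdot> Assoc C w (x \<boxdot> y) z \<cdot> (Assoc C w x y \<lhd> z) =
    Assoc C w x (y \<boxdot> z) \<cdot> Assoc C (w \<boxdot> x) y z"
  by (simp add: pentagon lwhisk_def rwhisk_def)

lemma triangle_whisk:
  "\<lbrakk>x \<in> Obj C; y \<in> Obj C\<rbrakk> \<Longrightarrow> (x \<rhd> LUnit C y) \<cdot> Assoc C x (Unit C) y = RUnit C x \<lhd> y"
  by (simp add: triangle lwhisk_def rwhisk_def)

lemma pentagon_apply:
  "\<lbrakk>w \<in> Obj C; x \<in> Obj C; y \<in> Obj C; z \<in> Obj C; t \<in> Arr C; Cod C t = w \<boxdot> x \<boxdot> y \<boxdot> z\<rbrakk> \<Longrightarrow>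
    (w \<rhd> Assoc C x y z) \<cdot> Assoc C w (x \<boxdot> y) z \<cdot> (Assoc C w x y \<lhd> z) \<cdot> t =
    Assoc C w x (y \<boxdot> z) \<cdot> Assoc C (w \<boxdot> x) y z \<cdot> t"
  using arg_cong[OF pentagon_whisk, of w x y z "\<lambda>s. s \<cdot> t"] by simp

text \<open>The functor 1 \<otimes> - is faithful, because \<open>LUnit\<close> identifies it
  naturally with the identity.\<close>

lemma lwhisk_unit_cancel:
  assumes "Unit C \<rhd> f = Unit C \<rhd> g" "f \<in> Arr C" "g \<in> Arr C" "Dom C f = Dom C g" "Cod C f = Cod C g"
  shows "f = g"
proof (rule epi_cancel)
  show "f \<cdot> LUnit C (Dom C f) = g \<cdot> LUnit C (Dom C f)"
    using assms lunit_whisk[of f] lunit_whisk[of g] by simp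
qed (use assms in auto)

text \<open>The mirror image, through \<open>RUnit\<close>. This rule discards the spectator object
  once it has been specialised to 1.\<close>

lemma rwhisk_unit_cancel:
  assumes "f \<lhd> Unit C = g \<lhd> Unit C" "f \<in> Arr C" "g \<in> Arr C" "Dom C f = Dom C g" "Cod C f = Cod C g"
  shows "f = g"
proof (rule epi_cancel)
  show "f \<cdot> RUnit C (Dom C f) = g \<cdot> RUnit C (Dom C f)"
    using assms runit_whisk[of f] runit_whisk[of g] by simp
qed (use assms in auto)

text \<open>Kelly's observation that this unit law already follows from pentagon and triangle: after
  applying 1 \<otimes> - and precomposing with associators, the pentagon for 1, 1, x, y becomes
  applicable.\<close>

lemma lunit_tensor:
  assumes [simp]: "x \<in> Obj C" "y \<in> Obj C"
  shows "LUnit C (x \<boxdot> y) \<cdot> Assoc C (Unit C) x y = LUnit C x \<lhd> y"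
proof (rule lwhisk_unit_cancel)
  let ?u = "Unit C"
  let ?e = "Assoc C ?u (?u \<boxdot> x) y \<cdot> (Assoc C ?u ?u x \<lhd> y)"
  have "(?u \<rhd> (LUnit C (x \<boxdot> y) \<cdot> Assoc C ?u x y)) \<cdot> ?e =
      (?u \<rhd> LUnit C (x \<boxdot> y)) \<cdot> Assoc C ?u ?u (x \<boxdot> y) \<cdot> Assoc C (?u \<boxdot> ?u) x y"
    by (simp add: lwhisk_comp pentagon_whisk)
  also have "\<dots> = (RUnit C ?u \<lhd> (x \<boxdot> y)) \<cdot> Assoc C (?u \<boxdot> ?u) x y"
    by (simp add: comp_apply[OF triangle_whisk])
  also have "\<dots> = Assoc C ?u x y \<cdot> ((?u \<rhd> LUnit C x) \<cdot> Assoc C ?u ?u x) \<lhd> y"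
    by (simp only: triangle_whisk assms unit_obj) (simp add: assoc_rr)
  also have "\<dots> = (?u \<rhd> (LUnit C x \<lhd> y)) \<cdot> ?e"
    by (simp add: rwhisk_comp comp_apply[OF assoc_lr])
  finally show "?u \<rhd> (LUnit C (x \<boxdot> y) \<cdot> Assoc C ?u x y) = ?u \<rhd> (LUnit C x \<lhd> y)"
    by (rule epi_cancel[rotated]) auto
qed auto

text \<open>
  The coherence isomorphisms disappear from calculations when every arrow is made to act at the
  head of a right-nested product \<open>x\<^sub>1 \<otimes> (x\<^sub>2 \<otimes> (\<dots> \<otimes> w))\<close>: an arrow \<open>f : x \<otimes> y \<rightarrow> z\<close> acts as
  \<open>x \<otimes> (y \<otimes> w) \<rightarrow> z \<otimes> w\<close>, an arrow \<open>u : 1 \<rightarrow> z\<close> as \<open>w \<rightarrow> z \<otimes> w\<close>, both naturally in \<open>w\<close>.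
\<close>

definition mact :: "'b \<Rightarrow> 'a \<Rightarrow> 'a \<Rightarrow> 'a \<Rightarrow> 'b"
  where "mact f x y w = (f \<lhd> w) \<cdot> Inv C (Assoc C x y w)"

definition uact :: "'b \<Rightarrow> 'a \<Rightarrow> 'b"
  where "uact u w = (u \<lhd> w) \<cdot> Inv C (LUnit C w)"

lemma mact_arr [simp]:
  assumes "x \<in> Obj C" "y \<in> Obj C" "w \<in> Obj C" "f \<in> Arr C" "Dom C f = x \<boxdot> y"
  shows "mact f x y w \<in> Arr C" "Dom C (mact f x y w) = x \<boxdot> (y \<boxdot> w)"
    "Cod C (mact f x y w) = Cod C f \<boxdot> w" "mact f x y w \<cdot> Assoc C x y w = f \<lhd> w"
  using assms by (auto simp: mact_def)

lemma uact_arr [simp]: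
  assumes "w \<in> Obj C" "u \<in> Arr C" "Dom C u = Unit C"
  shows "uact u w \<in> Arr C" "Dom C (uact u w) = w"
    "Cod C (uact u w) = Cod C u \<boxdot> w" "uact u w \<cdot> LUnit C w = u \<lhd> w"
  using assms by (auto simp: uact_def)

lemma mact_natural:
  assumes [simp]: "x \<in> Obj C" "y \<in> Obj C" "h \<in> Arr C" "f \<in> Arr C" "Dom C f = x \<boxdot> y" "Cod C f = z"
    "Dom C h = w"
  shows "(z \<rhd> h) \<cdot> mact f x y w = mact f x y (Cod C h) \<cdot> (x \<rhd> y \<rhd> h)"
proof -
  have [simp]: "w \<in> Obj C" "z \<in> Obj C"
    using obj_dom_cod[OF assms(3)] obj_dom_cod[OF assms(4)] by simp_all
  have "(x \<rhd> y \<rhd> h) \<cdot> Assoc C x y w = Assoc C x y (Cod C h) \<cdot> ((x \<boxdot> y) \<rhd> h)"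
    by (simp add: assoc_ll)
  then have eq: "((z \<rhd> h) \<cdot> mact f x y w) \<cdot> Assoc C x y w =
      (mact f x y (Cod C h) \<cdot> (x \<rhd> y \<rhd> h)) \<cdot> Assoc C x y w"
    by (simp add: whisk_exchange comp_apply[OF mact_arr(4)])
  show ?thesis
    by (rule epi_cancel[OF _ eq]) auto
qed

lemma uact_natural:
  assumes [simp]: "h \<in> Arr C" "u \<in> Arr C" "Dom C u = Unit C" "Cod C u = z" "Dom C h = w"
  shows "(z \<rhd> h) \<cdot> uact u w = uact u (Cod C h) \<cdot> h"
proof -
  have [simp]: "w \<in> Obj C" "z \<in> Obj C"
    using obj_dom_cod[OF assms(1)] obj_dom_cod[OF assms(2)] by simp_all
  have "h \<cdot> LUnit C w = LUnit C (Cod C h) \<cdot> (Unit C \<rhd> h)"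
    by (simp add: lunit_whisk)
  then have eq: "((z \<rhd> h) \<cdot> uact u w) \<cdot> LUnit C w = (uact u (Cod C h) \<cdot> h) \<cdot> LUnit C w"
    by (simp add: whisk_exchange comp_apply[OF uact_arr(4)])
  show ?thesis
    by (rule epi_cancel[OF _ eq]) auto
qed

text \<open>With \<open>mact_comp_right\<close> this is the dictionary between composites of actions
  and actions of composites. It is read in both directions: to start from an algebra law, and to
  return to one at the end.\<close>

lemma mact_comp_left:
  assumes [simp]: "x \<in> Obj C" "y \<in> Obj C" "z \<in> Obj C" "w \<in> Obj C" "f \<in> Arr C" "Dom C f = x \<boxdot> y"
    "g \<in> Arr C" "Dom C g = Cod C f \<boxdot> z"
  shows "mact g (Cod C f) z w \<cdot> mact f x y (z \<boxdot> w) \<cdot> Assoc C x y (z \<boxdot> w) \<cdot> Assoc C (x \<boxdot> y) z w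
    = (g \<cdot> (f \<lhd> z)) \<lhd> w"
proof -
  have "(f \<lhd> (z \<boxdot> w)) \<cdot> Assoc C (x \<boxdot> y) z w = Assoc C (Cod C f) z w \<cdot> ((f \<lhd> z) \<lhd> w)"
    by (simp add: assoc_rr)
  then show ?thesis
    by (simp add: comp_apply[OF mact_arr(4)] rwhisk_comp)
qed

lemma mact_comp_right:
  assumes [simp]: "x \<in> Obj C" "y \<in> Obj C" "z \<in> Obj C" "w \<in> Obj C" "f \<in> Arr C" "Dom C f = y \<boxdot> z"
    "g \<in> Arr C" "Dom C g = x \<boxdot> Cod C f"
  shows "mact g x (Cod C f) w \<cdot> (x \<rhd> mact f y z w) \<cdot> Assoc C x y (z \<boxdot> w) \<cdot> Assoc C (x \<boxdot> y) z w
    = (g \<cdot> (x \<rhd> f) \<cdot> Assoc C x y z) \<lhd> w"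
proof -
  have "(x \<rhd> (f \<lhd> w)) \<cdot> Assoc C x (y \<boxdot> z) w = Assoc C x (Cod C f) w \<cdot> ((x \<rhd> f) \<lhd> w)"
    by (simp add: assoc_lr)
  from comp_apply[OF this] show ?thesis
    by (simp add: rwhisk_comp comp_apply[OF mact_arr(4)] lwhisk_fuse flip: pentagon_whisk)
qed

text \<open>For actions, associativity contains no associator. Four separate arrows occur because in
  a graded algebra the four products involved have different degrees.\<close>

lemma mact_assoc:
  assumes [simp]: "x \<in> Obj C" "y \<in> Obj C" "z \<in> Obj C" "w \<in> Obj C"
    "f \<in> Arr C" "Dom C f = x \<boxdot> y" "Cod C f = xy" "g \<in> Arr C" "Dom C g = xy \<boxdot> z"
    "f' \<in> Arr C" "Dom C f' = y \<boxdot> z" "Cod C f' = yz" "g' \<in> Arr C" "Dom C g' = x \<boxdot> yz"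
    and eq: "g \<cdot> (f \<lhd> z) = g' \<cdot> (x \<rhd> f') \<cdot> Assoc C x y z"
    and [simp]: "Cod C g' = Cod C g"
  shows "mact g xy z w \<cdot> mact f x y (z \<boxdot> w) = mact g' x yz w \<cdot> (x \<rhd> mact f' y z w)"
proof -
  have [simp]: "xy \<in> Obj C" "yz \<in> Obj C"
    using obj_dom_cod[OF assms(5)] obj_dom_cod[OF assms(10)] by simp_all
  have "(mact g xy z w \<cdot> mact f x y (z \<boxdot> w)) \<cdot> Assoc C x y (z \<boxdot> w) \<cdot> Assoc C (x \<boxdot> y) z w
    = (mact g' x yz w \<cdot> (x \<rhd> mact f' y z w)) \<cdot> Assoc C x y (z \<boxdot> w) \<cdot> Assoc C (x \<boxdot> y) z w"
    using mact_comp_left[of x y z w f g] mact_comp_right[of x y z w f' g'] eq by simp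
  then show ?thesis
    by (rule epi_cancel[rotated]) auto
qed

lemma mact_unit_left:
  assumes [simp]: "x \<in> Obj C" "w \<in> Obj C" "u \<in> Arr C" "Dom C u = Unit C" "Cod C u = z"
    "f \<in> Arr C" "Dom C f = z \<boxdot> x"
  shows "mact f z x w \<cdot> uact u (x \<boxdot> w) \<cdot> (LUnit C x \<lhd> w) = (f \<cdot> (u \<lhd> x)) \<lhd> w"
proof -
  have [simp]: "z \<in> Obj C"
    using obj_dom_cod[OF assms(3)] by simp
  have "(u \<lhd> (x \<boxdot> w)) \<cdot> Assoc C (Unit C) x w = Assoc C z x w \<cdot> ((u \<lhd> x) \<lhd> w)"
    by (simp add: assoc_rr)
  then show ?thesis
    by (simp add: comp_apply[OF mact_arr(4)] comp_apply[OF uact_arr(4)] rwhisk_comp flip: lunit_tensor)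
qed

lemma mact_unit_right:
  assumes [simp]: "x \<in> Obj C" "w \<in> Obj C" "u \<in> Arr C" "Dom C u = Unit C" "Cod C u = z"
    "f \<in> Arr C" "Dom C f = x \<boxdot> z"
  shows "mact f x z w \<cdot> (x \<rhd> uact u w) \<cdot> (RUnit C x \<lhd> w) = (f \<cdot> (x \<rhd> u)) \<lhd> w"
proof -
  have [simp]: "z \<in> Obj C"
    using obj_dom_cod[OF assms(3)] by simp
  have "(x \<rhd> (u \<lhd> w)) \<cdot> Assoc C x (Unit C) w = Assoc C x z w \<cdot> ((x \<rhd> u) \<lhd> w)"
    by (simp add: assoc_lr)
  then show ?thesis
    by (simp add: comp_apply[OF mact_arr(4)] lwhisk_fuse rwhisk_comp flip: triangle_whisk)
qed

text \<open>Connects the unit of a tensor product of algebras, which carries an inverse unitor of 1,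
  with two successive insertions of units.\<close>

lemma uact_tensor:
  assumes [simp]: "w \<in> Obj C" "u \<in> Arr C" "Dom C u = Unit C" "v \<in> Arr C" "Dom C v = Unit C"
     "Cod C u = x" "Cod C v = y"
  shows "uact u (y \<boxdot> w) \<cdot> uact v w = Assoc C x y w \<cdot> uact ((u \<boxtimes> v) \<cdot> Inv C (LUnit C (Unit C))) w"
proof -
  have [simp]: "x \<in> Obj C" "y \<in> Obj C"
    using obj_dom_cod[OF assms(2)] obj_dom_cod[OF assms(4)] by simp_all
  have "(uact u (y \<boxdot> w) \<cdot> uact v w) \<cdot> LUnit C w \<cdot> (LUnit C (Unit C) \<lhd> w)
     = uact u (y \<boxdot> w) \<cdot> LUnit C (y \<boxdot> w) \<cdot> (Unit C \<rhd> (v \<lhd> w)) \<cdot> Assoc C (Unit C) (Unit C) w"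
    by (simp add: comp_apply[OF uact_arr(4)] comp_apply[OF lunit_whisk] lunit_tensor)
  also have "\<dots> = (u \<lhd> (y \<boxdot> w)) \<cdot> Assoc C (Unit C) y w \<cdot> ((Unit C \<rhd> v) \<lhd> w)"
    by (simp add: comp_apply[OF uact_arr(4)] assoc_lr)
  also have "\<dots> = Assoc C x y w \<cdot> ((u \<boxtimes> v) \<lhd> w)"
    by (simp add: tensor_whisk rwhisk_comp comp_apply[OF assoc_rr])
  also have "\<dots> = (Assoc C x y w \<cdot> uact ((u \<boxtimes> v) \<cdot> Inv C (LUnit C (Unit C))) w) \<cdot>
      LUnit C w \<cdot> (LUnit C (Unit C) \<lhd> w)"
    by (simp add: comp_apply[OF uact_arr(4)] flip: rwhisk_comp)
  finally show ?thesis
    by (rule epi_cancel[rotated]) auto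
qed

end


section \<open>The braiding as an exchange of the two leading factors\<close>

context braided_category
begin

lemma braid_arr [simp]:
  assumes "x \<in> Obj C" "y \<in> Obj C"
  shows "Braid C x y \<in> Arr C" "Dom C (Braid C x y) = x \<boxdot> y"
    "Cod C (Braid C x y) = y \<boxdot> x" "is_invertible C (Braid C x y)"
  using braid_hom[OF assms] by (auto simp: Hom_def)

lemma braid_whisk:
  assumes "x \<in> Obj C" "f \<in> Arr C" "Cod C f = y"
  shows "Braid C x y \<cdot> (x \<rhd> f) = (f \<lhd> x) \<cdot> Braid C x (Dom C f)"
    "Braid C y x \<cdot> (f \<lhd> x) = (x \<rhd> f) \<cdot> Braid C (Dom C f) x"
  using braid_natural[OF ide_hom arr_hom, of x f] braid_natural[OF arr_hom ide_hom, of f x] assms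
  by (auto simp: lwhisk_def rwhisk_def)

text \<open>\<open>mact\<close> of the braiding would end in (y \<otimes> x) \<otimes> w, which is
  no longer right-nested; the outer associator restores the nesting.\<close>

definition bact :: "'a \<Rightarrow> 'a \<Rightarrow> 'a \<Rightarrow> 'b"
  where "bact x y w = Assoc C y x w \<cdot> (Braid C x y \<lhd> w) \<cdot> Inv C (Assoc C x y w)"

lemma bact_arr [simp]:
  assumes "x \<in> Obj C" "y \<in> Obj C" "w \<in> Obj C"
  shows "bact x y w \<in> Arr C" "Dom C (bact x y w) = x \<boxdot> (y \<boxdot> w)"
    "Cod C (bact x y w) = y \<boxdot> (x \<boxdot> w)" "is_invertible C (bact x y w)"
    "bact x y w \<cdot> Assoc C x y w = Assoc C y x w \<cdot> (Braid C x y \<lhd> w)"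
  using assms by (auto simp: bact_def)

lemma bact_natural:
  assumes [simp]: "x \<in> Obj C" "y \<in> Obj C" "h \<in> Arr C" "Cod C h = w"
  shows "bact x y w \<cdot> (x \<rhd> y \<rhd> h) = (y \<rhd> x \<rhd> h) \<cdot> bact x y (Dom C h)"
proof -
  have [simp]: "w \<in> Obj C"
    using obj_dom_cod[OF assms(3)] by simp
  have "(x \<rhd> y \<rhd> h) \<cdot> Assoc C x y (Dom C h) = Assoc C x y w \<cdot> ((x \<boxdot> y) \<rhd> h)"
    by (simp add: assoc_ll)
  moreover have "(Braid C x y \<lhd> w) \<cdot> ((x \<boxdot> y) \<rhd> h) = ((y \<boxdot> x) \<rhd> h) \<cdot> (Braid C x y \<lhd> Dom C h)"
    by (simp add: whisk_exchange)
  ultimately have "(bact x y w \<cdot> (x \<rhd> y \<rhd> h)) \<cdot> Assoc C x y (Dom C h) =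
      ((y \<rhd> x \<rhd> h) \<cdot> bact x y (Dom C h)) \<cdot> Assoc C x y (Dom C h)"
    by (simp add: comp_apply[OF bact_arr(5)] comp_apply[OF assoc_ll])
  then show ?thesis
    by (rule epi_cancel[rotated]) auto
qed

lemma bact_natural_left:
  assumes [simp]: "y \<in> Obj C" "w \<in> Obj C" "f \<in> Arr C" "Cod C f = x"
  shows "bact x y w \<cdot> (f \<lhd> (y \<boxdot> w)) = (y \<rhd> (f \<lhd> w)) \<cdot> bact (Dom C f) y w"
proof -
  have [simp]: "x \<in> Obj C"
    using obj_dom_cod[OF assms(3)] by simp
  have "(f \<lhd> (y \<boxdot> w)) \<cdot> Assoc C (Dom C f) y w = Assoc C x y w \<cdot> ((f \<lhd> y) \<lhd> w)"
    by (simp add: assoc_rr)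
  moreover have "(Braid C x y \<lhd> w) \<cdot> ((f \<lhd> y) \<lhd> w) = ((y \<rhd> f) \<lhd> w) \<cdot> (Braid C (Dom C f) y \<lhd> w)"
    using braid_whisk[of y f x] by (simp flip: rwhisk_comp)
  ultimately have "(bact x y w \<cdot> (f \<lhd> (y \<boxdot> w))) \<cdot> Assoc C (Dom C f) y w =
      ((y \<rhd> (f \<lhd> w)) \<cdot> bact (Dom C f) y w) \<cdot> Assoc C (Dom C f) y w"
    by (simp add: comp_apply[OF bact_arr(5)] comp_apply[OF assoc_lr])
  then show ?thesis
    by (rule epi_cancel[rotated]) auto
qed

lemma bact_natural_right:
  assumes [simp]: "x \<in> Obj C" "w \<in> Obj C" "f \<in> Arr C" "Cod C f = y"
  shows "bact x y w \<cdot> (x \<rhd> (f \<lhd> w)) = (f \<lhd> (x \<boxdot> w)) \<cdot> bact x (Dom C f) w"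
proof -
  have [simp]: "y \<in> Obj C"
    using obj_dom_cod[OF assms(3)] by simp
  have "(x \<rhd> (f \<lhd> w)) \<cdot> Assoc C x (Dom C f) w = Assoc C x y w \<cdot> ((x \<rhd> f) \<lhd> w)"
    by (simp add: assoc_lr)
  moreover have "(Braid C x y \<lhd> w) \<cdot> ((x \<rhd> f) \<lhd> w) = ((f \<lhd> x) \<lhd> w) \<cdot> (Braid C x (Dom C f) \<lhd> w)"
    using braid_whisk[of x f y] by (simp flip: rwhisk_comp)
  ultimately have "(bact x y w \<cdot> (x \<rhd> (f \<lhd> w))) \<cdot> Assoc C x (Dom C f) w =
      ((f \<lhd> (x \<boxdot> w)) \<cdot> bact x (Dom C f) w) \<cdot> Assoc C x (Dom C f) w"
    by (simp add: comp_apply[OF bact_arr(5)] comp_apply[OF assoc_rr])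
  then show ?thesis
    by (rule epi_cancel[rotated]) auto
qed

text \<open>The first hexagon with a spectator w: to pass y \<otimes> z, the factor x passes y and
  then z. The pentagon moves the associators of the hexagon into the \<open>bact\<close>
  arrows.\<close>

lemma bact_tensor_right:
  assumes [simp]: "x \<in> Obj C" "y \<in> Obj C" "z \<in> Obj C" "w \<in> Obj C"
  shows "Assoc C y z (x \<boxdot> w) \<cdot> bact x (y \<boxdot> z) w =
    (y \<rhd> bact x z w) \<cdot> bact x y (z \<boxdot> w) \<cdot> (x \<rhd> Assoc C y z w)"
proof -
  have hex: "Assoc C y z x \<cdot> Braid C x (y \<boxdot> z) \<cdot> Assoc C x y z =
      (y \<rhd> Braid C x z) \<cdot> Assoc C y x z \<cdot> (Braid C x y \<lhd> z)"
    by (simp add: hexagon1 lwhisk_def rwhisk_def)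
  have "(Assoc C y z (x \<boxdot> w) \<cdot> bact x (y \<boxdot> z) w) \<cdot> Assoc C x (y \<boxdot> z) w \<cdot> (Assoc C x y z \<lhd> w) =
      Assoc C y z (x \<boxdot> w) \<cdot> Assoc C (y \<boxdot> z) x w \<cdot> (Braid C x (y \<boxdot> z) \<lhd> w) \<cdot> (Assoc C x y z \<lhd> w)"
    by (simp add: comp_apply[OF bact_arr(5)])
  also have "\<dots> = (y \<rhd> Assoc C z x w) \<cdot> Assoc C y (z \<boxdot> x) w \<cdot>
      ((Assoc C y z x \<cdot> Braid C x (y \<boxdot> z) \<cdot> Assoc C x y z) \<lhd> w)"
    by (simp add: rwhisk_comp pentagon_apply)
  also have "\<dots> = (y \<rhd> Assoc C z x w) \<cdot> (y \<rhd> (Braid C x z \<lhd> w)) \<cdot> Assoc C y (x \<boxdot> z) w \<cdot>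
      (Assoc C y x z \<lhd> w) \<cdot> ((Braid C x y \<lhd> z) \<lhd> w)"
    by (simp only: hex) (simp add: rwhisk_comp comp_apply[OF assoc_lr])
  also have "\<dots> = (y \<rhd> bact x z w) \<cdot> (y \<rhd> Assoc C x z w) \<cdot> Assoc C y (x \<boxdot> z) w \<cdot>
      (Assoc C y x z \<lhd> w) \<cdot> ((Braid C x y \<lhd> z) \<lhd> w)"
    by (simp add: lwhisk_fuse)
  also have "\<dots> = (y \<rhd> bact x z w) \<cdot> Assoc C y x (z \<boxdot> w) \<cdot> (Braid C x y \<lhd> (z \<boxdot> w)) \<cdot> Assoc C (x \<boxdot> y) z w"
    by (simp add: pentagon_apply assoc_rr)
  also have "\<dots> = ((y \<rhd> bact x z w) \<cdot> bact x y (z \<boxdot> w) \<cdot> (x \<rhd> Assoc C y z w)) \<cdot>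
      Assoc C x (y \<boxdot> z) w \<cdot> (Assoc C x y z \<lhd> w)"
    by (simp add: pentagon_whisk comp_apply[OF bact_arr(5)])
  finally show ?thesis
    by (rule epi_cancel[rotated]) auto
qed

lemma bact_tensor_left:
  assumes [simp]: "x \<in> Obj C" "y \<in> Obj C" "z \<in> Obj C" "w \<in> Obj C"
  shows "(z \<rhd> Assoc C x y w) \<cdot> bact (x \<boxdot> y) z w =
    bact x z (y \<boxdot> w) \<cdot> (x \<rhd> bact y z w) \<cdot> Assoc C x y (z \<boxdot> w)"
proof -
  let ?H = "(Braid C x z \<lhd> y) \<cdot> Inv C (Assoc C x z y) \<cdot> (x \<rhd> Braid C y z)"
  have "Inv C (Assoc C z x y) \<cdot> Braid C (x \<boxdot> y) z \<cdot> Inv C (Assoc C x y z) = ?H"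
    by (simp add: hexagon2 lwhisk_def rwhisk_def)
  \<comment> \<open>\<open>hexagon2\<close> is stated with inverse associators; multiplying by the
    associators on both sides solves it for the braiding of the product.\<close>
  then have "Assoc C z x y \<cdot> (Inv C (Assoc C z x y) \<cdot> Braid C (x \<boxdot> y) z \<cdot> Inv C (Assoc C x y z)) \<cdot>
      Assoc C x y z = Assoc C z x y \<cdot> ?H \<cdot> Assoc C x y z"
    by (simp only:)
  then have hex: "Braid C (x \<boxdot> y) z = Assoc C z x y \<cdot> ?H \<cdot> Assoc C x y z"
    by simp
  have "((z \<rhd> Assoc C x y w) \<cdot> bact (x \<boxdot> y) z w) \<cdot> Assoc C (x \<boxdot> y) z w =
      (z \<rhd> Assoc C x y w) \<cdot> Assoc C z (x \<boxdot> y) w \<cdot> (Braid C (x \<boxdot> y) z \<lhd> w)"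
    by simp
  also have "\<dots> = (z \<rhd> Assoc C x y w) \<cdot> Assoc C z (x \<boxdot> y) w \<cdot> (Assoc C z x y \<lhd> w) \<cdot>
      ((?H \<cdot> Assoc C x y z) \<lhd> w)"
    by (simp only: hex) (simp add: rwhisk_comp)
  also have "\<dots> = Assoc C z x (y \<boxdot> w) \<cdot> (Braid C x z \<lhd> (y \<boxdot> w)) \<cdot> Assoc C (x \<boxdot> z) y w \<cdot>
      (Inv C (Assoc C x z y) \<lhd> w) \<cdot> ((x \<rhd> Braid C y z) \<lhd> w) \<cdot> (Assoc C x y z \<lhd> w)"
    by (simp add: pentagon_apply rwhisk_comp comp_apply[OF assoc_rr])
  also have "\<dots> = bact x z (y \<boxdot> w) \<cdot> Assoc C x z (y \<boxdot> w) \<cdot> Assoc C (x \<boxdot> z) y w \<cdot>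
      (Inv C (Assoc C x z y) \<lhd> w) \<cdot> ((x \<rhd> Braid C y z) \<lhd> w) \<cdot> (Assoc C x y z \<lhd> w)"
    by (simp add: comp_apply[OF bact_arr(5)])
  also have "\<dots> = bact x z (y \<boxdot> w) \<cdot> (x \<rhd> Assoc C z y w) \<cdot> Assoc C x (z \<boxdot> y) w \<cdot>
      ((Assoc C x z y \<cdot> Inv C (Assoc C x z y)) \<lhd> w) \<cdot> ((x \<rhd> Braid C y z) \<lhd> w) \<cdot> (Assoc C x y z \<lhd> w)"
    by (subst rwhisk_comp) (simp_all add: pentagon_apply)
  also have "\<dots> = bact x z (y \<boxdot> w) \<cdot> (x \<rhd> Assoc C z y w) \<cdot> (x \<rhd> (Braid C y z \<lhd> w)) \<cdot>
      Assoc C x (y \<boxdot> z) w \<cdot> (Assoc C x y z \<lhd> w)"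
    by (simp add: comp_apply[OF assoc_lr])
  also have "\<dots> = bact x z (y \<boxdot> w) \<cdot> (x \<rhd> bact y z w) \<cdot> (x \<rhd> Assoc C y z w) \<cdot>
      Assoc C x (y \<boxdot> z) w \<cdot> (Assoc C x y z \<lhd> w)"
    by (simp add: lwhisk_fuse)
  also have "\<dots> = (bact x z (y \<boxdot> w) \<cdot> (x \<rhd> bact y z w) \<cdot> Assoc C x y (z \<boxdot> w)) \<cdot> Assoc C (x \<boxdot> y) z w"
    by (simp add: pentagon_whisk)
  finally show ?thesis
    by (rule epi_cancel[rotated]) auto
qed

text \<open>Naturality of the braiding along \<open>f\<close>, followed by a hexagon. In this shape
  and in that of \<open>bact_mact_left\<close> the hexagons enter the associativity of braided
  tensor products.\<close>

lemma bact_mact_right: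
  assumes [simp]: "x \<in> Obj C" "y \<in> Obj C" "z \<in> Obj C" "w \<in> Obj C" "f \<in> Arr C" "Dom C f = y \<boxdot> z"
    "Cod C f = yz"
  shows "bact x yz w \<cdot> (x \<rhd> mact f y z w) = mact f y z (x \<boxdot> w) \<cdot> (y \<rhd> bact x z w) \<cdot> bact x y (z \<boxdot> w)"
proof -
  have [simp]: "yz \<in> Obj C"
    using obj_dom_cod[OF assms(5)] by simp
  have "(bact x yz w \<cdot> (x \<rhd> mact f y z w)) \<cdot> (x \<rhd> Assoc C y z w) = (f \<lhd> (x \<boxdot> w)) \<cdot> bact x (y \<boxdot> z) w"
    by (simp add: lwhisk_fuse bact_natural_right)
  also have "\<dots> = mact f y z (x \<boxdot> w) \<cdot> Assoc C y z (x \<boxdot> w) \<cdot> bact x (y \<boxdot> z) w"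
    by (simp add: comp_apply[OF mact_arr(4)])
  also have "\<dots> = (mact f y z (x \<boxdot> w) \<cdot> (y \<rhd> bact x z w) \<cdot> bact x y (z \<boxdot> w)) \<cdot> (x \<rhd> Assoc C y z w)"
    by (simp add: bact_tensor_right)
  finally show ?thesis
    by (rule epi_cancel[rotated]) auto
qed

lemma bact_mact_left:
  assumes [simp]: "x \<in> Obj C" "y \<in> Obj C" "z \<in> Obj C" "w \<in> Obj C" "f \<in> Arr C" "Dom C f = x \<boxdot> y"
    "Cod C f = xy"
  shows "bact xy z w \<cdot> mact f x y (z \<boxdot> w) = (z \<rhd> mact f x y w) \<cdot> bact x z (y \<boxdot> w) \<cdot> (x \<rhd> bact y z w)"
proof -
  have [simp]: "xy \<in> Obj C"
    using obj_dom_cod[OF assms(5)] by simp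
  have "(bact xy z w \<cdot> mact f x y (z \<boxdot> w)) \<cdot> Assoc C x y (z \<boxdot> w) = (z \<rhd> (f \<lhd> w)) \<cdot> bact (x \<boxdot> y) z w"
    by (simp add: bact_natural_left)
  also have "\<dots> = (z \<rhd> mact f x y w) \<cdot> (z \<rhd> Assoc C x y w) \<cdot> bact (x \<boxdot> y) z w"
    by (simp add: lwhisk_fuse)
  also have "\<dots> = ((z \<rhd> mact f x y w) \<cdot> bact x z (y \<boxdot> w) \<cdot> (x \<rhd> bact y z w)) \<cdot> Assoc C x y (z \<boxdot> w)"
    by (simp add: bact_tensor_left)
  finally show ?thesis
    by (rule epi_cancel[rotated]) auto
qed

text \<open>For the algebra 1 the action of the multiplication is a unitor, so
  \<open>bact_mact_left\<close> and \<open>bact_mact_right\<close> specialise to statements about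
  braiding with 1.\<close>

lemma mact_lunit:
  assumes [simp]: "w \<in> Obj C"
  shows "mact (LUnit C (Unit C)) (Unit C) (Unit C) w = LUnit C (Unit C \<boxdot> w)"
proof -
  have "mact (LUnit C (Unit C)) (Unit C) (Unit C) w \<cdot> Assoc C (Unit C) (Unit C) w =
      LUnit C (Unit C \<boxdot> w) \<cdot> Assoc C (Unit C) (Unit C) w"
    by (simp add: lunit_tensor)
  then show ?thesis
    by (rule epi_cancel[rotated]) auto
qed

text \<open>Naturality of the braiding along \<open>1 \<otimes> 1 \<rightarrow> 1\<close> makes the braiding with \<open>1\<close> idempotent.\<close>

lemma bact_unit_left:
  assumes [simp]: "y \<in> Obj C" "w \<in> Obj C"
  shows "(y \<rhd> LUnit C w) \<cdot> bact (Unit C) y w = LUnit C (y \<boxdot> w)"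
proof -
  let ?u = "Unit C"
  have "LUnit C (y \<boxdot> (?u \<boxdot> w)) \<cdot> (?u \<rhd> bact ?u y w) = bact ?u y w \<cdot> LUnit C (?u \<boxdot> (y \<boxdot> w))"
    by (simp add: lunit_whisk)
  also have "\<dots> = ((y \<rhd> LUnit C (?u \<boxdot> w)) \<cdot> bact ?u y (?u \<boxdot> w)) \<cdot> (?u \<rhd> bact ?u y w)"
    using bact_mact_left[of ?u ?u y w "LUnit C ?u" ?u] by (simp add: mact_lunit)
  \<comment> \<open>Cancelling one copy of the invertible braiding leaves the claim for 1 \<otimes>
    w in place of w; the remaining steps transport it along \<open>LUnit C w\<close>.\<close>
  finally have "LUnit C (y \<boxdot> (?u \<boxdot> w)) = (y \<rhd> LUnit C (?u \<boxdot> w)) \<cdot> bact ?u y (?u \<boxdot> w)"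
    by (rule epi_cancel[rotated]) auto
  then have "LUnit C (y \<boxdot> w) \<cdot> (?u \<rhd> y \<rhd> LUnit C w) = (y \<rhd> (LUnit C w \<cdot> LUnit C (?u \<boxdot> w))) \<cdot> bact ?u y (?u \<boxdot> w)"
    by (simp add: lunit_whisk lwhisk_comp)
  also have "y \<rhd> (LUnit C w \<cdot> LUnit C (?u \<boxdot> w)) = (y \<rhd> LUnit C w) \<cdot> (y \<rhd> ?u \<rhd> LUnit C w)"
    by (simp add: lwhisk_fuse lunit_whisk)
  also have "\<dots> \<cdot> bact ?u y (?u \<boxdot> w) = ((y \<rhd> LUnit C w) \<cdot> bact ?u y w) \<cdot> (?u \<rhd> y \<rhd> LUnit C w)"
    by (simp add: bact_natural)
  finally show ?thesis
    by (rule epi_cancel[rotated, symmetric]) auto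
qed

lemma bact_unit_right:
  assumes [simp]: "x \<in> Obj C" "w \<in> Obj C"
  shows "LUnit C (x \<boxdot> w) \<cdot> bact x (Unit C) w = x \<rhd> LUnit C w"
proof -
  let ?u = "Unit C"
  have "bact x ?u w \<cdot> (x \<rhd> LUnit C (?u \<boxdot> w)) = LUnit C (?u \<boxdot> (x \<boxdot> w)) \<cdot> (?u \<rhd> bact x ?u w) \<cdot> bact x ?u (?u \<boxdot> w)"
    using bact_mact_right[of x ?u ?u w "LUnit C ?u" ?u] by (simp add: mact_lunit)
  also have "\<dots> = bact x ?u w \<cdot> LUnit C (x \<boxdot> (?u \<boxdot> w)) \<cdot> bact x ?u (?u \<boxdot> w)"
    by (simp add: comp_apply[OF lunit_whisk])
  finally have "x \<rhd> LUnit C (?u \<boxdot> w) = LUnit C (x \<boxdot> (?u \<boxdot> w)) \<cdot> bact x ?u (?u \<boxdot> w)"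
    by (rule mono_cancel[rotated]) auto
  then have "(x \<rhd> (LUnit C w \<cdot> LUnit C (?u \<boxdot> w))) = LUnit C (x \<boxdot> w) \<cdot> (?u \<rhd> x \<rhd> LUnit C w) \<cdot> bact x ?u (?u \<boxdot> w)"
    by (simp add: comp_apply[OF lunit_whisk] lwhisk_comp)
  also have "\<dots> = (LUnit C (x \<boxdot> w) \<cdot> bact x ?u w) \<cdot> (x \<rhd> ?u \<rhd> LUnit C w)"
    by (simp add: bact_natural)
  finally have "(x \<rhd> LUnit C w) \<cdot> (x \<rhd> ?u \<rhd> LUnit C w) = (LUnit C (x \<boxdot> w) \<cdot> bact x ?u w) \<cdot> (x \<rhd> ?u \<rhd> LUnit C w)"
    by (simp add: lunit_whisk flip: lwhisk_comp)
  then show ?thesis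
    by (rule epi_cancel[rotated, symmetric]) auto
qed

text \<open>Naturality in \<open>u\<close> reduces the exchange to the one with the unit object,
  which \<open>bact_unit_left\<close> evaluates.\<close>

lemma bact_uact_left:
  assumes [simp]: "y \<in> Obj C" "w \<in> Obj C" "u \<in> Arr C" "Dom C u = Unit C" "Cod C u = x"
  shows "bact x y w \<cdot> uact u (y \<boxdot> w) = y \<rhd> uact u w"
proof -
  have [simp]: "x \<in> Obj C"
    using obj_dom_cod[OF assms(3)] by simp
  have "(bact x y w \<cdot> uact u (y \<boxdot> w)) \<cdot> LUnit C (y \<boxdot> w) = (y \<rhd> (u \<lhd> w)) \<cdot> bact (Unit C) y w"
    by (simp add: bact_natural_left)
  also have "\<dots> = (y \<rhd> uact u w) \<cdot> LUnit C (y \<boxdot> w)"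
    by (simp add: lwhisk_fuse flip: bact_unit_left)
  finally show ?thesis
    by (rule epi_cancel[rotated]) auto
qed

lemma bact_uact_right:
  assumes [simp]: "x \<in> Obj C" "w \<in> Obj C" "u \<in> Arr C" "Dom C u = Unit C" "Cod C u = y"
  shows "bact x y w \<cdot> (x \<rhd> uact u w) = uact u (x \<boxdot> w)"
proof -
  have [simp]: "y \<in> Obj C"
    using obj_dom_cod[OF assms(3)] by simp
  have "(bact x y w \<cdot> (x \<rhd> uact u w)) \<cdot> (x \<rhd> LUnit C w) = (u \<lhd> (x \<boxdot> w)) \<cdot> bact x (Unit C) w"
    by (simp add: lwhisk_fuse bact_natural_right)
  also have "\<dots> = uact u (x \<boxdot> w) \<cdot> (x \<rhd> LUnit C w)"
    by (simp add: comp_apply[OF uact_arr(4)] flip: bact_unit_right)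
  finally show ?thesis
    by (rule epi_cancel[rotated]) auto
qed

end


section \<open>Braided tensor products of multiplications\<close>

context monoidal_category
begin

lemma mact_unit_left_ide:
  assumes [simp]: "x \<in> Obj C" "w \<in> Obj C" "u \<in> Arr C" "Dom C u = Unit C" "Cod C u = z"
    "f \<in> Arr C" "Dom C f = z \<boxdot> x" "Cod C f = x"
    and eq: "f \<cdot> (u \<lhd> x) = LUnit C x"
  shows "mact f z x w \<cdot> uact u (x \<boxdot> w) = Ide C (x \<boxdot> w)"
proof -
  have [simp]: "z \<in> Obj C"
    using obj_dom_cod[OF assms(3)] by simp
  have "(mact f z x w \<cdot> uact u (x \<boxdot> w)) \<cdot> (LUnit C x \<lhd> w) = Ide C (x \<boxdot> w) \<cdot> (LUnit C x \<lhd> w)"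
    by (simp add: mact_unit_left eq)
  then show ?thesis
    by (rule epi_cancel[rotated]) auto
qed

lemma mact_unit_right_ide:
  assumes [simp]: "x \<in> Obj C" "w \<in> Obj C" "u \<in> Arr C" "Dom C u = Unit C" "Cod C u = z"
    "f \<in> Arr C" "Dom C f = x \<boxdot> z" "Cod C f = x"
    and eq: "f \<cdot> (x \<rhd> u) = RUnit C x"
  shows "mact f x z w \<cdot> (x \<rhd> uact u w) = Ide C (x \<boxdot> w)"
proof -
  have [simp]: "z \<in> Obj C"
    using obj_dom_cod[OF assms(3)] by simp
  have "(mact f x z w \<cdot> (x \<rhd> uact u w)) \<cdot> (RUnit C x \<lhd> w) = Ide C (x \<boxdot> w) \<cdot> (RUnit C x \<lhd> w)"
    by (simp add: mact_unit_right eq)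
  then show ?thesis
    by (rule epi_cancel[rotated]) auto
qed

definition tensor_unit :: "'b \<Rightarrow> 'b \<Rightarrow> 'b"
  where "tensor_unit u v = (u \<boxtimes> v) \<cdot> Inv C (LUnit C (Unit C))"

text \<open>When u and v are the units of two algebras, \<open>left_incl\<close> and
  \<open>right_incl\<close> are the embeddings x \<mapsto> x \<otimes> 1 and y \<mapsto> 1 \<otimes>
  y of the factors into the tensor product.\<close>

definition left_incl :: "'a \<Rightarrow> 'b \<Rightarrow> 'b"
  where "left_incl a v = (a \<rhd> v) \<cdot> Inv C (RUnit C a)"

definition right_incl :: "'b \<Rightarrow> 'a \<Rightarrow> 'b"
  where "right_incl u d = (u \<lhd> d) \<cdot> Inv C (LUnit C d)"

lemma tensor_unit_arr [simp]:
  assumes "u \<in> Arr C" "Dom C u = Unit C" "v \<in> Arr C" "Dom C v = Unit C"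
  shows "tensor_unit u v \<in> Arr C" "Dom C (tensor_unit u v) = Unit C"
    "Cod C (tensor_unit u v) = Cod C u \<boxdot> Cod C v"
  using assms by (auto simp: tensor_unit_def)

lemma left_incl_arr [simp]:
  assumes "a \<in> Obj C" "v \<in> Arr C" "Dom C v = Unit C"
  shows "left_incl a v \<in> Arr C" "Dom C (left_incl a v) = a"
    "Cod C (left_incl a v) = a \<boxdot> Cod C v"
  using assms by (auto simp: left_incl_def)

lemma right_incl_arr [simp]:
  assumes "d \<in> Obj C" "u \<in> Arr C" "Dom C u = Unit C"
  shows "right_incl u d \<in> Arr C" "Dom C (right_incl u d) = d"
    "Cod C (right_incl u d) = Cod C u \<boxdot> d"
  using assms by (auto simp: right_incl_def)

lemma assoc_left_incl:
  assumes [simp]: "a \<in> Obj C" "w \<in> Obj C" "v \<in> Arr C" "Dom C v = Unit C" "Cod C v = d"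
  shows "Assoc C a d w \<cdot> (left_incl a v \<lhd> w) = a \<rhd> uact v w"
proof -
  have [simp]: "d \<in> Obj C"
    using obj_dom_cod[OF assms(3)] by simp
  have "(Assoc C a d w \<cdot> (left_incl a v \<lhd> w)) \<cdot> (RUnit C a \<lhd> w) = Assoc C a d w \<cdot> ((a \<rhd> v) \<lhd> w)"
    by (simp add: left_incl_def flip: rwhisk_comp)
  also have "\<dots> = (a \<rhd> uact v w) \<cdot> (RUnit C a \<lhd> w)"
    by (simp add: assoc_lr lwhisk_fuse flip: triangle_whisk)
  finally show ?thesis
    by (rule epi_cancel[rotated]) auto
qed

lemma assoc_right_incl:
  assumes [simp]: "d \<in> Obj C" "w \<in> Obj C" "u \<in> Arr C" "Dom C u = Unit C" "Cod C u = a"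
  shows "Assoc C a d w \<cdot> (right_incl u d \<lhd> w) = uact u (d \<boxdot> w)"
proof -
  have [simp]: "a \<in> Obj C"
    using obj_dom_cod[OF assms(3)] by simp
  have "(Assoc C a d w \<cdot> (right_incl u d \<lhd> w)) \<cdot> (LUnit C d \<lhd> w) = Assoc C a d w \<cdot> ((u \<lhd> d) \<lhd> w)"
    by (simp add: right_incl_def flip: rwhisk_comp)
  also have "\<dots> = uact u (d \<boxdot> w) \<cdot> (LUnit C d \<lhd> w)"
    by (simp add: assoc_rr comp_apply[OF uact_arr(4)] flip: lunit_tensor)
  finally show ?thesis
    by (rule epi_cancel[rotated]) auto
qed

text \<open>Naturality of \<open>LUnit\<close> along itself identifies \<open>LUnit\<close> of 1
  \<otimes> 1 with 1 \<otimes> \<open>LUnit\<close> of 1; then \<open>lunit_tensor\<close> and the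
  triangle have the same left-hand side.\<close>

lemma lunit_unit_eq_runit_unit: "LUnit C (Unit C) = RUnit C (Unit C)"
proof (rule rwhisk_unit_cancel)
  let ?u = "Unit C"
  have "LUnit C ?u \<cdot> LUnit C (?u \<boxdot> ?u) = LUnit C ?u \<cdot> (?u \<rhd> LUnit C ?u)"
    by (simp add: lunit_whisk)
  then have "LUnit C (?u \<boxdot> ?u) = ?u \<rhd> LUnit C ?u"
    by (rule mono_cancel[rotated]) auto
  then show "LUnit C ?u \<lhd> ?u = RUnit C ?u \<lhd> ?u"
    using lunit_tensor[of ?u ?u] triangle_whisk[of ?u ?u] by simp
qed auto

lemma right_incl_comp:
  assumes "u \<in> Arr C" "Dom C u = Unit C" "v \<in> Arr C" "Dom C v = Unit C" "Cod C v = d"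
  shows "right_incl u d \<cdot> v = tensor_unit u v"
proof -
  have [simp]: "d \<in> Obj C"
    using obj_dom_cod(2)[of v] assms by simp
  note [simp] = assms
  have "(Inv C (LUnit C d) \<cdot> v) \<cdot> LUnit C (Unit C) = ((Unit C \<rhd> v) \<cdot> Inv C (LUnit C (Unit C))) \<cdot> LUnit C (Unit C)"
    using lunit_whisk[of v d, symmetric] by simp
  then have "(Inv C (LUnit C d) \<cdot> v) = (Unit C \<rhd> v) \<cdot> Inv C (LUnit C (Unit C))"
    by (rule epi_cancel[rotated]) auto
  then show ?thesis
    by (simp add: right_incl_def tensor_unit_def tensor_whisk)
qed

lemma left_incl_comp:
  assumes "f \<in> Arr C" "Cod C f = a" "v \<in> Arr C" "Dom C v = Unit C"
  shows "left_incl a v \<cdot> f = (f \<boxtimes> v) \<cdot> Inv C (RUnit C (Dom C f))"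
proof -
  have [simp]: "a \<in> Obj C"
    using obj_dom_cod(2)[of f] assms by simp
  note [simp] = assms
  have "(Inv C (RUnit C a) \<cdot> f) \<cdot> RUnit C (Dom C f) = ((f \<lhd> Unit C) \<cdot> Inv C (RUnit C (Dom C f))) \<cdot> RUnit C (Dom C f)"
    using runit_whisk[of f a, symmetric] by simp
  then have "Inv C (RUnit C a) \<cdot> f = (f \<lhd> Unit C) \<cdot> Inv C (RUnit C (Dom C f))"
    by (rule epi_cancel[rotated]) auto
  then show ?thesis
    by (simp add: left_incl_def lwhisk_def rwhisk_def) (simp add: comp_apply[OF tensor_comp'])
qed

lemma tpow_obj [simp]: "V \<in> Obj C \<Longrightarrow> tpow C V n \<in> Obj C"
  by (induction n) auto

lemma tcat_arr [simp]:
  assumes [simp]: "V \<in> Obj C"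
  shows "tcat C V m n \<in> Arr C" "Dom C (tcat C V m n) = tpow C V m \<boxdot> tpow C V n"
    "Cod C (tcat C V m n) = tpow C V (m + n)"
proof -
  have "tcat C V m n \<in> Hom C (tpow C V m \<boxdot> tpow C V n) (tpow C V (m + n))"
  proof (induction n)
    case (Suc n)
    show ?case
      using homD[OF Suc] by (auto intro!: homI)
  qed (auto intro!: homI)
  then show "tcat C V m n \<in> Arr C" "Dom C (tcat C V m n) = tpow C V m \<boxdot> tpow C V n"
    "Cod C (tcat C V m n) = tpow C V (m + n)"
    by (auto simp: Hom_def)
qed

end


section \<open>The multiplication of a braided tensor product of algebras\<close>

context braided_category
begin

text \<open>The pentagon on both sides of the braiding: enlarging the spectator d' by a further
  factor w only changes brackets.\<close>

lemma bact_whisk: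
  assumes [simp]: "d \<in> Obj C" "a \<in> Obj C" "d' \<in> Obj C" "w \<in> Obj C"
  shows "(a \<rhd> Assoc C d d' w) \<cdot> Assoc C a (d \<boxdot> d') w \<cdot> (bact d a d' \<lhd> w) =
    bact d a (d' \<boxdot> w) \<cdot> (d \<rhd> Assoc C a d' w) \<cdot> Assoc C d (a \<boxdot> d') w"
proof -
  have "((a \<rhd> Assoc C d d' w) \<cdot> Assoc C a (d \<boxdot> d') w \<cdot> (bact d a d' \<lhd> w)) \<cdot> (Assoc C d a d' \<lhd> w) =
     (a \<rhd> Assoc C d d' w) \<cdot> Assoc C a (d \<boxdot> d') w \<cdot> (Assoc C a d d' \<lhd> w) \<cdot> ((Braid C d a \<lhd> d') \<lhd> w)"
    by (simp flip: rwhisk_comp)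
  also have "\<dots> = Assoc C a d (d' \<boxdot> w) \<cdot> (Braid C d a \<lhd> (d' \<boxdot> w)) \<cdot> Assoc C (d \<boxdot> a) d' w"
    by (simp add: pentagon_apply assoc_rr)
  also have "\<dots> = (bact d a (d' \<boxdot> w) \<cdot> (d \<rhd> Assoc C a d' w) \<cdot> Assoc C d (a \<boxdot> d') w) \<cdot> (Assoc C d a d' \<lhd> w)"
    by (simp add: pentagon_whisk comp_apply[OF bact_arr(5)])
  finally show ?thesis
    by (rule epi_cancel[rotated]) auto
qed

lemma middle_braid_arr [simp]:
  assumes "a \<in> Obj C" "b \<in> Obj C" "c \<in> Obj C" "d \<in> Obj C"
  shows "middle_braid C a b c d \<in> Arr C"
    "Dom C (middle_braid C a b c d) = a \<boxdot> b \<boxdot> (c \<boxdot> d)"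
    "Cod C (middle_braid C a b c d) = a \<boxdot> c \<boxdot> (b \<boxdot> d)"
    "Assoc C a c (b \<boxdot> d) \<cdot> middle_braid C a b c d = (a \<rhd> bact b c d) \<cdot> Assoc C a b (c \<boxdot> d)"
proof -
  have "middle_braid C a b c d = Inv C (Assoc C a c (b \<boxdot> d)) \<cdot> (a \<rhd> bact b c d) \<cdot> Assoc C a b (c \<boxdot> d)"
    by (simp add: middle_braid_def bact_def lwhisk_def rwhisk_def)
  then show "middle_braid C a b c d \<in> Arr C"
    "Dom C (middle_braid C a b c d) = a \<boxdot> b \<boxdot> (c \<boxdot> d)"
    "Cod C (middle_braid C a b c d) = a \<boxdot> c \<boxdot> (b \<boxdot> d)"
    "Assoc C a c (b \<boxdot> d) \<cdot> middle_braid C a b c d = (a \<rhd> bact b c d) \<cdot> Assoc C a b (c \<boxdot> d)"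
    using assms by auto
qed

definition tensor_mul :: "'b \<Rightarrow> 'b \<Rightarrow> 'a \<Rightarrow> 'a \<Rightarrow> 'a \<Rightarrow> 'a \<Rightarrow> 'b"
  where "tensor_mul f g a d a' d' = (f \<boxtimes> g) \<cdot> middle_braid C a d a' d'"

text \<open>The action of \<open>tensor_mul f g\<close> with the brackets of both arguments opened:
  d passes a', then \<open>g\<close> multiplies d with d', then \<open>f\<close> multiplies a with
  a'.\<close>

definition tact :: "'b \<Rightarrow> 'b \<Rightarrow> 'a \<Rightarrow> 'a \<Rightarrow> 'a \<Rightarrow> 'a \<Rightarrow> 'a \<Rightarrow> 'b"
  where "tact f g a d a' d' w = mact f a a' (Cod C g \<boxdot> w) \<cdot>
    (a \<rhd> ((a' \<rhd> mact g d d' w) \<cdot> bact d a' (d' \<boxdot> w)))"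

lemma tensor_mul_arr [simp]:
  assumes "a \<in> Obj C" "d \<in> Obj C" "a' \<in> Obj C" "d' \<in> Obj C"
    "f \<in> Arr C" "Dom C f = a \<boxdot> a'" "g \<in> Arr C" "Dom C g = d \<boxdot> d'"
  shows "tensor_mul f g a d a' d' \<in> Arr C"
    "Dom C (tensor_mul f g a d a' d') = a \<boxdot> d \<boxdot> (a' \<boxdot> d')"
    "Cod C (tensor_mul f g a d a' d') = Cod C f \<boxdot> Cod C g"
  using assms by (auto simp: tensor_mul_def)

lemma tact_arr [simp]:
  assumes "a \<in> Obj C" "d \<in> Obj C" "a' \<in> Obj C" "d' \<in> Obj C" "w \<in> Obj C"
    "f \<in> Arr C" "Dom C f = a \<boxdot> a'" "g \<in> Arr C" "Dom C g = d \<boxdot> d'"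
  shows "tact f g a d a' d' w \<in> Arr C"
    "Dom C (tact f g a d a' d' w) = a \<boxdot> (d \<boxdot> (a' \<boxdot> (d' \<boxdot> w)))"
    "Cod C (tact f g a d a' d' w) = Cod C f \<boxdot> (Cod C g \<boxdot> w)"
  using assms by (auto simp: tact_def)

text \<open>The bridge from the product formula with its associators to \<open>tact\<close>; every
  later identity for \<open>tensor_mul\<close> goes through it.\<close>

lemma rwhisk_tensor_mul:
  assumes [simp]: "a \<in> Obj C" "d \<in> Obj C" "a' \<in> Obj C" "d' \<in> Obj C" "w \<in> Obj C"
    "f \<in> Arr C" "Dom C f = a \<boxdot> a'" "Cod C f = a''" "g \<in> Arr C" "Dom C g = d \<boxdot> d'" "Cod C g = d''"
  shows "Assoc C a'' d'' w \<cdot> (tensor_mul f g a d a' d' \<lhd> w) =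
    tact f g a d a' d' w \<cdot> (a \<rhd> d \<rhd> Assoc C a' d' w) \<cdot> Assoc C a d (a' \<boxdot> d' \<boxdot> w) \<cdot>
    Assoc C (a \<boxdot> d) (a' \<boxdot> d') w"
proof -
  have [simp]: "a'' \<in> Obj C" "d'' \<in> Obj C"
    using obj_dom_cod[OF assms(6)] obj_dom_cod[OF assms(9)] by simp_all
  let ?m = "middle_braid C a d a' d'"
  have "Assoc C a'' d'' w \<cdot> (tensor_mul f g a d a' d' \<lhd> w) =
      (f \<lhd> (d'' \<boxdot> w)) \<cdot> Assoc C (a \<boxdot> a') d'' w \<cdot> (((a \<boxdot> a') \<rhd> g) \<lhd> w) \<cdot> (?m \<lhd> w)"
    by (simp add: tensor_mul_def tensor_whisk rwhisk_comp comp_apply[OF assoc_rr])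
  also have "\<dots> = mact f a a' (d'' \<boxdot> w) \<cdot> (a \<rhd> a' \<rhd> (g \<lhd> w)) \<cdot> Assoc C a a' (d \<boxdot> d' \<boxdot> w) \<cdot>
      Assoc C (a \<boxdot> a') (d \<boxdot> d') w \<cdot> (?m \<lhd> w)"
    using comp_apply[OF assoc_ll[of "g \<lhd> w" a a' "d'' \<boxdot> w"]]
      comp_apply[OF mact_arr(4)[of a a' "d'' \<boxdot> w" f], symmetric]
    by (simp add: comp_apply[OF assoc_lr])
  also have "\<dots> = mact f a a' (d'' \<boxdot> w) \<cdot> (a \<rhd> a' \<rhd> (g \<lhd> w)) \<cdot> (a \<rhd> Assoc C a' (d \<boxdot> d') w) \<cdot>
      Assoc C a (a' \<boxdot> (d \<boxdot> d')) w \<cdot> ((Assoc C a a' (d \<boxdot> d') \<cdot> ?m) \<lhd> w)"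
    by (simp add: rwhisk_comp pentagon_apply del: middle_braid_arr(4))
  also have "\<dots> = mact f a a' (d'' \<boxdot> w) \<cdot> (a \<rhd> ((a' \<rhd> (g \<lhd> w)) \<cdot> Assoc C a' (d \<boxdot> d') w \<cdot> (bact d a' d' \<lhd> w))) \<cdot>
      Assoc C a (d \<boxdot> (a' \<boxdot> d')) w \<cdot> (Assoc C a d (a' \<boxdot> d') \<lhd> w)"
    by (simp add: rwhisk_comp lwhisk_comp comp_apply[OF assoc_lr])
  also have "(a' \<rhd> (g \<lhd> w)) \<cdot> Assoc C a' (d \<boxdot> d') w \<cdot> (bact d a' d' \<lhd> w) =
      (a' \<rhd> mact g d d' w) \<cdot> (a' \<rhd> Assoc C d d' w) \<cdot> Assoc C a' (d \<boxdot> d') w \<cdot> (bact d a' d' \<lhd> w)"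
    by (simp add: lwhisk_fuse)
  also have "\<dots> = ((a' \<rhd> mact g d d' w) \<cdot> bact d a' (d' \<boxdot> w)) \<cdot> (d \<rhd> Assoc C a' d' w) \<cdot> Assoc C d (a' \<boxdot> d') w"
    by (simp add: bact_whisk)
  also have "mact f a a' (d'' \<boxdot> w) \<cdot> (a \<rhd> \<dots>) \<cdot> Assoc C a (d \<boxdot> (a' \<boxdot> d')) w \<cdot> (Assoc C a d (a' \<boxdot> d') \<lhd> w)
      = tact f g a d a' d' w \<cdot> (a \<rhd> d \<rhd> Assoc C a' d' w) \<cdot> (a \<rhd> Assoc C d (a' \<boxdot> d') w) \<cdot>
        Assoc C a (d \<boxdot> (a' \<boxdot> d')) w \<cdot> (Assoc C a d (a' \<boxdot> d') \<lhd> w)"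
    by (simp add: tact_def lwhisk_comp)
  also have "\<dots> = tact f g a d a' d' w \<cdot> (a \<rhd> d \<rhd> Assoc C a' d' w) \<cdot> Assoc C a d (a' \<boxdot> d' \<boxdot> w) \<cdot>
      Assoc C (a \<boxdot> d) (a' \<boxdot> d') w"
    by (simp add: pentagon_whisk)
  finally show ?thesis .
qed

lemma mact_tensor_mul:
  assumes [simp]: "a \<in> Obj C" "d \<in> Obj C" "a' \<in> Obj C" "d' \<in> Obj C" "w \<in> Obj C"
    "f \<in> Arr C" "Dom C f = a \<boxdot> a'" "Cod C f = a''" "g \<in> Arr C" "Dom C g = d \<boxdot> d'" "Cod C g = d''"
  shows "Assoc C a'' d'' w \<cdot> mact (tensor_mul f g a d a' d') (a \<boxdot> d) (a' \<boxdot> d') w =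
    tact f g a d a' d' w \<cdot> (a \<rhd> d \<rhd> Assoc C a' d' w) \<cdot> Assoc C a d (a' \<boxdot> d' \<boxdot> w)"
proof -
  have [simp]: "a'' \<in> Obj C" "d'' \<in> Obj C"
    using obj_dom_cod[OF assms(6)] obj_dom_cod[OF assms(9)] by simp_all
  have "(Assoc C a'' d'' w \<cdot> mact (tensor_mul f g a d a' d') (a \<boxdot> d) (a' \<boxdot> d') w) \<cdot>
      Assoc C (a \<boxdot> d) (a' \<boxdot> d') w =
    (tact f g a d a' d' w \<cdot> (a \<rhd> d \<rhd> Assoc C a' d' w) \<cdot> Assoc C a d (a' \<boxdot> d' \<boxdot> w)) \<cdot>
      Assoc C (a \<boxdot> d) (a' \<boxdot> d') w"
    by (simp add: rwhisk_tensor_mul)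
  then show ?thesis
    by (rule epi_cancel[rotated]) auto
qed

lemma tact_natural:
  assumes [simp]: "a \<in> Obj C" "d \<in> Obj C" "a' \<in> Obj C" "d' \<in> Obj C" "h \<in> Arr C"
    "f \<in> Arr C" "Dom C f = a \<boxdot> a'" "Cod C f = a''" "g \<in> Arr C" "Dom C g = d \<boxdot> d'" "Cod C g = d''"
    and [simp]: "Dom C h = w"
  shows "(a'' \<rhd> d'' \<rhd> h) \<cdot> tact f g a d a' d' w =
    tact f g a d a' d' (Cod C h) \<cdot> (a \<rhd> d \<rhd> a' \<rhd> d' \<rhd> h)"
proof -
  have [simp]: "w \<in> Obj C" "a'' \<in> Obj C" "d'' \<in> Obj C"
    using obj_dom_cod[OF assms(5)] obj_dom_cod[OF assms(6)] obj_dom_cod[OF assms(9)] by simp_all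
  show ?thesis
    by (simp add: tact_def comp_apply[OF mact_natural] lwhisk_fuse mact_natural bact_natural)
qed

text \<open>Both bracketings require the same three exchanges: d past a', d past a'' and d' past
  a''. The hexagons, as \<open>bact_mact_left\<close> on the left and \<open>bact_mact_right\<close>
  on the right, separate exchanges from multiplications, and then associativity of the two factors
  applies.\<close>

lemma tact_assoc:
  assumes [simp]: "a \<in> Obj C" "a' \<in> Obj C" "a'' \<in> Obj C" "d \<in> Obj C" "d' \<in> Obj C" "d'' \<in> Obj C" "w \<in> Obj C"
  and [simp]: "f0 \<in> Arr C" "Dom C f0 = a \<boxdot> a'" "Cod C f0 = a0" "f1 \<in> Arr C" "Dom C f1 = a0 \<boxdot> a''"
    "f3 \<in> Arr C" "Dom C f3 = a' \<boxdot> a''" "Cod C f3 = a3" "f2 \<in> Arr C" "Dom C f2 = a \<boxdot> a3" "Cod C f2 = Cod C f1"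
  and fa: "f1 \<cdot> (f0 \<lhd> a'') = f2 \<cdot> (a \<rhd> f3) \<cdot> Assoc C a a' a''"
  and [simp]: "g0 \<in> Arr C" "Dom C g0 = d \<boxdot> d'" "Cod C g0 = d0" "g1 \<in> Arr C" "Dom C g1 = d0 \<boxdot> d''"
    "g3 \<in> Arr C" "Dom C g3 = d' \<boxdot> d''" "Cod C g3 = d3" "g2 \<in> Arr C" "Dom C g2 = d \<boxdot> d3" "Cod C g2 = Cod C g1"
  and ga: "g1 \<cdot> (g0 \<lhd> d'') = g2 \<cdot> (d \<rhd> g3) \<cdot> Assoc C d d' d''"
  shows "tact f1 g1 a0 d0 a'' d'' w \<cdot> tact f0 g0 a d a' d' (a'' \<boxdot> (d'' \<boxdot> w)) =
    tact f2 g2 a d a3 d3 w \<cdot> (a \<rhd> d \<rhd> tact f3 g3 a' d' a'' d'' w)"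
proof -
  have [simp]: "a0 \<in> Obj C" "a3 \<in> Obj C" "d0 \<in> Obj C" "d3 \<in> Obj C"
    using obj_dom_cod(2)[of f0] obj_dom_cod(2)[of f3] obj_dom_cod(2)[of g0] obj_dom_cod(2)[of g3] by simp_all
  let ?z = "Cod C g1"
  let ?K = "(a'' \<rhd> (mact g2 d d3 w \<cdot> (d \<rhd> mact g3 d' d'' w))) \<cdot> bact d a'' (d' \<boxdot> (d'' \<boxdot> w)) \<cdot>
      (d \<rhd> bact d' a'' (d'' \<boxdot> w))"
  let ?R = "mact f2 a a3 (?z \<boxdot> w) \<cdot> (a \<rhd> (mact f3 a' a'' (?z \<boxdot> w) \<cdot> (a' \<rhd> ?K) \<cdot> bact d a' (d' \<boxdot> (a'' \<boxdot> (d'' \<boxdot> w)))))"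
  have "(a'' \<rhd> mact g1 d0 d'' w) \<cdot> bact d0 a'' (d'' \<boxdot> w) \<cdot> mact g0 d d' (a'' \<boxdot> (d'' \<boxdot> w)) =
     (a'' \<rhd> (mact g1 d0 d'' w \<cdot> mact g0 d d' (d'' \<boxdot> w))) \<cdot> bact d a'' (d' \<boxdot> (d'' \<boxdot> w)) \<cdot> (d \<rhd> bact d' a'' (d'' \<boxdot> w))"
    by (simp add: bact_mact_left lwhisk_comp)
  also have "mact g1 d0 d'' w \<cdot> mact g0 d d' (d'' \<boxdot> w) = mact g2 d d3 w \<cdot> (d \<rhd> mact g3 d' d'' w)"
    by (rule mact_assoc[OF _ _ _ _ _ _ _ _ _ _ _ _ _ _ ga]) auto
  finally have K: "(a'' \<rhd> mact g1 d0 d'' w) \<cdot> bact d0 a'' (d'' \<boxdot> w) \<cdot> mact g0 d d' (a'' \<boxdot> (d'' \<boxdot> w)) = ?K" .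
  have "tact f1 g1 a0 d0 a'' d'' w \<cdot> tact f0 g0 a d a' d' (a'' \<boxdot> (d'' \<boxdot> w)) =
     (mact f1 a0 a'' (?z \<boxdot> w) \<cdot> mact f0 a a' (a'' \<boxdot> (?z \<boxdot> w))) \<cdot>
     (a \<rhd> ((a' \<rhd> ((a'' \<rhd> mact g1 d0 d'' w) \<cdot> bact d0 a'' (d'' \<boxdot> w) \<cdot> mact g0 d d' (a'' \<boxdot> (d'' \<boxdot> w)))) \<cdot>
       bact d a' (d' \<boxdot> (a'' \<boxdot> (d'' \<boxdot> w)))))"
    by (simp add: tact_def comp_apply[OF mact_natural] lwhisk_fuse)
  also have "mact f1 a0 a'' (?z \<boxdot> w) \<cdot> mact f0 a a' (a'' \<boxdot> (?z \<boxdot> w)) =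
      mact f2 a a3 (?z \<boxdot> w) \<cdot> (a \<rhd> mact f3 a' a'' (?z \<boxdot> w))"
    by (rule mact_assoc[OF _ _ _ _ _ _ _ _ _ _ _ _ _ _ fa]) auto
  finally have L: "tact f1 g1 a0 d0 a'' d'' w \<cdot> tact f0 g0 a d a' d' (a'' \<boxdot> (d'' \<boxdot> w)) = ?R"
    by (simp only: K) (simp add: lwhisk_fuse)
  \<comment> \<open>\<open>?J\<close> performs the product \<open>g3\<close> before d passes a'', as
    the right-hand side of the claim does; this is naturality of the exchange in its
    spectator.\<close>
  let ?J = "(a'' \<rhd> mact g2 d d3 w) \<cdot> bact d a'' (d3 \<boxdot> w) \<cdot> (d \<rhd> ((a'' \<rhd> mact g3 d' d'' w) \<cdot> bact d' a'' (d'' \<boxdot> w)))"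
  have "?K = ?J"
    by (simp add: lwhisk_comp comp_apply[OF bact_natural])
  then have "?R = mact f2 a a3 (?z \<boxdot> w) \<cdot> (a \<rhd> (mact f3 a' a'' (?z \<boxdot> w) \<cdot> (a' \<rhd> ?J) \<cdot> bact d a' (d' \<boxdot> (a'' \<boxdot> (d'' \<boxdot> w)))))"
    by (simp only:)
  also have "\<dots> = mact f2 a a3 (?z \<boxdot> w) \<cdot> (a \<rhd> ((a3 \<rhd> mact g2 d d3 w) \<cdot> bact d a3 (d3 \<boxdot> w) \<cdot>
      (d \<rhd> (mact f3 a' a'' (d3 \<boxdot> w) \<cdot> (a' \<rhd> ((a'' \<rhd> mact g3 d' d'' w) \<cdot> bact d' a'' (d'' \<boxdot> w)))))))"
    by (simp add: lwhisk_comp comp_apply[OF mact_natural] comp_apply[OF bact_natural[of d a']] bact_natural[of d a']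
        comp_apply[OF bact_mact_right])
  also have "\<dots> = tact f2 g2 a d a3 d3 w \<cdot> (a \<rhd> d \<rhd> tact f3 g3 a' d' a'' d'' w)"
    by (simp add: tact_def lwhisk_comp)
  finally show ?thesis
    using L by simp
qed

text \<open>This is \<open>tact_assoc\<close> for the spectator 1, translated back through
  \<open>mact_comp_left\<close> and \<open>mact_comp_right\<close>.\<close>

lemma tensor_mul_assoc:
  assumes [simp]: "a \<in> Obj C" "a' \<in> Obj C" "a'' \<in> Obj C" "d \<in> Obj C" "d' \<in> Obj C" "d'' \<in> Obj C"
  and [simp]: "f0 \<in> Arr C" "Dom C f0 = a \<boxdot> a'" "Cod C f0 = a0" "f1 \<in> Arr C" "Dom C f1 = a0 \<boxdot> a''"
    "f3 \<in> Arr C" "Dom C f3 = a' \<boxdot> a''" "Cod C f3 = a3" "f2 \<in> Arr C" "Dom C f2 = a \<boxdot> a3" "Cod C f2 = Cod C f1"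
  and fa: "f1 \<cdot> (f0 \<lhd> a'') = f2 \<cdot> (a \<rhd> f3) \<cdot> Assoc C a a' a''"
  and [simp]: "g0 \<in> Arr C" "Dom C g0 = d \<boxdot> d'" "Cod C g0 = d0" "g1 \<in> Arr C" "Dom C g1 = d0 \<boxdot> d''"
    "g3 \<in> Arr C" "Dom C g3 = d' \<boxdot> d''" "Cod C g3 = d3" "g2 \<in> Arr C" "Dom C g2 = d \<boxdot> d3" "Cod C g2 = Cod C g1"
  and ga: "g1 \<cdot> (g0 \<lhd> d'') = g2 \<cdot> (d \<rhd> g3) \<cdot> Assoc C d d' d''"
  shows "tensor_mul f1 g1 a0 d0 a'' d'' \<cdot> (tensor_mul f0 g0 a d a' d' \<lhd> (a'' \<boxdot> d'')) =
    tensor_mul f2 g2 a d a3 d3 \<cdot> ((a \<boxdot> d) \<rhd> tensor_mul f3 g3 a' d' a'' d'') \<cdot>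
    Assoc C (a \<boxdot> d) (a' \<boxdot> d') (a'' \<boxdot> d'')"
proof (rule rwhisk_unit_cancel)
  have [simp]: "a0 \<in> Obj C" "a3 \<in> Obj C" "d0 \<in> Obj C" "d3 \<in> Obj C"
    using obj_dom_cod(2)[of f0] obj_dom_cod(2)[of f3] obj_dom_cod(2)[of g0] obj_dom_cod(2)[of g3] by simp_all
  let ?w = "Unit C" and ?x = "a \<boxdot> d" and ?y = "a' \<boxdot> d'" and ?z = "a'' \<boxdot> d''"
  let ?m0 = "tensor_mul f0 g0 a d a' d'" and ?m1 = "tensor_mul f1 g1 a0 d0 a'' d''"
  let ?m2 = "tensor_mul f2 g2 a d a3 d3" and ?m3 = "tensor_mul f3 g3 a' d' a'' d''"
  \<comment> \<open>\<open>?e\<close> opens the brackets of the three pairs, so that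
    \<open>tact\<close> can act.\<close>
  let ?e = "(a \<rhd> d \<rhd> a' \<rhd> d' \<rhd> Assoc C a'' d'' ?w) \<cdot> (a \<rhd> d \<rhd> Assoc C a' d' (?z \<boxdot> ?w)) \<cdot>
    Assoc C a d (?y \<boxdot> (?z \<boxdot> ?w))"
  have T: "tact f1 g1 a0 d0 a'' d'' ?w \<cdot> tact f0 g0 a d a' d' (a'' \<boxdot> (d'' \<boxdot> ?w)) =
    tact f2 g2 a d a3 d3 ?w \<cdot> (a \<rhd> d \<rhd> tact f3 g3 a' d' a'' d'' ?w)"
    by (rule tact_assoc) (use fa ga in simp_all)
  have "Assoc C (Cod C f1) (Cod C g1) ?w \<cdot> mact ?m1 (a0 \<boxdot> d0) ?z ?w \<cdot> mact ?m0 ?x ?y (?z \<boxdot> ?w) =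
     tact f1 g1 a0 d0 a'' d'' ?w \<cdot> tact f0 g0 a d a' d' (a'' \<boxdot> (d'' \<boxdot> ?w)) \<cdot> ?e"
    by (simp add: comp_apply[OF mact_tensor_mul] mact_tensor_mul comp_apply[OF tact_natural])
  also have "\<dots> = tact f2 g2 a d a3 d3 ?w \<cdot> (a \<rhd> d \<rhd> tact f3 g3 a' d' a'' d'' ?w) \<cdot> ?e"
    by (simp add: comp_apply[OF T])
  also have "\<dots> = tact f2 g2 a d a3 d3 ?w \<cdot>
      (a \<rhd> d \<rhd> (tact f3 g3 a' d' a'' d'' ?w \<cdot> (a' \<rhd> d' \<rhd> Assoc C a'' d'' ?w) \<cdot> Assoc C a' d' (?z \<boxdot> ?w))) \<cdot>
      Assoc C a d (?y \<boxdot> (?z \<boxdot> ?w))"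
    by (simp add: lwhisk_comp)
  also have "tact f3 g3 a' d' a'' d'' ?w \<cdot> (a' \<rhd> d' \<rhd> Assoc C a'' d'' ?w) \<cdot> Assoc C a' d' (?z \<boxdot> ?w) =
      Assoc C a3 d3 ?w \<cdot> mact ?m3 ?y ?z ?w"
    by (simp add: mact_tensor_mul)
  also have "tact f2 g2 a d a3 d3 ?w \<cdot> (a \<rhd> d \<rhd> \<dots>) \<cdot> Assoc C a d (?y \<boxdot> (?z \<boxdot> ?w)) =
      (tact f2 g2 a d a3 d3 ?w \<cdot> (a \<rhd> d \<rhd> Assoc C a3 d3 ?w) \<cdot> Assoc C a d (a3 \<boxdot> d3 \<boxdot> ?w)) \<cdot>
      (?x \<rhd> mact ?m3 ?y ?z ?w)"
    by (simp add: lwhisk_comp assoc_ll)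
  also have "tact f2 g2 a d a3 d3 ?w \<cdot> (a \<rhd> d \<rhd> Assoc C a3 d3 ?w) \<cdot> Assoc C a d (a3 \<boxdot> d3 \<boxdot> ?w) =
      Assoc C (Cod C f1) (Cod C g1) ?w \<cdot> mact ?m2 ?x (a3 \<boxdot> d3) ?w"
    by (simp add: mact_tensor_mul)
  finally have "Assoc C (Cod C f1) (Cod C g1) ?w \<cdot> (mact ?m1 (a0 \<boxdot> d0) ?z ?w \<cdot> mact ?m0 ?x ?y (?z \<boxdot> ?w)) =
      Assoc C (Cod C f1) (Cod C g1) ?w \<cdot> (mact ?m2 ?x (a3 \<boxdot> d3) ?w \<cdot> (?x \<rhd> mact ?m3 ?y ?z ?w))"
    by simp
  then have eq: "mact ?m1 (a0 \<boxdot> d0) ?z ?w \<cdot> mact ?m0 ?x ?y (?z \<boxdot> ?w) =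
      mact ?m2 ?x (a3 \<boxdot> d3) ?w \<cdot> (?x \<rhd> mact ?m3 ?y ?z ?w)"
    by (rule mono_cancel[rotated]) auto
  let ?E = "Assoc C ?x ?y (?z \<boxdot> ?w) \<cdot> Assoc C (?x \<boxdot> ?y) ?z ?w"
  have "(?m1 \<cdot> (?m0 \<lhd> ?z)) \<lhd> ?w = (mact ?m1 (a0 \<boxdot> d0) ?z ?w \<cdot> mact ?m0 ?x ?y (?z \<boxdot> ?w)) \<cdot> ?E"
    using mact_comp_left[of ?x ?y ?z ?w ?m0 ?m1] by simp
  also have "\<dots> = (mact ?m2 ?x (a3 \<boxdot> d3) ?w \<cdot> (?x \<rhd> mact ?m3 ?y ?z ?w)) \<cdot> ?E"
    by (simp only: eq)
  also have "\<dots> = (?m2 \<cdot> (?x \<rhd> ?m3) \<cdot> Assoc C ?x ?y ?z) \<lhd> ?w"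
    using mact_comp_right[of ?x ?y ?z ?w ?m3 ?m2] by simp
  finally show "(?m1 \<cdot> (?m0 \<lhd> ?z)) \<lhd> ?w = (?m2 \<cdot> (?x \<rhd> ?m3) \<cdot> Assoc C ?x ?y ?z) \<lhd> ?w" .
qed (use obj_dom_cod(2)[of f0] obj_dom_cod(2)[of f3] obj_dom_cod(2)[of g0] obj_dom_cod(2)[of g3] in auto)

text \<open>The inserted v is carried past a by \<open>bact_uact_left\<close>; afterwards each unit
  stands next to its own factor and is absorbed there.\<close>

lemma tensor_mul_unit_left:
  assumes [simp]: "u \<in> Arr C" "Dom C u = Unit C" "Cod C u = a0" "v \<in> Arr C" "Dom C v = Unit C" "Cod C v = d0"
    "a \<in> Obj C" "d \<in> Obj C" "f \<in> Arr C" "Dom C f = a0 \<boxdot> a" "Cod C f = a"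
    "g \<in> Arr C" "Dom C g = d0 \<boxdot> d" "Cod C g = d"
  and fu: "f \<cdot> (u \<lhd> a) = LUnit C a" and gv: "g \<cdot> (v \<lhd> d) = LUnit C d"
  shows "tensor_mul f g a0 d0 a d \<cdot> (tensor_unit u v \<lhd> (a \<boxdot> d)) = LUnit C (a \<boxdot> d)"
proof (rule rwhisk_unit_cancel)
  have [simp]: "a0 \<in> Obj C" "d0 \<in> Obj C"
    using obj_dom_cod(2)[of u] obj_dom_cod(2)[of v] by simp_all
  let ?w = "Unit C" and ?m = "tensor_mul f g a0 d0 a d" and ?x = "a \<boxdot> d"
  have "Assoc C a d ?w \<cdot> mact ?m (a0 \<boxdot> d0) ?x ?w \<cdot> uact (tensor_unit u v) (?x \<boxdot> ?w) =
      tact f g a0 d0 a d ?w \<cdot> (a0 \<rhd> d0 \<rhd> Assoc C a d ?w) \<cdot> uact u (d0 \<boxdot> (?x \<boxdot> ?w)) \<cdot> uact v (?x \<boxdot> ?w)"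
    using uact_tensor[of "?x \<boxdot> ?w" u v a0 d0]
    by (simp add: comp_apply[OF mact_tensor_mul] tensor_unit_def)
  also have "\<dots> = tact f g a0 d0 a d ?w \<cdot> uact u (d0 \<boxdot> (a \<boxdot> (d \<boxdot> ?w))) \<cdot> uact v (a \<boxdot> (d \<boxdot> ?w)) \<cdot> Assoc C a d ?w"
    by (simp add: comp_apply[OF uact_natural] uact_natural)
  also have "tact f g a0 d0 a d ?w \<cdot> uact u (d0 \<boxdot> (a \<boxdot> (d \<boxdot> ?w))) \<cdot> uact v (a \<boxdot> (d \<boxdot> ?w)) \<cdot> Assoc C a d ?w =
     (mact f a0 a (d \<boxdot> ?w) \<cdot> uact u (a \<boxdot> (d \<boxdot> ?w))) \<cdot> (a \<rhd> (mact g d0 d ?w \<cdot> uact v (d \<boxdot> ?w))) \<cdot> Assoc C a d ?w"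
    by (simp add: tact_def comp_apply[OF uact_natural] comp_apply[OF bact_uact_left] lwhisk_comp)
  also have "\<dots> = Assoc C a d ?w \<cdot> Ide C (?x \<boxdot> ?w)"
    by (simp add: mact_unit_left_ide fu gv del: comp_assoc')
  finally have eq: "mact ?m (a0 \<boxdot> d0) ?x ?w \<cdot> uact (tensor_unit u v) (?x \<boxdot> ?w) = Ide C (?x \<boxdot> ?w)"
    by (rule mono_cancel[rotated]) auto
  have "(?m \<cdot> (tensor_unit u v \<lhd> ?x)) \<lhd> ?w =
      (mact ?m (a0 \<boxdot> d0) ?x ?w \<cdot> uact (tensor_unit u v) (?x \<boxdot> ?w)) \<cdot> (LUnit C ?x \<lhd> ?w)"
    by (simp add: mact_unit_left)
  then show "(?m \<cdot> (tensor_unit u v \<lhd> ?x)) \<lhd> ?w = LUnit C ?x \<lhd> ?w"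
    by (simp add: eq del: comp_assoc')
qed (use obj_dom_cod(2)[of u] obj_dom_cod(2)[of v] in auto)

lemma tensor_mul_unit_right:
  assumes [simp]: "u \<in> Arr C" "Dom C u = Unit C" "Cod C u = a0" "v \<in> Arr C" "Dom C v = Unit C" "Cod C v = d0"
    "a \<in> Obj C" "d \<in> Obj C" "f \<in> Arr C" "Dom C f = a \<boxdot> a0" "Cod C f = a"
    "g \<in> Arr C" "Dom C g = d \<boxdot> d0" "Cod C g = d"
  and fu: "f \<cdot> (a \<rhd> u) = RUnit C a" and gv: "g \<cdot> (d \<rhd> v) = RUnit C d"
  shows "tensor_mul f g a d a0 d0 \<cdot> ((a \<boxdot> d) \<rhd> tensor_unit u v) = RUnit C (a \<boxdot> d)"
proof (rule rwhisk_unit_cancel)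
  have [simp]: "a0 \<in> Obj C" "d0 \<in> Obj C"
    using obj_dom_cod(2)[of u] obj_dom_cod(2)[of v] by simp_all
  let ?w = "Unit C" and ?m = "tensor_mul f g a d a0 d0" and ?x = "a \<boxdot> d"
  have "Assoc C a d ?w \<cdot> mact ?m ?x (a0 \<boxdot> d0) ?w \<cdot> (?x \<rhd> uact (tensor_unit u v) ?w) =
      tact f g a d a0 d0 ?w \<cdot> (a \<rhd> d \<rhd> (Assoc C a0 d0 ?w \<cdot> uact (tensor_unit u v) ?w)) \<cdot> Assoc C a d ?w"
    by (simp add: comp_apply[OF mact_tensor_mul] assoc_ll lwhisk_comp)
  also have "Assoc C a0 d0 ?w \<cdot> uact (tensor_unit u v) ?w = uact u (d0 \<boxdot> ?w) \<cdot> uact v ?w"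
    using uact_tensor[of "?w" u v a0 d0] by (simp add: tensor_unit_def)
  also have "tact f g a d a0 d0 ?w \<cdot> (a \<rhd> d \<rhd> \<dots>) \<cdot> Assoc C a d ?w =
     mact f a a0 (d \<boxdot> ?w) \<cdot> (a \<rhd> ((a0 \<rhd> mact g d d0 ?w) \<cdot> uact u (d \<boxdot> (d0 \<boxdot> ?w)) \<cdot> (d \<rhd> uact v ?w))) \<cdot> Assoc C a d ?w"
    by (simp add: tact_def lwhisk_fuse) (simp add: lwhisk_comp comp_apply[OF bact_uact_right])
  also have "\<dots> = mact f a a0 (d \<boxdot> ?w) \<cdot> (a \<rhd> (uact u (d \<boxdot> ?w) \<cdot> mact g d d0 ?w \<cdot> (d \<rhd> uact v ?w))) \<cdot> Assoc C a d ?w"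
    by (simp add: comp_apply[OF uact_natural])
  also have "\<dots> = (mact f a a0 (d \<boxdot> ?w) \<cdot> (a \<rhd> uact u (d \<boxdot> ?w))) \<cdot> Assoc C a d ?w"
    using mact_unit_right_ide[of d ?w v d0 g] gv by simp
  also have "\<dots> = Assoc C a d ?w \<cdot> Ide C (?x \<boxdot> ?w)"
    by (simp add: mact_unit_right_ide fu del: comp_assoc')
  finally have eq: "mact ?m ?x (a0 \<boxdot> d0) ?w \<cdot> (?x \<rhd> uact (tensor_unit u v) ?w) = Ide C (?x \<boxdot> ?w)"
    by (rule mono_cancel[rotated]) auto
  have "(?m \<cdot> (?x \<rhd> tensor_unit u v)) \<lhd> ?w =
      (mact ?m ?x (a0 \<boxdot> d0) ?w \<cdot> (?x \<rhd> uact (tensor_unit u v) ?w)) \<cdot> (RUnit C ?x \<lhd> ?w)"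
    by (simp add: mact_unit_right)
  then show "(?m \<cdot> (?x \<rhd> tensor_unit u v)) \<lhd> ?w = RUnit C ?x \<lhd> ?w"
    by (simp add: eq del: comp_assoc')
qed (use obj_dom_cod(2)[of u] obj_dom_cod(2)[of v] in auto)

text \<open>Common first step of the product formulas below. The second argument \<open>Q\<close> is
  left open so that it can be either of the two embeddings.\<close>

lemma tensor_mul_left_incl:
  assumes [simp]: "v \<in> Arr C" "Dom C v = Unit C" "Cod C v = d"
    "a \<in> Obj C" "a' \<in> Obj C" "d' \<in> Obj C" "w \<in> Obj C" "Q \<in> Arr C" "Cod C Q = a' \<boxdot> d'"
    "f \<in> Arr C" "Dom C f = a \<boxdot> a'" "g \<in> Arr C" "Dom C g = d \<boxdot> d'"
  shows "Assoc C (Cod C f) (Cod C g) w \<cdot> ((tensor_mul f g a d a' d' \<cdot> (left_incl a v \<boxtimes> Q)) \<lhd> w) =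
    tact f g a d a' d' w \<cdot> (a \<rhd> (uact v (a' \<boxdot> (d' \<boxdot> w)) \<cdot> Assoc C a' d' w \<cdot> (Q \<lhd> w))) \<cdot> Assoc C a (Dom C Q) w"
proof -
  have [simp]: "d \<in> Obj C"
    using obj_dom_cod(2)[of v] by simp
  show ?thesis
    by (simp add: tensor_whisk rwhisk_comp comp_apply[OF rwhisk_tensor_mul] comp_apply[OF assoc_rr] assoc_lr
        comp_apply[OF assoc_left_incl] lwhisk_fuse comp_apply[OF uact_natural])
qed

lemma tensor_mul_right_incl:
  assumes [simp]: "u \<in> Arr C" "Dom C u = Unit C" "Cod C u = a"
    "d \<in> Obj C" "a' \<in> Obj C" "d' \<in> Obj C" "w \<in> Obj C" "Q \<in> Arr C" "Cod C Q = a' \<boxdot> d'"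
    "f \<in> Arr C" "Dom C f = a \<boxdot> a'" "g \<in> Arr C" "Dom C g = d \<boxdot> d'"
  shows "Assoc C (Cod C f) (Cod C g) w \<cdot> ((tensor_mul f g a d a' d' \<cdot> (right_incl u d \<boxtimes> Q)) \<lhd> w) =
    tact f g a d a' d' w \<cdot> uact u (d \<boxdot> (a' \<boxdot> (d' \<boxdot> w))) \<cdot> (d \<rhd> (Assoc C a' d' w \<cdot> (Q \<lhd> w))) \<cdot> Assoc C d (Dom C Q) w"
proof -
  have [simp]: "a \<in> Obj C"
    using obj_dom_cod(2)[of u] by simp
  show ?thesis
    by (simp add: tensor_whisk rwhisk_comp comp_apply[OF rwhisk_tensor_mul] comp_apply[OF assoc_rr] assoc_lr
        comp_apply[OF assoc_right_incl] lwhisk_comp comp_apply[OF uact_natural])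
qed

lemma tensor_mul_left_left:
  assumes [simp]: "v \<in> Arr C" "Dom C v = Unit C" "Cod C v = d"
    "a \<in> Obj C" "a' \<in> Obj C" "f \<in> Arr C" "Dom C f = a \<boxdot> a'" "g \<in> Arr C" "Dom C g = d \<boxdot> d" "Cod C g = d"
    and gv: "g \<cdot> (v \<lhd> d) = LUnit C d"
  shows "tensor_mul f g a d a' d \<cdot> (left_incl a v \<boxtimes> left_incl a' v) = left_incl (Cod C f) v \<cdot> f"
proof (rule rwhisk_unit_cancel)
  have [simp]: "d \<in> Obj C"
    using obj_dom_cod(2)[of v] by simp
  let ?w = "Unit C"
  have "Assoc C (Cod C f) d ?w \<cdot> ((tensor_mul f g a d a' d \<cdot> (left_incl a v \<boxtimes> left_incl a' v)) \<lhd> ?w) =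
      tact f g a d a' d ?w \<cdot> (a \<rhd> (uact v (a' \<boxdot> (d \<boxdot> ?w)) \<cdot> (a' \<rhd> uact v ?w))) \<cdot> Assoc C a a' ?w"
    using tensor_mul_left_incl[of v d a a' d ?w "left_incl a' v" f g] by (simp add: assoc_left_incl)
  also have "\<dots> = mact f a a' (d \<boxdot> ?w) \<cdot> (a \<rhd> a' \<rhd> ((mact g d d ?w \<cdot> uact v (d \<boxdot> ?w)) \<cdot> uact v ?w)) \<cdot> Assoc C a a' ?w"
    by (simp add: tact_def lwhisk_comp comp_apply[OF bact_uact_left])
      (simp add: lwhisk_fuse comp_apply[OF bact_uact_left])
  also have "(mact g d d ?w \<cdot> uact v (d \<boxdot> ?w)) \<cdot> uact v ?w = uact v ?w"
    using gv by (simp add: mact_unit_left_ide del: comp_assoc')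
  also have "mact f a a' (d \<boxdot> ?w) \<cdot> (a \<rhd> a' \<rhd> uact v ?w) \<cdot> Assoc C a a' ?w =
      ((Cod C f \<rhd> uact v ?w) \<cdot> mact f a a' ?w) \<cdot> Assoc C a a' ?w"
    by (subst mact_natural) auto
  also have "\<dots> = (Cod C f \<rhd> uact v ?w) \<cdot> (f \<lhd> ?w)"
    by simp
  also have "\<dots> = Assoc C (Cod C f) d ?w \<cdot> ((left_incl (Cod C f) v \<cdot> f) \<lhd> ?w)"
    by (simp add: rwhisk_comp comp_apply[OF assoc_left_incl])
  finally show "(tensor_mul f g a d a' d \<cdot> (left_incl a v \<boxtimes> left_incl a' v)) \<lhd> ?w = (left_incl (Cod C f) v \<cdot> f) \<lhd> ?w"
    by (rule mono_cancel[rotated]) auto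
qed (use obj_dom_cod(2)[of v] in auto)

lemma tensor_mul_right_right:
  assumes [simp]: "u \<in> Arr C" "Dom C u = Unit C" "Cod C u = a"
    "d \<in> Obj C" "d' \<in> Obj C" "g \<in> Arr C" "Dom C g = d \<boxdot> d'" "f \<in> Arr C" "Dom C f = a \<boxdot> a" "Cod C f = a"
    and fu: "f \<cdot> (u \<lhd> a) = LUnit C a"
  shows "tensor_mul f g a d a d' \<cdot> (right_incl u d \<boxtimes> right_incl u d') = right_incl u (Cod C g) \<cdot> g"
proof (rule rwhisk_unit_cancel)
  have [simp]: "a \<in> Obj C"
    using obj_dom_cod(2)[of u] by simp
  let ?w = "Unit C"
  have "Assoc C a (Cod C g) ?w \<cdot> ((tensor_mul f g a d a d' \<cdot> (right_incl u d \<boxtimes> right_incl u d')) \<lhd> ?w) =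
      tact f g a d a d' ?w \<cdot> uact u (d \<boxdot> (a \<boxdot> (d' \<boxdot> ?w))) \<cdot> (d \<rhd> uact u (d' \<boxdot> ?w)) \<cdot> Assoc C d d' ?w"
    using tensor_mul_right_incl[of u a d a d' ?w "right_incl u d'" f g] by (simp add: assoc_right_incl)
  also have "\<dots> = (mact f a a (Cod C g \<boxdot> ?w) \<cdot> uact u (a \<boxdot> (Cod C g \<boxdot> ?w))) \<cdot>
      (a \<rhd> mact g d d' ?w) \<cdot> uact u (d \<boxdot> (d' \<boxdot> ?w)) \<cdot> Assoc C d d' ?w"
    by (simp add: tact_def comp_apply[OF uact_natural] comp_apply[OF bact_uact_right])
  also have "\<dots> = uact u (Cod C g \<boxdot> ?w) \<cdot> mact g d d' ?w \<cdot> Assoc C d d' ?w"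
    by (simp add: mact_unit_left_ide fu del: comp_assoc') (simp add: comp_apply[OF uact_natural])
  also have "\<dots> = Assoc C a (Cod C g) ?w \<cdot> ((right_incl u (Cod C g) \<cdot> g) \<lhd> ?w)"
    by (simp add: rwhisk_comp comp_apply[OF assoc_right_incl])
  finally show "(tensor_mul f g a d a d' \<cdot> (right_incl u d \<boxtimes> right_incl u d')) \<lhd> ?w = (right_incl u (Cod C g) \<cdot> g) \<lhd> ?w"
    by (rule mono_cancel[rotated]) auto
qed (use obj_dom_cod(2)[of u] in auto)

lemma tensor_mul_left_right:
  assumes [simp]: "u \<in> Arr C" "Dom C u = Unit C" "Cod C u = a0" "v \<in> Arr C" "Dom C v = Unit C" "Cod C v = d0"
    "a \<in> Obj C" "d \<in> Obj C" "f \<in> Arr C" "Dom C f = a \<boxdot> a0" "Cod C f = a"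
    "g \<in> Arr C" "Dom C g = d0 \<boxdot> d" "Cod C g = d"
  and fu: "f \<cdot> (a \<rhd> u) = RUnit C a" and gv: "g \<cdot> (v \<lhd> d) = LUnit C d"
  shows "tensor_mul f g a d0 a0 d \<cdot> (left_incl a v \<boxtimes> right_incl u d) = Ide C (a \<boxdot> d)"
proof (rule rwhisk_unit_cancel)
  have [simp]: "a0 \<in> Obj C" "d0 \<in> Obj C"
    using obj_dom_cod(2)[of u] obj_dom_cod(2)[of v] by simp_all
  let ?w = "Unit C"
  have "Assoc C a d ?w \<cdot> ((tensor_mul f g a d0 a0 d \<cdot> (left_incl a v \<boxtimes> right_incl u d)) \<lhd> ?w) =
      tact f g a d0 a0 d ?w \<cdot> (a \<rhd> (uact v (a0 \<boxdot> (d \<boxdot> ?w)) \<cdot> uact u (d \<boxdot> ?w))) \<cdot> Assoc C a d ?w"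
    using tensor_mul_left_incl[of v d0 a a0 d ?w "right_incl u d" f g] by (simp add: assoc_right_incl)
  also have "\<dots> = mact f a a0 (d \<boxdot> ?w) \<cdot> (a \<rhd> ((a0 \<rhd> (mact g d0 d ?w \<cdot> uact v (d \<boxdot> ?w))) \<cdot> uact u (d \<boxdot> ?w))) \<cdot> Assoc C a d ?w"
    by (simp add: tact_def lwhisk_fuse comp_apply[OF bact_uact_left])
  also have "\<dots> = (mact f a a0 (d \<boxdot> ?w) \<cdot> (a \<rhd> uact u (d \<boxdot> ?w))) \<cdot> Assoc C a d ?w"
    by (simp add: mact_unit_left_ide gv)
  also have "\<dots> = Assoc C a d ?w \<cdot> (Ide C (a \<boxdot> d) \<lhd> ?w)"
    by (simp add: mact_unit_right_ide fu del: comp_assoc')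
  finally show "(tensor_mul f g a d0 a0 d \<cdot> (left_incl a v \<boxtimes> right_incl u d)) \<lhd> ?w = Ide C (a \<boxdot> d) \<lhd> ?w"
    by (rule mono_cancel[rotated]) auto
qed (use obj_dom_cod(2)[of u] obj_dom_cod(2)[of v] in auto)

text \<open>The one product of embedded factors in which the braiding survives: in the other three
  cases at least one of the two exchanged factors is a unit.\<close>

lemma tensor_mul_right_left:
  assumes [simp]: "u \<in> Arr C" "Dom C u = Unit C" "Cod C u = a0" "v \<in> Arr C" "Dom C v = Unit C" "Cod C v = d0"
    "a \<in> Obj C" "d \<in> Obj C" "f \<in> Arr C" "Dom C f = a0 \<boxdot> a" "Cod C f = a"
    "g \<in> Arr C" "Dom C g = d \<boxdot> d0" "Cod C g = d"
  and fu: "f \<cdot> (u \<lhd> a) = LUnit C a" and gv: "g \<cdot> (d \<rhd> v) = RUnit C d"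
  shows "tensor_mul f g a0 d a d0 \<cdot> (right_incl u d \<boxtimes> left_incl a v) = Braid C d a"
proof (rule rwhisk_unit_cancel)
  have [simp]: "a0 \<in> Obj C" "d0 \<in> Obj C"
    using obj_dom_cod(2)[of u] obj_dom_cod(2)[of v] by simp_all
  let ?w = "Unit C"
  have "Assoc C a d ?w \<cdot> ((tensor_mul f g a0 d a d0 \<cdot> (right_incl u d \<boxtimes> left_incl a v)) \<lhd> ?w) =
      tact f g a0 d a d0 ?w \<cdot> uact u (d \<boxdot> (a \<boxdot> (d0 \<boxdot> ?w))) \<cdot> (d \<rhd> a \<rhd> uact v ?w) \<cdot> Assoc C d a ?w"
    using tensor_mul_right_incl[of u a0 d a d0 ?w "left_incl a v" f g] by (simp add: assoc_left_incl)
  also have "\<dots> = (mact f a0 a (d \<boxdot> ?w) \<cdot> uact u (a \<boxdot> (d \<boxdot> ?w))) \<cdot> (a \<rhd> mact g d d0 ?w) \<cdot>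
      bact d a (d0 \<boxdot> ?w) \<cdot> (d \<rhd> a \<rhd> uact v ?w) \<cdot> Assoc C d a ?w"
    by (simp add: tact_def comp_apply[OF uact_natural])
  also have "\<dots> = (a \<rhd> (mact g d d0 ?w \<cdot> (d \<rhd> uact v ?w))) \<cdot> bact d a ?w \<cdot> Assoc C d a ?w"
    by (simp add: mact_unit_left_ide fu del: comp_assoc') (simp add: comp_apply[OF bact_natural] lwhisk_comp)
  also have "\<dots> = Assoc C a d ?w \<cdot> (Braid C d a \<lhd> ?w)"
    by (simp add: mact_unit_right_ide gv)
  finally show "(tensor_mul f g a0 d a d0 \<cdot> (right_incl u d \<boxtimes> left_incl a v)) \<lhd> ?w = Braid C d a \<lhd> ?w"
    by (rule mono_cancel[rotated]) auto
qed (use obj_dom_cod(2)[of u] obj_dom_cod(2)[of v] in auto)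

end


section \<open>Braided graded algebras and their super tensor products\<close>

context abelian_category
begin

text \<open>One statement for all additive operations in use: composing and tensoring with a fixed
  arrow, on either side.\<close>

lemma add_map_zero_inv:
  assumes "x \<in> Obj C" "y \<in> Obj C" "x' \<in> Obj C" "y' \<in> Obj C"
    and hom: "\<And>f. f \<in> Hom C x y \<Longrightarrow> \<phi> f \<in> Hom C x' y'"
    and add: "\<And>f g. \<lbrakk>f \<in> Hom C x y; g \<in> Hom C x y\<rbrakk> \<Longrightarrow> \<phi> (Add C f g) = Add C (\<phi> f) (\<phi> g)"
  shows "\<phi> (Zero C x y) = Zero C x' y'"
    and "f \<in> Hom C x y \<Longrightarrow> \<phi> (inv\<^bsub>hom_grp C x y\<^esub> f) = inv\<^bsub>hom_grp C x' y'\<^esub> (\<phi> f)"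
proof -
  interpret G: comm_group "hom_grp C x y"
    by (rule hom_comm_group) fact+
  interpret H: comm_group "hom_grp C x' y'"
    by (rule hom_comm_group) fact+
  interpret group_hom "hom_grp C x y" "hom_grp C x' y'" \<phi>
    using hom add by unfold_locales (auto simp: hom_def hom_grp_def)
  show "\<phi> (Zero C x y) = Zero C x' y'"
    using hom_one by (simp add: hom_grp_def)
  show "\<phi> (inv\<^bsub>hom_grp C x y\<^esub> f) = inv\<^bsub>hom_grp C x' y'\<^esub> (\<phi> f)" if "f \<in> Hom C x y"
    using hom_inv that by (simp add: hom_grp_def)
qed

lemma zero_arr [simp]:
  assumes "x \<in> Obj C" "y \<in> Obj C"
  shows "Zero C x y \<in> Arr C" "Dom C (Zero C x y) = x" "Cod C (Zero C x y) = y"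
proof -
  interpret comm_group "hom_grp C x y"
    by (rule hom_comm_group) fact+
  have "Zero C x y \<in> Hom C x y"
    using one_closed by (simp add: hom_grp_def)
  then show "Zero C x y \<in> Arr C" "Dom C (Zero C x y) = x" "Cod C (Zero C x y) = y"
    by (auto simp: Hom_def)
qed

lemma comp_zero:
  "\<lbrakk>f \<in> Arr C; y \<in> Obj C; Cod C f = z\<rbrakk> \<Longrightarrow> Zero C z y \<cdot> f = Zero C (Dom C f) y"
  "\<lbrakk>f \<in> Arr C; y \<in> Obj C; Dom C f = z\<rbrakk> \<Longrightarrow> f \<cdot> Zero C y z = Zero C y (Cod C f)"
proof -
  show "Zero C z y \<cdot> f = Zero C (Dom C f) y" if "f \<in> Arr C" "y \<in> Obj C" "Cod C f = z"
    using that by (intro add_map_zero_inv(1)[where \<phi> = "\<lambda>g. g \<cdot> f"])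
      (auto intro: comp_hom[OF arr_hom] comp_add_left[OF arr_hom] simp: arr_hom)
  show "f \<cdot> Zero C y z = Zero C y (Cod C f)" if "f \<in> Arr C" "y \<in> Obj C" "Dom C f = z"
    using that arr_hom[of f] by (intro add_map_zero_inv(1)[where \<phi> = "\<lambda>g. f \<cdot> g"])
      (auto intro: comp_hom comp_add_right simp: arr_hom)
qed

lemma inv_hom:
  assumes "f \<in> Hom C x y"
  shows "inv\<^bsub>hom_grp C x y\<^esub> f \<in> Hom C x y" "inv\<^bsub>hom_grp C x y\<^esub> (inv\<^bsub>hom_grp C x y\<^esub> f) = f"
proof -
  interpret comm_group "hom_grp C x y"
    using assms by (intro hom_comm_group) (auto dest: homD)
  show "inv\<^bsub>hom_grp C x y\<^esub> f \<in> Hom C x y" "inv\<^bsub>hom_grp C x y\<^esub> (inv\<^bsub>hom_grp C x y\<^esub> f) = f"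
    using assms inv_closed[of f] inv_inv[of f] by (auto simp: hom_grp_def)
qed

lemma signed_arr [simp]:
  assumes "f \<in> Arr C"
  shows "signed C n f \<in> Arr C" "Dom C (signed C n f) = Dom C f" "Cod C (signed C n f) = Cod C f"
  using homD[OF inv_hom(1)[OF arr_hom[OF assms]]] assms by (auto simp: signed_def)

lemma signed_0 [simp]: "signed C 0 f = f"
  by (simp add: signed_def)

lemma signed_signed [simp]: "f \<in> Arr C \<Longrightarrow> signed C m (signed C n f) = signed C (m + n) f"
  using inv_hom[OF arr_hom, of f] by (auto simp: signed_def Hom_def)

lemma signed_comp [simp]:
  assumes "f \<in> Arr C" "g \<in> Arr C" "Dom C g = Cod C f"
  shows "signed C n g \<cdot> f = signed C n (g \<cdot> f)" "g \<cdot> signed C n f = signed C n (g \<cdot> f)"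
proof -
  have "inv\<^bsub>hom_grp C (Dom C g) (Cod C g)\<^esub> g \<cdot> f = inv\<^bsub>hom_grp C (Dom C f) (Cod C g)\<^esub> (g \<cdot> f)"
    using assms arr_hom[of f] arr_hom[of g] by (intro add_map_zero_inv(2)[where \<phi> = "\<lambda>g. g \<cdot> f"])
      (auto intro: comp_hom[OF arr_hom] comp_add_left[OF arr_hom] simp: arr_hom)
  then show "signed C n g \<cdot> f = signed C n (g \<cdot> f)"
    using assms by (simp add: signed_def)
  have "g \<cdot> inv\<^bsub>hom_grp C (Dom C f) (Cod C f)\<^esub> f = inv\<^bsub>hom_grp C (Dom C f) (Cod C g)\<^esub> (g \<cdot> f)"
    using assms arr_hom[of f] arr_hom[of g] by (intro add_map_zero_inv(2)[where \<phi> = "\<lambda>f. g \<cdot> f"])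
      (auto intro: comp_hom comp_add_right simp: arr_hom)
  then show "g \<cdot> signed C n f = signed C n (g \<cdot> f)"
    using assms by (simp add: signed_def)
qed

lemma invertible_signed [simp]: "is_invertible C f \<Longrightarrow> is_invertible C (signed C n f)"
proof (rule invertibleI[where g = "signed C n (Inv C f)"])
  assume f: "is_invertible C f"
  note [simp] = f invertible_arr[OF f]
  show "signed C n (Inv C f) \<cdot> signed C n f = Ide C (Dom C (signed C n f))"
    "signed C n f \<cdot> signed C n (Inv C f) = Ide C (Cod C (signed C n f))"
    \<comment> \<open>The two signs combine to the exponent \<open>n + n\<close>, which is
      even.\<close>
    by (simp_all add: signed_def[of _ "n + n"])
qed (auto simp: invertible_arr)

lemma kernel_mono:
  assumes k: "is_kernel C k f"
  shows "is_mono C k"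
  unfolding is_mono_def
proof (intro conjI ballI impI)
  show k_arr [simp]: "k \<in> Arr C"
    using k by (simp add: is_kernel_def)
  fix x g h
  assume x: "x \<in> Obj C" and g: "g \<in> Hom C x (Dom C k)" and h: "h \<in> Hom C x (Dom C k)" and eq: "k \<cdot> g = k \<cdot> h"
  note [simp] = homD(1-3)[OF g]
  have [simp]: "f \<in> Arr C" "Cod C k = Dom C f" and fk: "f \<cdot> k = Zero C (Dom C k) (Cod C f)"
    using k by (auto simp: is_kernel_def)
  have "f \<cdot> k \<cdot> g = Zero C x (Cod C f)"
    by (simp add: comp_apply[OF fk] comp_zero)
  moreover have "k \<cdot> g \<in> Hom C x (Dom C f)"
    by (simp add: homI)
  ultimately have "\<exists>!u. u \<in> Hom C x (Dom C k) \<and> k \<cdot> u = k \<cdot> g"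
    using k x unfolding is_kernel_def by blast
  then show "g = h"
    using g h eq by metis
qed

lemma add_hom:
  assumes "f \<in> Hom C x y" "g \<in> Hom C x y"
  shows "Add C f g \<in> Hom C x y"
proof -
  interpret comm_group "hom_grp C x y"
    using assms by (intro hom_comm_group) (auto dest: homD)
  show ?thesis
    using m_closed[of f g] assms by (simp add: hom_grp_def)
qed

end


context abelian_braided_category
begin

lemma tensor_zero:
  assumes "f \<in> Arr C" "x \<in> Obj C" "y \<in> Obj C"
  shows "f \<boxtimes> Zero C x y = Zero C (Dom C f \<boxdot> x) (Cod C f \<boxdot> y)"
    "Zero C x y \<boxtimes> f = Zero C (x \<boxdot> Dom C f) (y \<boxdot> Cod C f)"
proof -
  show "f \<boxtimes> Zero C x y = Zero C (Dom C f \<boxdot> x) (Cod C f \<boxdot> y)"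
    using assms by (intro add_map_zero_inv(1)[where \<phi> = "\<lambda>g. f \<boxtimes> g"])
      (auto intro: tensor_hom tensor_add_right[OF arr_hom] simp: arr_hom)
  show "Zero C x y \<boxtimes> f = Zero C (x \<boxdot> Dom C f) (y \<boxdot> Cod C f)"
    using assms by (intro add_map_zero_inv(1)[where \<phi> = "\<lambda>g. g \<boxtimes> f"])
      (auto intro: tensor_hom tensor_add_left[OF _ _ arr_hom] simp: arr_hom)
qed

lemma signed_tensor [simp]:
  assumes "f \<in> Arr C" "g \<in> Arr C"
  shows "signed C n f \<boxtimes> g = signed C n (f \<boxtimes> g)" "f \<boxtimes> signed C n g = signed C n (f \<boxtimes> g)"
proof -
  have "(inv\<^bsub>hom_grp C (Dom C f) (Cod C f)\<^esub> f) \<boxtimes> g =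
      inv\<^bsub>hom_grp C (Dom C f \<boxdot> Dom C g) (Cod C f \<boxdot> Cod C g)\<^esub> (f \<boxtimes> g)"
    using assms by (intro add_map_zero_inv(2)[where \<phi> = "\<lambda>f. f \<boxtimes> g"])
      (auto intro: tensor_hom tensor_add_left[OF _ _ arr_hom] simp: arr_hom)
  then show "signed C n f \<boxtimes> g = signed C n (f \<boxtimes> g)"
    using assms by (simp add: signed_def)
  have "f \<boxtimes> (inv\<^bsub>hom_grp C (Dom C g) (Cod C g)\<^esub> g) =
      inv\<^bsub>hom_grp C (Dom C f \<boxdot> Dom C g) (Cod C f \<boxdot> Cod C g)\<^esub> (f \<boxtimes> g)"
    using assms by (intro add_map_zero_inv(2)[where \<phi> = "\<lambda>g. f \<boxtimes> g"])
      (auto intro: tensor_hom tensor_add_right[OF arr_hom] simp: arr_hom)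
  then show "f \<boxtimes> signed C n g = signed C n (f \<boxtimes> g)"
    using assms by (simp add: signed_def)
qed

lemma signed_whisk [simp]:
  assumes "f \<in> Arr C" "x \<in> Obj C"
  shows "signed C n f \<lhd> x = signed C n (f \<lhd> x)" "x \<rhd> signed C n f = signed C n (x \<rhd> f)"
  using assms by (simp_all add: lwhisk_def rwhisk_def)

end


text \<open>Degrees are taken from an arbitrary type with an associative, unital \<open>add\<close>,
  because the degrees of \<Omega> are nested pairs such as \<open>((p, ()), q)\<close>. Additivity
  of \<open>gdeg\<close> is what makes the signs of iterated products consistent.\<close>

locale braided_graded_algebra = abelian_braided_category C
  for C :: "('o, 'a) braided_data" (structure) +
  fixes A :: "('g, 'o, 'a) graded_algebra" and add :: "'g \<Rightarrow> 'g \<Rightarrow> 'g" and e :: 'g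
  assumes add_assoc [simp]: "add (add x y) z = add x (add y z)"
    and add_e [simp]: "add e x = x" "add x e = x"
    and gobj_obj [simp]: "gobj A x \<in> Obj C"
    and gmul_hom: "gmul A x y \<in> Hom C (gobj A x \<boxdot> gobj A y) (gobj A (add x y))"
    and guni_hom: "guni A \<in> Hom C (Unit C) (gobj A e)"
    and gmul_assoc: "gmul A (add x y) z \<cdot> (gmul A x y \<boxtimes> Ide C (gobj A z)) =
      gmul A x (add y z) \<cdot> (Ide C (gobj A x) \<boxtimes> gmul A y z) \<cdot> Assoc C (gobj A x) (gobj A y) (gobj A z)"
    and gmul_unit_left: "gmul A e x \<cdot> (guni A \<boxtimes> Ide C (gobj A x)) = LUnit C (gobj A x)"
    and gmul_unit_right: "gmul A x e \<cdot> (Ide C (gobj A x) \<boxtimes> guni A) = RUnit C (gobj A x)"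
    and gdeg_add [simp]: "gdeg A (add x y) = gdeg A x + gdeg A y"
begin

lemma gdeg_e [simp]: "gdeg A e = 0"
  using gdeg_add[of e e] by simp

lemma gmul_arr [simp]:
  "gmul A x y \<in> Arr C" "Dom C (gmul A x y) = gobj A x \<boxdot> gobj A y" "Cod C (gmul A x y) = gobj A (add x y)"
  using homD[OF gmul_hom] by auto

lemma guni_arr [simp]:
  "guni A \<in> Arr C" "Dom C (guni A) = Unit C" "Cod C (guni A) = gobj A e"
  using homD[OF guni_hom] by auto

text \<open>The product of generalized elements: arrows into homogeneous components take the place
  of elements, and the rules that follow read like the laws of an ordinary algebra.\<close>

definition gprod :: "'g \<Rightarrow> 'g \<Rightarrow> 'a \<Rightarrow> 'a \<Rightarrow> 'a"
  where "gprod x y f g = gmul A x y \<cdot> (f \<boxtimes> g)"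

lemma gprod_arr [simp]:
  assumes "f \<in> Arr C" "Cod C f = gobj A x" "g \<in> Arr C" "Cod C g = gobj A y"
  shows "gprod x y f g \<in> Arr C" "Dom C (gprod x y f g) = Dom C f \<boxdot> Dom C g"
    "Cod C (gprod x y f g) = gobj A (add x y)"
  using assms by (auto simp: gprod_def)

lemma gprod_comp:
  assumes "f \<in> Arr C" "Cod C f = gobj A x" "g \<in> Arr C" "Cod C g = gobj A y"
    "u \<in> Arr C" "v \<in> Arr C" "Cod C u = Dom C f" "Cod C v = Dom C g"
  shows "gprod x y f g \<cdot> (u \<boxtimes> v) = gprod x y (f \<cdot> u) (g \<cdot> v)"
  using assms by (simp add: gprod_def tensor_comp')

lemma gprod_whisk:
  assumes "f \<in> Arr C" "Cod C f = gobj A x" "g \<in> Arr C" "Cod C g = gobj A y" "u \<in> Arr C"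
  shows "\<lbrakk>Cod C u = Dom C f; Dom C g = d\<rbrakk> \<Longrightarrow> gprod x y f g \<cdot> (u \<boxtimes> Ide C d) = gprod x y (f \<cdot> u) g"
    "\<lbrakk>Cod C u = Dom C g; Dom C f = d\<rbrakk> \<Longrightarrow> gprod x y f g \<cdot> (Ide C d \<boxtimes> u) = gprod x y f (g \<cdot> u)"
  using assms by (auto simp: gprod_comp)

lemma gprod_assoc:
  assumes "f \<in> Arr C" "Cod C f = gobj A x" "g \<in> Arr C" "Cod C g = gobj A y" "h \<in> Arr C" "Cod C h = gobj A z"
  shows "gprod (add x y) z (gprod x y f g) h =
    gprod x (add y z) f (gprod y z g h) \<cdot> Assoc C (Dom C f) (Dom C g) (Dom C h)"
proof -
  have "gprod (add x y) z (gprod x y f g) h =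
      (gmul A (add x y) z \<cdot> (gmul A x y \<boxtimes> Ide C (gobj A z))) \<cdot> (f \<boxtimes> g \<boxtimes> h)"
    using assms by (simp add: gprod_def tensor_comp')
  also have "\<dots> = gmul A x (add y z) \<cdot> (Ide C (gobj A x) \<boxtimes> gmul A y z) \<cdot> (f \<boxtimes> (g \<boxtimes> h)) \<cdot>
      Assoc C (Dom C f) (Dom C g) (Dom C h)"
    using assms by (simp add: gmul_assoc assoc_natural')
  also have "\<dots> = gprod x (add y z) f (gprod y z g h) \<cdot> Assoc C (Dom C f) (Dom C g) (Dom C h)"
    using assms comp_apply[OF tensor_comp'[of f "Ide C (gobj A x)" "g \<boxtimes> h" "gmul A y z"]]
    by (simp add: gprod_def)
  finally show ?thesis .
qed

lemma gprod_unit_left: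
  "\<lbrakk>f \<in> Arr C; Cod C f = gobj A x\<rbrakk> \<Longrightarrow> gprod e x (guni A) f = f \<cdot> LUnit C (Dom C f)"
  using lunit_natural'[of f "gobj A x"] comp_apply[OF gmul_unit_left[of x], of "Ide C (Unit C) \<boxtimes> f"]
  by (simp add: gprod_def tensor_comp')

lemma gprod_unit_right:
  "\<lbrakk>f \<in> Arr C; Cod C f = gobj A x\<rbrakk> \<Longrightarrow> gprod x e f (guni A) = f \<cdot> RUnit C (Dom C f)"
  using runit_natural'[of f "gobj A x"] comp_apply[OF gmul_unit_right[of x], of "f \<boxtimes> Ide C (Unit C)"]
  by (simp add: gprod_def tensor_comp')

text \<open>The two product maps differ by an associator, so invertibility can be moved across a
  change of brackets.\<close>

lemma invertible_gprod_assoc: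
  assumes "f \<in> Arr C" "Cod C f = gobj A x" "g \<in> Arr C" "Cod C g = gobj A y" "h \<in> Arr C" "Cod C h = gobj A z"
  shows "is_invertible C (gprod (add x y) z (gprod x y f g) h) \<longleftrightarrow> is_invertible C (gprod x (add y z) f (gprod y z g h))"
proof -
  let ?a = "Assoc C (Dom C f) (Dom C g) (Dom C h)"
  have e: "gprod x (add y z) f (gprod y z g h) = gprod (add x y) z (gprod x y f g) h \<cdot> Inv C ?a"
    using assms by (simp add: gprod_assoc)
  show ?thesis
  proof
    show "is_invertible C (gprod x (add y z) f (gprod y z g h))"
      if "is_invertible C (gprod (add x y) z (gprod x y f g) h)"
      unfolding e using assms that by simp
    show "is_invertible C (gprod (add x y) z (gprod x y f g) h)"
      if "is_invertible C (gprod x (add y z) f (gprod y z g h))"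
      using assms that by (simp add: gprod_assoc)
  qed
qed

text \<open>Allows one factor of an invertible product map to be modified by an isomorphism, in the
  application by a braiding.\<close>

lemma invertible_gprod_comp:
  assumes "is_invertible C (gprod x y f g)" "f \<in> Arr C" "Cod C f = gobj A x" "g \<in> Arr C" "Cod C g = gobj A y"
    and "is_invertible C u"
  shows "Cod C u = Dom C f \<Longrightarrow> is_invertible C (gprod x y (f \<cdot> u) g)"
    "Cod C u = Dom C g \<Longrightarrow> is_invertible C (gprod x y f (g \<cdot> u))"
  using assms invertible_arr[OF assms(6)] by (simp_all flip: gprod_whisk)

lemma gprod_signed:
  assumes "f \<in> Arr C" "Cod C f = gobj A x" "g \<in> Arr C" "Cod C g = gobj A y"
  shows "gprod x y (signed C n f) g = signed C n (gprod x y f g)"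
  using assms by (simp add: gprod_def)

end


section \<open>The super tensor product as a graded algebra, and its two embedded factors\<close>

locale braided_graded_algebra_pair = abelian_braided_category C +
    A: braided_graded_algebra C A addA eA + D: braided_graded_algebra C D addD eD
  for C :: "('o, 'a) braided_data" (structure)
    and A :: "('g, 'o, 'a) graded_algebra" and addA eA
    and D :: "('h, 'o, 'a) graded_algebra" and addD eD
begin

abbreviation "S \<equiv> super_tensor C A D"

definition "addS = (\<lambda>(x, y) (x', y'). (addA x x', addD y y'))"

lemma addS_pair [simp]: "addS (x, y) (x', y') = (addA x x', addD y y')"
  by (simp add: addS_def)

abbreviation "mulS x y x' y' \<equiv>
  tensor_mul (gmul A x x') (gmul D y y') (gobj A x) (gobj D y) (gobj A x') (gobj D y')"

lemma super_tensor_simps [simp]: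
  "gobj S (x, y) = gobj A x \<boxdot> gobj D y"
  "gmul S (x, y) (x', y') = signed C (gdeg D y * gdeg A x') (mulS x y x' y')"
  "guni S = tensor_unit (guni A) (guni D)"
  "gdeg S (x, y) = gdeg A x + gdeg D y"
  by (simp_all add: super_tensor_def tensor_mul_def tensor_unit_def)

lemma mulS_assoc:
  "mulS (addA x x') (addD y y') x'' y'' \<cdot> (mulS x y x' y' \<lhd> (gobj A x'' \<boxdot> gobj D y'')) =
   mulS x y (addA x' x'') (addD y' y'') \<cdot> ((gobj A x \<boxdot> gobj D y) \<rhd> mulS x' y' x'' y'') \<cdot>
    Assoc C (gobj A x \<boxdot> gobj D y) (gobj A x' \<boxdot> gobj D y') (gobj A x'' \<boxdot> gobj D y'')"
  by (rule tensor_mul_assoc)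
    (auto simp: A.gmul_assoc[folded lwhisk_def rwhisk_def] D.gmul_assoc[folded lwhisk_def rwhisk_def])

lemma mulS_unit:
  "mulS eA eD x y \<cdot> (tensor_unit (guni A) (guni D) \<lhd> (gobj A x \<boxdot> gobj D y)) = LUnit C (gobj A x \<boxdot> gobj D y)"
  "mulS x y eA eD \<cdot> ((gobj A x \<boxdot> gobj D y) \<rhd> tensor_unit (guni A) (guni D)) = RUnit C (gobj A x \<boxdot> gobj D y)"
  by (rule tensor_mul_unit_left tensor_mul_unit_right;
      simp add: A.gmul_unit_left[folded rwhisk_def] D.gmul_unit_left[folded rwhisk_def]
        A.gmul_unit_right[folded lwhisk_def] D.gmul_unit_right[folded lwhisk_def])+

sublocale super: braided_graded_algebra C S addS "(eA, eD)"
proof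
  fix p q r :: "'g \<times> 'h"
  obtain x y x' y' x'' y'' where [simp]: "p = (x, y)" "q = (x', y')" "r = (x'', y'')"
    by (metis surj_pair)
  show "addS (addS p q) r = addS p (addS q r)" "addS (eA, eD) p = p" "addS p (eA, eD) = p" "gobj S p \<in> Obj C"
    "gdeg S (addS p q) = gdeg S p + gdeg S q"
    by simp_all
  show "gmul S p q \<in> Hom C (gobj S p \<boxdot> gobj S q) (gobj S (addS p q))" "guni S \<in> Hom C (Unit C) (gobj S (eA, eD))"
    by (auto intro!: homI)
  show "gmul S (eA, eD) p \<cdot> (guni S \<boxtimes> Ide C (gobj S p)) = LUnit C (gobj S p)"
    "gmul S p (eA, eD) \<cdot> (Ide C (gobj S p) \<boxtimes> guni S) = RUnit C (gobj S p)"
    using mulS_unit by (simp_all add: lwhisk_def rwhisk_def)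
  \<comment> \<open>The exponent of the sign is bilinear in the degrees: both bracketings collect
    |y||x'| + |y||x''| + |y'||x''|. The rest is \<open>mulS_assoc\<close>.\<close>
  show "gmul S (addS p q) r \<cdot> (gmul S p q \<boxtimes> Ide C (gobj S r)) =
      gmul S p (addS q r) \<cdot> (Ide C (gobj S p) \<boxtimes> gmul S q r) \<cdot> Assoc C (gobj S p) (gobj S q) (gobj S r)"
    using mulS_assoc[of x x' x'' y y' y'']
    by (simp add: algebra_simps flip: lwhisk_def rwhisk_def)
qed

definition "inA x = left_incl (gobj A x) (guni D)"
definition "inD y = right_incl (guni A) (gobj D y)"

lemma incl_arr [simp]:
  "inA x \<in> Arr C" "Dom C (inA x) = gobj A x" "Cod C (inA x) = gobj A x \<boxdot> gobj D eD"
  "inD y \<in> Arr C" "Dom C (inD y) = gobj D y" "Cod C (inD y) = gobj A eA \<boxdot> gobj D y"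
  by (simp_all add: inA_def inD_def)

lemma inA_inA: "super.gprod (x, eD) (x', eD) (inA x) (inA x') = inA (addA x x') \<cdot> gmul A x x'"
  using tensor_mul_left_left[of "guni D" "gobj D eD" "gobj A x" "gobj A x'" "gmul A x x'" "gmul D eD eD"]
    D.gmul_unit_left[of eD]
  by (simp add: super.gprod_def inA_def rwhisk_def)

lemma inD_inD: "super.gprod (eA, y) (eA, y') (inD y) (inD y') = inD (addD y y') \<cdot> gmul D y y'"
  using tensor_mul_right_right[of "guni A" "gobj A eA" "gobj D y" "gobj D y'" "gmul D y y'" "gmul A eA eA"]
    A.gmul_unit_left[of eA]
  by (simp add: super.gprod_def inD_def rwhisk_def)

text \<open>Only units, of degree 0, are exchanged here, so neither braiding nor sign remains. The
  opposite order in \<open>inD_inA\<close> is the commutation relation between the two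
  factors.\<close>

lemma inA_inD: "super.gprod (x, eD) (eA, y) (inA x) (inD y) = Ide C (gobj A x \<boxdot> gobj D y)"
  using tensor_mul_left_right[of "guni A" "gobj A eA" "guni D" "gobj D eD" "gobj A x" "gobj D y"
      "gmul A x eA" "gmul D eD y"] A.gmul_unit_right[of x] D.gmul_unit_left[of y]
  by (simp add: super.gprod_def inA_def inD_def rwhisk_def lwhisk_def)

lemma inD_inA: "super.gprod (eA, y) (x, eD) (inD y) (inA x) =
    signed C (gdeg D y * gdeg A x) (Braid C (gobj D y) (gobj A x))"
  using tensor_mul_right_left[of "guni A" "gobj A eA" "guni D" "gobj D eD" "gobj A x" "gobj D y"
      "gmul A eA x" "gmul D y eD"] A.gmul_unit_left[of x] D.gmul_unit_right[of y]
  by (simp add: super.gprod_def inA_def inD_def rwhisk_def lwhisk_def)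

lemma gprod_inA_inA:
  assumes "f \<in> Arr C" "Cod C f = gobj A x" "g \<in> Arr C" "Cod C g = gobj A x'"
  shows "super.gprod (x, eD) (x', eD) (inA x \<cdot> f) (inA x' \<cdot> g) = inA (addA x x') \<cdot> A.gprod x x' f g"
  using assms inA_inA[of x x'] by (simp add: A.gprod_def flip: super.gprod_comp)

lemma gprod_inA_inD:
  assumes "f \<in> Arr C" "Cod C f = gobj A x" "g \<in> Arr C" "Cod C g = gobj D y"
  shows "super.gprod (x, eD) (eA, y) (inA x \<cdot> f) (inD y \<cdot> g) = f \<boxtimes> g"
  using assms inA_inD[of x y] by (simp flip: super.gprod_comp)

lemma gprod_inD_inA:
  assumes "f \<in> Arr C" "Cod C f = gobj A x" "g \<in> Arr C" "Cod C g = gobj D y"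
  shows "super.gprod (eA, y) (x, eD) (inD y \<cdot> g) (inA x \<cdot> f) =
    signed C (gdeg D y * gdeg A x) ((f \<boxtimes> g) \<cdot> Braid C (Dom C g) (Dom C f))"
  using assms inD_inA[of y x] braid_natural[OF arr_hom arr_hom, of g f] by (simp flip: super.gprod_comp)

end


section \<open>Relative tensor products of free modules\<close>

context monoidal_category
begin

lemma algebra_arr:
  assumes "is_algebra C B"
  shows "carr B \<in> Obj C"
    "mul B \<in> Arr C" "Dom C (mul B) = carr B \<boxdot> carr B" "Cod C (mul B) = carr B"
    "uni B \<in> Arr C" "Dom C (uni B) = Unit C" "Cod C (uni B) = carr B"
    "mul B \<cdot> (mul B \<boxtimes> Ide C (carr B)) = mul B \<cdot> (Ide C (carr B) \<boxtimes> mul B) \<cdot> Assoc C (carr B) (carr B) (carr B)"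
    "mul B \<cdot> (uni B \<boxtimes> Ide C (carr B)) = LUnit C (carr B)"
    "mul B \<cdot> (Ide C (carr B) \<boxtimes> uni B) = RUnit C (carr B)"
  using assms unfolding is_algebra_def Let_def by (auto simp: Hom_def)

lemma bimodule_arr:
  assumes "is_bimodule C B M"
  shows "mobj M \<in> Obj C"
    "lact M \<in> Arr C" "Dom C (lact M) = carr B \<boxdot> mobj M" "Cod C (lact M) = mobj M"
    "ract M \<in> Arr C" "Dom C (ract M) = mobj M \<boxdot> carr B" "Cod C (ract M) = mobj M"
    "ract M \<cdot> (ract M \<boxtimes> Ide C (carr B)) = ract M \<cdot> (Ide C (mobj M) \<boxtimes> mul B) \<cdot> Assoc C (mobj M) (carr B) (carr B)"
  using assms unfolding is_bimodule_def Let_def by (auto simp: Hom_def)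

lemma regular_bimodule: "is_algebra C B \<Longrightarrow> is_bimodule C B (regular_bimodule B)"
  unfolding is_algebra_def is_bimodule_def regular_bimodule_def Let_def by simp

text \<open>Any other model M is compared with Z through the two universal properties. Linearity of
  the comparison \<open>f\<close> is tested after tensoring \<open>\<pi>\<close> with B; this is
  legitimate because the section \<open>s\<close> makes \<open>\<pi>\<close> a split epimorphism,
  and split epimorphisms stay split after tensoring.\<close>

lemma descends_to_bimodule_isoI:
  assumes w: "is_tensor_over C B X Y Z w" and B: "is_algebra C B"
    and s [simp]: "s \<in> Arr C" "Dom C s = mobj Z" "Cod C s = mobj X \<boxdot> mobj Y" "w \<cdot> s = Ide C (mobj Z)"
  shows "descends_to_bimodule_iso C B X Y Z w"
  unfolding descends_to_bimodule_iso_def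
proof (intro conjI allI impI)
  show "\<exists>M \<pi>. is_tensor_over C B X Y M \<pi>"
    using w by blast
  fix M \<pi>
  assume p: "is_tensor_over C B X Y M \<pi>"
  let ?x = "mobj X" and ?y = "mobj Y" and ?b = "carr B"
  note W = w[unfolded is_tensor_over_def Let_def] and P = p[unfolded is_tensor_over_def Let_def]
  have bim: "is_bimodule C B X" "is_bimodule C B Y" "is_bimodule C B Z" "is_bimodule C B M"
    using W P by auto
  note [simp] = algebra_arr(1-7)[OF B] bimodule_arr(1-7)[OF bim(1)] bimodule_arr(1-7)[OF bim(2)]
    bimodule_arr(1-7)[OF bim(3)] bimodule_arr(1-7)[OF bim(4)]
  have wh: "w \<in> Hom C (?x \<boxdot> ?y) (mobj Z)" and ph: "\<pi> \<in> Hom C (?x \<boxdot> ?y) (mobj M)"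
    using W P by auto
  note [simp] = homD(1-3)[OF wh] homD(1-3)[OF ph]
  obtain f where f: "f \<in> Hom C (mobj M) (mobj Z)" and fp: "f \<cdot> \<pi> = w"
    using P W wh bimodule_arr(1)[OF bim(3)] by metis
  obtain g where g: "g \<in> Hom C (mobj Z) (mobj M)" and gw: "g \<cdot> w = \<pi>"
    using P W ph bimodule_arr(1)[OF bim(4)] by metis
  note [simp] = homD(1-3)[OF f] homD(1-3)[OF g]
  have gs: "g = \<pi> \<cdot> s"
    by (simp flip: gw)
  have fg: "f \<cdot> g = Ide C (mobj Z)"
    by (simp add: gs comp_apply[OF fp])
  have "\<exists>!t. t \<in> Hom C (mobj M) (mobj M) \<and> t \<cdot> \<pi> = \<pi>"
    using P ph bimodule_arr(1)[OF bim(4)] by blast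
  moreover have "g \<cdot> f \<in> Hom C (mobj M) (mobj M) \<and> (g \<cdot> f) \<cdot> \<pi> = \<pi>"
    by (simp add: fp gw homI)
  moreover have "Ide C (mobj M) \<in> Hom C (mobj M) (mobj M) \<and> Ide C (mobj M) \<cdot> \<pi> = \<pi>"
    by (simp add: homI)
  ultimately have gf: "g \<cdot> f = Ide C (mobj M)"
    by blast
  then have psf: "\<pi> \<cdot> s \<cdot> f = Ide C (mobj M)"
    by (simp add: gs)
  \<comment> \<open>Cancellation of a split epimorphism; \<open>F\<close> will come from
    \<open>psf\<close>, by which \<open>s \<cdot> f\<close> is a section of
    \<open>\<pi>\<close>.\<close>
  have epi: "P = Q" if "P \<cdot> E = Q \<cdot> E" "E \<cdot> F = Ide C m" "P \<in> Arr C" "Q \<in> Arr C" "E \<in> Arr C" "F \<in> Arr C"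
    "Dom C P = m" "Dom C Q = m" "Cod C E = m" "Dom C E = Cod C F" for P Q E F m
  proof -
    have "P = (P \<cdot> E) \<cdot> F"
      using that(2-) by simp
    also have "\<dots> = Q"
      unfolding that(1) using that(2-) by simp
    finally show ?thesis .
  qed
  have "(f \<cdot> lact M \<cdot> (Ide C ?b \<boxtimes> \<pi>)) \<cdot> Assoc C ?b ?x ?y = f \<cdot> \<pi> \<cdot> (lact X \<boxtimes> Ide C ?y)"
    using P by simp
  also have "\<dots> = lact Z \<cdot> (Ide C ?b \<boxtimes> w) \<cdot> Assoc C ?b ?x ?y"
    using W by (simp add: comp_apply[OF fp])
  also have "Ide C ?b \<boxtimes> w = (Ide C ?b \<boxtimes> f) \<cdot> (Ide C ?b \<boxtimes> \<pi>)"
    by (simp add: tensor_comp' fp)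
  finally have "(f \<cdot> lact M \<cdot> (Ide C ?b \<boxtimes> \<pi>)) \<cdot> Assoc C ?b ?x ?y =
      (lact Z \<cdot> (Ide C ?b \<boxtimes> f) \<cdot> (Ide C ?b \<boxtimes> \<pi>)) \<cdot> Assoc C ?b ?x ?y"
    by simp
  then have "f \<cdot> lact M \<cdot> (Ide C ?b \<boxtimes> \<pi>) = lact Z \<cdot> (Ide C ?b \<boxtimes> f) \<cdot> (Ide C ?b \<boxtimes> \<pi>)"
    by (rule epi_cancel[rotated]) auto
  then have "(f \<cdot> lact M) \<cdot> (Ide C ?b \<boxtimes> \<pi>) = (lact Z \<cdot> (Ide C ?b \<boxtimes> f)) \<cdot> (Ide C ?b \<boxtimes> \<pi>)"
    by simp
  then have l: "f \<cdot> lact M = lact Z \<cdot> (Ide C ?b \<boxtimes> f)"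
    by (rule epi[where F = "Ide C ?b \<boxtimes> (s \<cdot> f)"]) (auto simp: tensor_comp' psf)
  have "f \<cdot> ract M \<cdot> (\<pi> \<boxtimes> Ide C ?b) = f \<cdot> \<pi> \<cdot> (Ide C ?x \<boxtimes> ract Y) \<cdot> Assoc C ?x ?y ?b"
    using P by simp
  also have "\<dots> = ract Z \<cdot> (w \<boxtimes> Ide C ?b)"
    using W by (simp add: comp_apply[OF fp])
  also have "w \<boxtimes> Ide C ?b = (f \<boxtimes> Ide C ?b) \<cdot> (\<pi> \<boxtimes> Ide C ?b)"
    by (simp add: tensor_comp' fp)
  finally have "(f \<cdot> ract M) \<cdot> (\<pi> \<boxtimes> Ide C ?b) = (ract Z \<cdot> (f \<boxtimes> Ide C ?b)) \<cdot> (\<pi> \<boxtimes> Ide C ?b)"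
    by simp
  then have r: "f \<cdot> ract M = ract Z \<cdot> (f \<boxtimes> Ide C ?b)"
    by (rule epi[where F = "(s \<cdot> f) \<boxtimes> Ide C ?b"]) (auto simp: tensor_comp' psf)
  have "is_invertible C f"
    using fg gf by (intro invertibleI[of _ g]) auto
  then show "\<exists>f. f \<cdot> \<pi> = w \<and> is_bimodule_iso C B M Z f"
    using fp f l r bim unfolding is_bimodule_iso_def by blast
qed

text \<open>
  If \<open>X = X\<^sub>0 \<otimes> B\<close> and \<open>Y = B \<otimes> Y\<^sub>0\<close> are free on one side, then \<open>X \<otimes>\<^sub>B Y = X\<^sub>0 \<otimes> B \<otimes> Y\<^sub>0\<close>, and the
  coequalizer is split by inserting the unit of \<open>B\<close>.
\<close>

lemma descends_to_bimodule_iso_free: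
  assumes B: "is_algebra C B"
    and bim: "is_bimodule C B X" "is_bimodule C B Y" "is_bimodule C B Z"
    and w [simp]: "w \<in> Arr C" "Dom C w = mobj X \<boxdot> mobj Y" "Cod C w = mobj Z"
    and bal: "w \<cdot> (ract X \<boxtimes> Ide C (mobj Y)) = w \<cdot> (Ide C (mobj X) \<boxtimes> lact Y) \<cdot> Assoc C (mobj X) (carr B) (mobj Y)"
    and left: "lact Z \<cdot> (Ide C (carr B) \<boxtimes> w) \<cdot> Assoc C (carr B) (mobj X) (mobj Y) = w \<cdot> (lact X \<boxtimes> Ide C (mobj Y))"
    and right: "ract Z \<cdot> (w \<boxtimes> Ide C (carr B)) = w \<cdot> (Ide C (mobj X) \<boxtimes> ract Y) \<cdot> Assoc C (mobj X) (mobj Y) (carr B)"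
    and a [simp]: "a \<in> Arr C" "Cod C a = mobj X" and c [simp]: "c \<in> Arr C" "Cod C c = mobj Y"
    and \<phi>: "\<phi> = ract X \<cdot> (a \<boxtimes> Ide C (carr B))" "is_invertible C \<phi>"
    and \<psi>: "\<psi> = lact Y \<cdot> (Ide C (carr B) \<boxtimes> c)" "is_invertible C \<psi>"
    and \<theta>: "is_invertible C (w \<cdot> (\<phi> \<boxtimes> c))"
  shows "descends_to_bimodule_iso C B X Y Z w"
proof -
  let ?x = "mobj X" and ?y = "mobj Y" and ?b = "carr B"
  note [simp] = algebra_arr(1-7)[OF B] bimodule_arr(1-7)[OF bim(1)] bimodule_arr(1-7)[OF bim(2)]
    bimodule_arr(1-7)[OF bim(3)]
  have \<phi>_arr [simp]: "\<phi> \<in> Arr C" "Dom C \<phi> = Dom C a \<boxdot> ?b" "Cod C \<phi> = ?x"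
    by (simp_all add: \<phi>(1))
  have \<psi>_arr [simp]: "\<psi> \<in> Arr C" "Dom C \<psi> = ?b \<boxdot> Dom C c" "Cod C \<psi> = ?y"
    by (simp_all add: \<psi>(1))
  \<comment> \<open>The right action of B on X in the coordinates given by
    \<open>\<phi>\<close>.\<close>
  let ?\<kappa> = "(Ide C (Dom C a) \<boxtimes> mul B) \<cdot> Assoc C (Dom C a) ?b ?b"
  let ?A = "Assoc C (Dom C a \<boxdot> ?b) ?b (Dom C c)"
  let ?u = "ract X \<boxtimes> Ide C ?y" and ?v = "(Ide C ?x \<boxtimes> lact Y) \<cdot> Assoc C ?x ?b ?y"
  obtain t where t [simp]: "t \<in> Arr C" "Dom C t = mobj Z" "Cod C t = Dom C a \<boxdot> ?b \<boxdot> Dom C c"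
    and wt: "(w \<cdot> (\<phi> \<boxtimes> c)) \<cdot> t = Ide C (mobj Z)" and tw: "t \<cdot> (w \<cdot> (\<phi> \<boxtimes> c)) = Ide C (Dom C a \<boxdot> ?b \<boxdot> Dom C c)"
    using inv_arr[OF \<theta>] by auto
  \<comment> \<open>The section of \<open>w\<close>: an element x b y of Z is sent to (x b)
    \<otimes> y, the whole coefficient b being placed on the left.\<close>
  let ?s = "(\<phi> \<boxtimes> c) \<cdot> t"
  have ws: "w \<cdot> ?s = Ide C (mobj Z)"
    using wt by simp
  have "ract X \<cdot> (\<phi> \<boxtimes> Ide C ?b) = (ract X \<cdot> (ract X \<boxtimes> Ide C ?b)) \<cdot> ((a \<boxtimes> Ide C ?b) \<boxtimes> Ide C ?b)"
    by (simp add: \<phi>(1) tensor_comp')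
  also have "\<dots> = ract X \<cdot> (Ide C ?x \<boxtimes> mul B) \<cdot> (a \<boxtimes> (Ide C ?b \<boxtimes> Ide C ?b)) \<cdot> Assoc C (Dom C a) ?b ?b"
    by (simp add: bimodule_arr(8)[OF bim(1)] assoc_natural' del: tensor_ide)
  also have "\<dots> = \<phi> \<cdot> ?\<kappa>"
    using comp_apply[OF tensor_comp'[of a "Ide C ?x" "Ide C (?b \<boxdot> ?b)" "mul B"]]
      comp_apply[OF tensor_comp'[of "Ide C (Dom C a)" a "mul B" "Ide C ?b"]]
    by (simp add: \<phi>(1))
  finally have \<kappa>: "ract X \<cdot> (\<phi> \<boxtimes> Ide C ?b) = \<phi> \<cdot> ?\<kappa>" .
  \<comment> \<open>In elements: a balanced \<open>h\<close> takes the same value on x b \<otimes>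
    b' y and on x b b' \<otimes> y.\<close>
  have key: "h \<cdot> (\<phi> \<boxtimes> \<psi>) \<cdot> ?A = h \<cdot> (\<phi> \<boxtimes> c) \<cdot> (?\<kappa> \<boxtimes> Ide C (Dom C c))"
    if [simp]: "h \<in> Arr C" "Dom C h = ?x \<boxdot> ?y" and hb: "h \<cdot> ?u = h \<cdot> ?v" for h
  proof -
    have "h \<cdot> (\<phi> \<boxtimes> \<psi>) \<cdot> ?A = h \<cdot> (Ide C ?x \<boxtimes> lact Y) \<cdot> (\<phi> \<boxtimes> (Ide C ?b \<boxtimes> c)) \<cdot> ?A"
      using comp_apply[OF tensor_comp'[of \<phi> "Ide C ?x" "Ide C ?b \<boxtimes> c" "lact Y"], of ?A]
      by (simp add: \<psi>(1))
    also have "\<dots> = (h \<cdot> ?v) \<cdot> (\<phi> \<boxtimes> Ide C ?b \<boxtimes> c)"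
      by (simp add: assoc_natural')
    also have "\<dots> = h \<cdot> ((ract X \<cdot> (\<phi> \<boxtimes> Ide C ?b)) \<boxtimes> c)"
      unfolding hb[symmetric] by (simp add: tensor_comp')
    also have "\<dots> = h \<cdot> (\<phi> \<boxtimes> c) \<cdot> (?\<kappa> \<boxtimes> Ide C (Dom C c))"
      unfolding \<kappa> by (simp add: tensor_comp')
    finally show ?thesis .
  qed
  \<comment> \<open>\<open>key\<close> applies both to \<open>h\<close> and to \<open>w\<close>,
    which is balanced itself; since \<open>\<phi>\<close> and \<open>\<psi>\<close> are invertible,
    it suffices to compare on the elements x b \<otimes> b' y.\<close>
  have fac: "(h \<cdot> ?s) \<cdot> w = h"
    if [simp]: "h \<in> Arr C" "Dom C h = ?x \<boxdot> ?y" and hb: "h \<cdot> ?u = h \<cdot> ?v" for h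
  proof -
    have "((h \<cdot> ?s) \<cdot> w) \<cdot> (\<phi> \<boxtimes> \<psi>) \<cdot> ?A =
        h \<cdot> (\<phi> \<boxtimes> c) \<cdot> (t \<cdot> (w \<cdot> (\<phi> \<boxtimes> c))) \<cdot> (?\<kappa> \<boxtimes> Ide C (Dom C c))"
      using key[OF w(1,2) bal] by simp
    also have "\<dots> = h \<cdot> (\<phi> \<boxtimes> \<psi>) \<cdot> ?A"
      unfolding tw using key[OF that(1,2) hb] by simp
    finally show ?thesis
      by (rule epi_cancel[rotated]) (use \<phi>(2) \<psi>(2) in auto)
  qed
  have "\<exists>!f. f \<in> Hom C (mobj Z) z \<and> f \<cdot> w = h"
    if "h \<in> Hom C (?x \<boxdot> ?y) z" and hb: "h \<cdot> ?u = h \<cdot> ?v" for h z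
  proof (rule ex1I[of _ "h \<cdot> ?s"])
    note [simp] = homD(1-3)[OF that(1)]
    show "h \<cdot> ?s \<in> Hom C (mobj Z) z \<and> (h \<cdot> ?s) \<cdot> w = h"
      using fac[of h] hb by (auto intro!: homI)
    show "f = h \<cdot> ?s" if "f \<in> Hom C (mobj Z) z \<and> f \<cdot> w = h" for f
    proof -
      from that have fh: "f \<in> Hom C (mobj Z) z" and fw: "f \<cdot> w = h"
        by auto
      note [simp] = homD(1-3)[OF fh]
      have "h \<cdot> ?s = f \<cdot> w \<cdot> ?s"
        by (simp flip: fw)
      then show ?thesis
        by (simp only: ws) simp
    qed
  qed
  then have "is_tensor_over C B X Y Z w"
    unfolding is_tensor_over_def Let_def using bim bal left right by (auto intro: homI)
  then show ?thesis
    using B ws by (intro descends_to_bimodule_isoI[where s = ?s]) auto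
qed

text \<open>The free case in which both generating objects are 1 and both generators are the unit of
  B; the coordinates are then the unitors.\<close>

lemma descends_regular:
  assumes "is_algebra C B"
  shows "descends_to_bimodule_iso C B (regular_bimodule B) (regular_bimodule B) (regular_bimodule B) (mul B)"
proof -
  note [simp] = algebra_arr[OF assms]
  have "is_invertible C (mul B \<cdot> (LUnit C (carr B) \<boxtimes> uni B))"
  proof -
    have "mul B \<cdot> (LUnit C (carr B) \<boxtimes> uni B) =
        mul B \<cdot> (Ide C (carr B) \<boxtimes> uni B) \<cdot> (LUnit C (carr B) \<boxtimes> Ide C (Unit C))"
      by (simp add: tensor_comp' del: algebra_arr(10))
    also have "\<dots> = RUnit C (carr B) \<cdot> (LUnit C (carr B) \<boxtimes> Ide C (Unit C))"
      by (subst comp_apply[OF algebra_arr(10)[OF assms]]) auto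
    finally show ?thesis
      by simp
  qed
  then show ?thesis
    using regular_bimodule[OF assms]
    by (intro descends_to_bimodule_iso_free[OF assms, where a = "uni B" and c = "uni B"
          and \<phi> = "LUnit C (carr B)" and \<psi> = "RUnit C (carr B)"])
      (auto simp: regular_bimodule_def)
qed

end


section \<open>Bimodules formed by the components of a graded algebra that receives B\<close>

locale graded_algebra_over = braided_graded_algebra C A add e
  for C :: "('o, 'a) braided_data" (structure) and A :: "('g, 'o, 'a) graded_algebra" and add e +
  fixes B :: "('o, 'a) algebra_data" and \<beta> :: 'a
  assumes algebra: "is_algebra C B"
    and emb [simp]: "\<beta> \<in> Arr C" "Dom C \<beta> = carr B" "Cod C \<beta> = gobj A e"
    and emb_mul: "gprod e e \<beta> \<beta> = \<beta> \<cdot> mul B"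
    and emb_uni: "\<beta> \<cdot> uni B = guni A"
begin

definition bimod :: "'g \<Rightarrow> ('o, 'a) bimodule_data"
  where "bimod x = \<lparr>mobj = gobj A x, lact = gprod e x \<beta> (Ide C (gobj A x)), ract = gprod x e (Ide C (gobj A x)) \<beta>\<rparr>"

lemma bimod_simps [simp]:
  "mobj (bimod x) = gobj A x" "lact (bimod x) = gprod e x \<beta> (Ide C (gobj A x))"
  "ract (bimod x) = gprod x e (Ide C (gobj A x)) \<beta>"
  by (simp_all add: bimod_def)

lemma gmul_tensor:
  "\<lbrakk>f \<in> Arr C; Cod C f = gobj A x; g \<in> Arr C; Cod C g = gobj A y\<rbrakk> \<Longrightarrow> gmul A x y \<cdot> (f \<boxtimes> g) = gprod x y f g"
  by (simp add: gprod_def)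

text \<open>Each associativity axiom is \<open>gprod_assoc\<close> with \<open>\<beta>\<close> in
  two of the three places; \<open>emb_mul\<close> and \<open>emb_uni\<close> translate the structure
  of B.\<close>

lemma bimod_bimodule: "is_bimodule C B (bimod x)"
proof -
  note [simp] = algebra_arr(1-7)[OF algebra]
  let ?i = "Ide C (gobj A x)"
  show ?thesis
    unfolding is_bimodule_def Let_def
    using gprod_assoc[of \<beta> e \<beta> e ?i x] gprod_assoc[of ?i x \<beta> e \<beta> e] gprod_assoc[of \<beta> e ?i x \<beta> e]
      gprod_unit_left[of ?i x] gprod_unit_right[of ?i x]
    by (auto intro!: homI simp: gprod_whisk comp_apply[OF gprod_whisk(2)] emb_mul emb_uni)
qed

text \<open>The common criterion for both orders of the product. Balancedness and linearity are
  instances of associativity, so only three product maps of the generators \<open>a\<close>,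
  \<open>\<beta>\<close>, \<open>c\<close> remain to be inverted.\<close>

lemma descends_gmul:
  assumes [simp]: "a \<in> Arr C" "Cod C a = gobj A x" "c \<in> Arr C" "Cod C c = gobj A y"
    and inv: "is_invertible C (gprod x e a \<beta>)" "is_invertible C (gprod e y \<beta> c)"
      "is_invertible C (gprod x y (gprod x e a \<beta>) c)"
  shows "descends_to_bimodule_iso C B (bimod x) (bimod y) (bimod (add x y)) (gmul A x y)"
proof (rule descends_to_bimodule_iso_free[where a = a and c = c and
      \<phi> = "gprod x e a \<beta>" and \<psi> = "gprod e y \<beta> c"])
  note [simp] = algebra_arr(1-7)[OF algebra]
  let ?i = "Ide C (gobj A x)" and ?j = "Ide C (gobj A y)" and ?k = "Ide C (gobj A (add x y))"
  have m: "gmul A x y = gprod x y ?i ?j"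
    by (simp add: gprod_def)
  show "gmul A x y \<cdot> (ract (bimod x) \<boxtimes> Ide C (mobj (bimod y))) =
      gmul A x y \<cdot> (Ide C (mobj (bimod x)) \<boxtimes> lact (bimod y)) \<cdot> Assoc C (mobj (bimod x)) (carr B) (mobj (bimod y))"
    using gprod_assoc[of ?i x \<beta> e ?j y] by (simp add: m gprod_whisk comp_apply[OF gprod_whisk(2)])
  show "lact (bimod (add x y)) \<cdot> (Ide C (carr B) \<boxtimes> gmul A x y) \<cdot> Assoc C (carr B) (mobj (bimod x)) (mobj (bimod y)) =
      gmul A x y \<cdot> (lact (bimod x) \<boxtimes> Ide C (mobj (bimod y)))"
    using gprod_assoc[of \<beta> e ?i x ?j y] by (simp add: m gprod_whisk comp_apply[OF gprod_whisk(2)])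
  show "ract (bimod (add x y)) \<cdot> (gmul A x y \<boxtimes> Ide C (carr B)) =
      gmul A x y \<cdot> (Ide C (mobj (bimod x)) \<boxtimes> ract (bimod y)) \<cdot> Assoc C (mobj (bimod x)) (mobj (bimod y)) (carr B)"
    using gprod_assoc[of ?i x ?j y \<beta> e] by (simp add: m gprod_whisk comp_apply[OF gprod_whisk(2)])
qed (use inv algebra bimod_bimodule algebra_arr(1)[OF algebra] in \<open>auto simp: gprod_whisk gmul_tensor\<close>)

end


section \<open>The quadratic algebra \<open>\<Lambda>\<close>\<close>

context abelian_braided_category
begin

text \<open>
  The ideal generated in degree 2 lies in the kernel of the augmentation \<open>TV \<rightarrow> 1\<close>, so the unit
  of the quotient is a split monomorphism.
\<close>

lemma quotient_unit_split:
  assumes V [simp]: "V \<in> Obj C" and T: "is_tensor_algebra C V T \<iota>"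
    and r: "r \<in> Arr C" "Cod C r = tpow C V 2"
    and k: "is_ideal_generated_by_image C T (\<iota> 2 \<cdot> r) k"
    and \<pi>: "is_algebra_hom C T L \<pi>" "is_cokernel C \<pi> k"
  obtains u where "u \<in> Hom C (carr L) (Unit C)" "u \<cdot> uni L = Ide C (Unit C)"
proof -
  let ?u = "Unit C" and ?t = "carr T"
  have alg: "is_algebra C T" and cop: "is_coproduct C (tpow C V) ?t \<iota>"
    and copl: "\<And>X. X \<in> Obj C \<Longrightarrow> is_coproduct C (\<lambda>n. X \<boxdot> tpow C V n) (X \<boxdot> ?t) (\<lambda>n. Ide C X \<boxtimes> \<iota> n)"
    and copr: "\<And>X. X \<in> Obj C \<Longrightarrow> is_coproduct C (\<lambda>n. tpow C V n \<boxdot> X) (?t \<boxdot> X) (\<lambda>n. \<iota> n \<boxtimes> Ide C X)"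
    and mul_\<iota>: "\<And>m n. mul T \<cdot> (\<iota> m \<boxtimes> \<iota> n) = \<iota> (m + n) \<cdot> tcat C V m n"
    and uni_\<iota>: "uni T = \<iota> 0"
    using T unfolding is_tensor_algebra_def by blast+
  note [simp] = algebra_arr(1-7)[OF alg] r
  have \<iota>: "\<iota> n \<in> Hom C (tpow C V n) ?t" for n
    using cop by (simp add: is_coproduct_def)
  note [simp] = homD(1-3)[OF \<iota>]
  \<comment> \<open>Components of the augmentation: identity in degree 0, zero in positive
    degrees.\<close>
  let ?f = "\<lambda>n. if n = 0 then Ide C ?u else Zero C (tpow C V n) ?u"
  have "?f n \<in> Hom C (tpow C V n) ?u" for n
    by (cases n) (auto intro!: homI)
  then have "\<exists>!h. h \<in> Hom C ?t ?u \<and> (\<forall>n. h \<cdot> \<iota> n = ?f n)"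
    by (rule coproduct_universal[OF cop unit_obj])
  then obtain \<epsilon> where \<epsilon>: "\<epsilon> \<in> Hom C ?t ?u" and \<epsilon>\<iota>: "\<epsilon> \<cdot> \<iota> n = ?f n" for n
    by blast
  note [simp] = homD(1-3)[OF \<epsilon>]
  \<comment> \<open>Both sides vanish unless m = n = 0. In that case the left side gives
    \<open>RUnit\<close> of 1, by the definition of \<open>tcat\<close>, and the right side
    \<open>LUnit\<close> of 1.\<close>
  have "(\<epsilon> \<cdot> mul T) \<cdot> (\<iota> m \<boxtimes> \<iota> n) = (LUnit C ?u \<cdot> (\<epsilon> \<boxtimes> \<epsilon>)) \<cdot> (\<iota> m \<boxtimes> \<iota> n)" for m n
  proof -
    have "(\<epsilon> \<cdot> mul T) \<cdot> (\<iota> m \<boxtimes> \<iota> n) = ?f (m + n) \<cdot> tcat C V m n"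
      by (simp add: mul_\<iota> comp_apply[OF \<epsilon>\<iota>])
    also have "\<dots> = LUnit C ?u \<cdot> (?f m \<boxtimes> ?f n)"
      by (auto simp: comp_zero tensor_zero lunit_unit_eq_runit_unit)
    also have "\<dots> = (LUnit C ?u \<cdot> (\<epsilon> \<boxtimes> \<epsilon>)) \<cdot> (\<iota> m \<boxtimes> \<iota> n)"
      by (simp only: \<epsilon>\<iota>[symmetric]) (simp add: tensor_comp')
    finally show ?thesis .
  qed
  \<comment> \<open>Coproducts are preserved in one tensor factor at a time, so equality on T
    \<otimes> T is tested first in the second factor and then in the first.\<close>
  then have mn: "((\<epsilon> \<cdot> mul T) \<cdot> (\<iota> m \<boxtimes> Ide C ?t)) \<cdot> (Ide C (tpow C V m) \<boxtimes> \<iota> n) =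
      ((LUnit C ?u \<cdot> (\<epsilon> \<boxtimes> \<epsilon>)) \<cdot> (\<iota> m \<boxtimes> Ide C ?t)) \<cdot> (Ide C (tpow C V m) \<boxtimes> \<iota> n)" for m n
    by (simp add: tensor_comp')
  have m: "(\<epsilon> \<cdot> mul T) \<cdot> (\<iota> m \<boxtimes> Ide C ?t) = (LUnit C ?u \<cdot> (\<epsilon> \<boxtimes> \<epsilon>)) \<cdot> (\<iota> m \<boxtimes> Ide C ?t)" for m
    by (rule coproduct_eq[OF copl[of "tpow C V m"] _ _ mn, where x = ?u]) (auto intro!: homI)
  have \<epsilon>_mul: "\<epsilon> \<cdot> mul T = LUnit C ?u \<cdot> (\<epsilon> \<boxtimes> \<epsilon>)"
    by (rule coproduct_eq[OF copr[of ?t] _ _ m, where x = ?u]) (auto intro!: homI)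
  obtain k' where k': "is_kernel C k' \<epsilon>"
    using has_kernel[of \<epsilon>] by auto
  have [simp]: "k' \<in> Arr C" "Cod C k' = ?t" and \<epsilon>k': "\<epsilon> \<cdot> k' = Zero C (Dom C k') ?u"
    using k' by (auto simp: is_kernel_def)
  have factors: "factors_through C h k'"
    if [simp]: "h \<in> Arr C" "Cod C h = ?t" and "\<epsilon> \<cdot> h = Zero C (Dom C h) ?u" for h
  proof -
    have "h \<in> Hom C (Dom C h) (Dom C \<epsilon>)"
      by (simp add: homI)
    then have "\<exists>!u. u \<in> Hom C (Dom C h) (Dom C k') \<and> k' \<cdot> u = h"
      using k' that(3) obj_dom_cod(1)[OF that(1)] unfolding is_kernel_def by auto
    then show ?thesis
      unfolding factors_through_def by blast
  qed
  \<comment> \<open>As \<open>\<epsilon>\<close> is multiplicative, it kills every product with one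
    factor in its kernel.\<close>
  have "is_ideal C T k'"
    unfolding is_ideal_def
  proof (intro conjI factors)
    show "\<epsilon> \<cdot> mul T \<cdot> (Ide C ?t \<boxtimes> k') = Zero C (Dom C (mul T \<cdot> (Ide C ?t \<boxtimes> k'))) ?u"
      by (simp add: comp_apply[OF \<epsilon>_mul] tensor_comp' \<epsilon>k' tensor_zero comp_zero)
    show "\<epsilon> \<cdot> mul T \<cdot> (k' \<boxtimes> Ide C ?t) = Zero C (Dom C (mul T \<cdot> (k' \<boxtimes> Ide C ?t))) ?u"
      by (simp add: comp_apply[OF \<epsilon>_mul] tensor_comp' \<epsilon>k' tensor_zero comp_zero)
  qed (auto intro: kernel_mono[OF k'])
  \<comment> \<open>The relations sit in degree 2, where \<open>\<epsilon>\<close> is zero by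
    construction.\<close>
  moreover have "factors_through C (\<iota> 2 \<cdot> r) k'"
    by (rule factors) (auto simp: comp_apply[OF \<epsilon>\<iota>] comp_zero)
  ultimately have "factors_through C k k'"
    using k unfolding is_ideal_generated_by_image_def by blast
  then obtain g where g: "g \<in> Hom C (Dom C k) (Dom C k')" and kg: "k' \<cdot> g = k"
    unfolding factors_through_def by blast
  note [simp] = homD(1-3)[OF g]
  have "\<epsilon> \<cdot> k' \<cdot> g = Zero C (Dom C k) ?u" "Cod C (k' \<cdot> g) = ?t"
    by (simp_all add: comp_apply[OF \<epsilon>k'] comp_zero)
  then have \<epsilon>k: "\<epsilon> \<cdot> k = Zero C (Dom C k) ?u" and k_cod: "Cod C k = ?t"
    unfolding kg .
  have "\<exists>!u. u \<in> Hom C (Cod C \<pi>) ?u \<and> u \<cdot> \<pi> = \<epsilon>"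
    using \<pi>(2) \<epsilon> \<epsilon>k unit_obj unfolding is_cokernel_def k_cod by blast
  then obtain u where u: "u \<in> Hom C (Cod C \<pi>) ?u" and u\<pi>: "u \<cdot> \<pi> = \<epsilon>"
    by blast
  have \<pi>_hom: "\<pi> \<in> Hom C ?t (carr L)" and \<pi>_uni: "\<pi> \<cdot> uni T = uni L"
    using \<pi>(1) by (auto simp: is_algebra_hom_def)
  note [simp] = homD(1-3)[OF \<pi>_hom]
  have u': "u \<in> Hom C (carr L) ?u"
    using u by simp
  note [simp] = homD(1-3)[OF u']
  have "u \<cdot> uni L = \<epsilon> \<cdot> \<iota> 0"
    by (simp flip: \<pi>_uni u\<pi> uni_\<iota>)
  then show ?thesis
    using u' that \<epsilon>\<iota>[of 0] by simp
qed

text \<open>The algebra laws are tested after the monomorphisms \<open>j\<close>, where they turn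
  into those of the quotient L.\<close>

lemma Lambda_graded_algebra:
  assumes \<Lambda>: "is_Lambda C V \<Lambda>" and V [simp]: "V \<in> Obj C"
  shows "braided_graded_algebra C \<Lambda> (+) 0" "is_invertible C (guni \<Lambda>)"
proof -
  let ?r = "(Inv C (LUnit C V) \<boxtimes> Ide C V) \<cdot> Add C (Ide C (V \<boxdot> V)) (Braid C V V)"
  obtain T \<iota> k L \<pi> e j where T: "is_tensor_algebra C V T \<iota>"
    and k: "is_ideal_generated_by_image C T (\<iota> 2 \<cdot> ?r) k"
    and L: "is_algebra C L" and \<pi>: "is_algebra_hom C T L \<pi>" "is_cokernel C \<pi> k"
    and e: "\<And>p. is_epi C (e p)" "\<And>p. e p \<in> Hom C (tpow C V p) (gobj \<Lambda> p)"
    and j: "\<And>p. is_mono C (j p)" "\<And>p. j p \<in> Hom C (gobj \<Lambda> p) (carr L)"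
    and je: "\<And>p. j p \<cdot> e p = \<pi> \<cdot> \<iota> p"
    and gm: "\<And>p q. gmul \<Lambda> p q \<in> Hom C (gobj \<Lambda> p \<boxdot> gobj \<Lambda> q) (gobj \<Lambda> (p + q))"
    and jm: "\<And>p q. j (p + q) \<cdot> gmul \<Lambda> p q = mul L \<cdot> (j p \<boxtimes> j q)"
    and gu: "guni \<Lambda> \<in> Hom C (Unit C) (gobj \<Lambda> 0)" and ju: "j 0 \<cdot> guni \<Lambda> = uni L"
    and deg: "\<And>p. gdeg \<Lambda> p = p"
    using \<Lambda> unfolding is_Lambda_def by (elim exE conjE) (rule that, assumption+, blast+)
  note [simp] = homD(1-3)[OF e(2)] homD(1-3)[OF j(2)] homD(1-3)[OF gm] homD(1-3)[OF gu] algebra_arr(1-7)[OF L]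
  have obj [simp]: "gobj \<Lambda> p \<in> Obj C" for p
    using homD(5)[OF e(2)] .
  show "braided_graded_algebra C \<Lambda> (+) 0"
  proof
    fix p q r
    let ?p = "gobj \<Lambda> p" and ?q = "gobj \<Lambda> q" and ?r = "gobj \<Lambda> r" and ?l = "carr L"
    have "j (p + q + r) \<cdot> gmul \<Lambda> (p + q) r \<cdot> (gmul \<Lambda> p q \<boxtimes> Ide C ?r) =
        (mul L \<cdot> (mul L \<boxtimes> Ide C ?l)) \<cdot> (j p \<boxtimes> j q \<boxtimes> j r)"
      by (simp add: comp_apply[OF jm] tensor_comp' jm)
    also have "\<dots> = mul L \<cdot> (Ide C ?l \<boxtimes> mul L) \<cdot> (j p \<boxtimes> (j q \<boxtimes> j r)) \<cdot> Assoc C ?p ?q ?r"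
      by (simp add: algebra_arr(8)[OF L] assoc_natural')
    also have "\<dots> = mul L \<cdot> (j p \<boxtimes> j (q + r)) \<cdot> (Ide C ?p \<boxtimes> gmul \<Lambda> q r) \<cdot> Assoc C ?p ?q ?r"
      using comp_apply[OF tensor_comp'[of "j p" "Ide C ?l" "j q \<boxtimes> j r" "mul L"], of "Assoc C ?p ?q ?r"]
        comp_apply[OF tensor_comp'[of "Ide C ?p" "j p" "gmul \<Lambda> q r" "j (q + r)"], of "Assoc C ?p ?q ?r"]
      by (simp add: jm)
    also have "\<dots> = j (p + q + r) \<cdot> gmul \<Lambda> p (q + r) \<cdot> (Ide C ?p \<boxtimes> gmul \<Lambda> q r) \<cdot> Assoc C ?p ?q ?r"
      using comp_apply[OF jm[of p "q + r"], of "(Ide C ?p \<boxtimes> gmul \<Lambda> q r) \<cdot> Assoc C ?p ?q ?r"]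
      by (simp add: add.assoc)
    finally show "gmul \<Lambda> (p + q) r \<cdot> (gmul \<Lambda> p q \<boxtimes> Ide C ?r) =
        gmul \<Lambda> p (q + r) \<cdot> (Ide C ?p \<boxtimes> gmul \<Lambda> q r) \<cdot> Assoc C ?p ?q ?r"
      by (rule mono_eq[OF j(1)[of "p + q + r"]]) (auto simp: add.assoc)
    have "j p \<cdot> gmul \<Lambda> 0 p \<cdot> (guni \<Lambda> \<boxtimes> Ide C ?p) = (mul L \<cdot> (uni L \<boxtimes> Ide C ?l)) \<cdot> (Ide C (Unit C) \<boxtimes> j p)"
      using comp_apply[OF jm[of 0 p], of "guni \<Lambda> \<boxtimes> Ide C ?p"] by (simp add: tensor_comp' ju)
    also have "\<dots> = j p \<cdot> LUnit C ?p"
      unfolding algebra_arr(9)[OF L] by (simp add: lunit_natural')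
    finally show "gmul \<Lambda> 0 p \<cdot> (guni \<Lambda> \<boxtimes> Ide C ?p) = LUnit C ?p"
      by (rule mono_eq[OF j(1)[of p]]) auto
    have "j p \<cdot> gmul \<Lambda> p 0 \<cdot> (Ide C ?p \<boxtimes> guni \<Lambda>) = (mul L \<cdot> (Ide C ?l \<boxtimes> uni L)) \<cdot> (j p \<boxtimes> Ide C (Unit C))"
      using comp_apply[OF jm[of p 0], of "Ide C ?p \<boxtimes> guni \<Lambda>"] by (simp add: tensor_comp' ju)
    also have "\<dots> = j p \<cdot> RUnit C ?p"
      unfolding algebra_arr(10)[OF L] by (simp add: runit_natural')
    finally show "gmul \<Lambda> p 0 \<cdot> (Ide C ?p \<boxtimes> guni \<Lambda>) = RUnit C ?p"
      by (rule mono_eq[OF j(1)[of p]]) auto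
  qed (auto simp: deg intro: gm gu)
  have add [simp]: "Add C (Ide C (V \<boxdot> V)) (Braid C V V) \<in> Hom C (V \<boxdot> V) (V \<boxdot> V)"
    by (intro add_hom) (auto intro!: homI)
  have r: "?r \<in> Arr C" "Cod C ?r = tpow C V 2"
    using homD[OF add] by (auto simp: numeral_2_eq_2)
  obtain u where u: "u \<in> Hom C (carr L) (Unit C)" and uu: "u \<cdot> uni L = Ide C (Unit C)"
    using quotient_unit_split[OF V T r k \<pi>] .
  note [simp] = homD(1-3)[OF u]
  have "uni T = \<iota> 0" "\<pi> \<cdot> uni T = uni L"
    using T \<pi>(1) unfolding is_tensor_algebra_def is_algebra_hom_def by blast+
  \<comment> \<open>The zeroth tensor power is 1, so \<open>e 0\<close> and the unit of \<Lambda>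
    are parallel arrows and coincide. Hence the unit is an epimorphism, and the left inverse
    \<open>u \<cdot> j 0\<close> makes it an isomorphism.\<close>
  then have "j 0 \<cdot> e 0 = j 0 \<cdot> guni \<Lambda>"
    by (simp only: je ju)
  then have eu: "e 0 = guni \<Lambda>"
    by (rule mono_eq[OF j(1)]) auto
  have l: "(u \<cdot> j 0) \<cdot> guni \<Lambda> = Ide C (Unit C)"
    by (simp add: ju uu)
  have "(guni \<Lambda> \<cdot> u \<cdot> j 0) \<cdot> guni \<Lambda> = Ide C (gobj \<Lambda> 0) \<cdot> guni \<Lambda>"
    by (simp add: ju uu)
  then have "guni \<Lambda> \<cdot> u \<cdot> j 0 = Ide C (gobj \<Lambda> 0)"
    by (rule epi_eq[OF e(1)[of 0, unfolded eu]]) auto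
  with l show "is_invertible C (guni \<Lambda>)"
    by (intro invertibleI[of _ "u \<cdot> j 0"]) simp_all
qed

end


section \<open>The bigraded algebra \<open>\<Omega>\<close>\<close>

text \<open>With a bare \<open>\<lambda>_ _. ()\<close> the unit laws would become looping simplification rules \<open>() = x\<close>.\<close>

definition unit_add :: "unit \<Rightarrow> unit \<Rightarrow> unit"
  where "unit_add x y = ()"

lemma (in abelian_braided_category) in_degree_zero_graded_algebra:
  assumes "is_algebra C B"
  shows "braided_graded_algebra C (in_degree_zero B) unit_add ()"
  using algebra_arr[OF assms] by unfold_locales (auto simp: in_degree_zero_def intro!: homI)


section \<open>Generators of \<Omega> and their commutation relations\<close>

locale omega_algebra = abelian_braided_category C + L: braided_graded_algebra C \<Lambda> "(+)" "0::nat"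
  for C :: "('o, 'a) braided_data" (structure) and \<Lambda> :: "(nat, 'o, 'a) graded_algebra" +
  fixes B :: "('o, 'a) algebra_data"
  assumes algebra: "is_algebra C B" and guni_invertible: "is_invertible C (guni \<Lambda>)"
begin

abbreviation "B0 \<equiv> in_degree_zero B"

sublocale B0: braided_graded_algebra C B0 unit_add "()"
  by (rule in_degree_zero_graded_algebra[OF algebra])

sublocale inner: braided_graded_algebra_pair C \<Lambda> "(+)" 0 B0 unit_add "()" ..

sublocale outer: braided_graded_algebra_pair C "super_tensor C \<Lambda> B0" inner.addS "(0, ())" \<Lambda> "(+)" 0 ..

lemma B0_simps [simp]:
  "gobj B0 u = carr B" "gmul B0 u v = mul B" "guni B0 = uni B" "gdeg B0 u = 0"
  by (simp_all add: in_degree_zero_def)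

abbreviation "\<Omega> \<equiv> super_tensor C (super_tensor C \<Lambda> B0) \<Lambda>"
abbreviation "b \<equiv> carr B"
abbreviation "ix p q \<equiv> ((p :: nat, ()), q :: nat)"
abbreviation "pr \<equiv> outer.super.gprod"

text \<open>The generators x \<otimes> 1 \<otimes> 1, 1 \<otimes> b \<otimes> 1 and 1 \<otimes> 1
  \<otimes> y. One embedding suffices for \<open>\<gamma>\<close>, as \<open>outer.inD\<close>
  inserts the unit of the whole inner algebra.\<close>

definition "\<alpha> p = outer.inA (p, ()) \<cdot> inner.inA p"
definition "\<beta> = outer.inA (0, ()) \<cdot> inner.inD ()"
definition "\<gamma> q = outer.inD q"

lemma carr_obj [simp]: "b \<in> Obj C"
  using algebra_arr(1)[OF algebra] .

lemma gen_arr [simp]: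
  "\<alpha> p \<in> Arr C" "Dom C (\<alpha> p) = gobj \<Lambda> p" "Cod C (\<alpha> p) = gobj \<Lambda> p \<boxdot> b \<boxdot> gobj \<Lambda> 0"
  "\<beta> \<in> Arr C" "Dom C \<beta> = b" "Cod C \<beta> = gobj \<Lambda> 0 \<boxdot> b \<boxdot> gobj \<Lambda> 0"
  "\<gamma> q \<in> Arr C" "Dom C (\<gamma> q) = gobj \<Lambda> q" "Cod C (\<gamma> q) = gobj \<Lambda> 0 \<boxdot> b \<boxdot> gobj \<Lambda> q"
  by (simp_all add: \<alpha>_def \<beta>_def \<gamma>_def)

lemma left_embed_eq: "left_embed C \<Lambda> B p = outer.inA (p, ())"
  by (simp add: left_embed_def outer.inA_def left_incl_def lwhisk_def)

lemma right_embed_eq: "right_embed C \<Lambda> B q = inner.inD () \<boxtimes> Ide C (gobj \<Lambda> q)"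
  by (simp add: right_embed_def inner.inD_def right_incl_def rwhisk_def)

lemma middle_embed_eq: "middle_embed C \<Lambda> B = \<beta>"
  by (simp add: middle_embed_def \<beta>_def outer.inA_def left_incl_comp)
    (simp add: inner.inD_def right_incl_def rwhisk_def)

text \<open>Apart from unitors, the embeddings only insert the unit of \<Lambda>, so this is where 1
  \<cong> \<Lambda>^0 is used.\<close>

lemma embed_invertible: "is_invertible C (left_embed C \<Lambda> B p)" "is_invertible C (right_embed C \<Lambda> B q)"
  using guni_invertible by (simp_all add: left_embed_def right_embed_def)

text \<open>This rule and the next five give the products of two different generators in either
  order. Reversing a pair composes with a braiding; only \<open>\<gamma>\<alpha>\<close> carries a
  sign, because B has degree 0.\<close>

lemma \<alpha>\<beta>: "pr (ix p 0) (ix 0 0) (\<alpha> p) \<beta> = left_embed C \<Lambda> B p"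
  using outer.gprod_inA_inA[of "inner.inA p" "(p, ())" "inner.inD ()" "(0, ())"] inner.inA_inD[of p "()"]
  by (simp add: \<alpha>_def \<beta>_def left_embed_eq)

lemma \<beta>\<alpha>: "pr (ix 0 0) (ix p 0) \<beta> (\<alpha> p) = left_embed C \<Lambda> B p \<cdot> Braid C b (gobj \<Lambda> p)"
  using outer.gprod_inA_inA[of "inner.inD ()" "(0, ())" "inner.inA p" "(p, ())"] inner.inD_inA[of "()" p]
  by (simp add: \<alpha>_def \<beta>_def left_embed_eq)

lemma \<beta>\<gamma>: "pr (ix 0 0) (ix 0 q) \<beta> (\<gamma> q) = right_embed C \<Lambda> B q"
  using outer.gprod_inA_inD[of "inner.inD ()" "(0, ())" "Ide C (gobj \<Lambda> q)" q]
  by (simp add: \<beta>_def \<gamma>_def right_embed_eq)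

lemma \<gamma>\<beta>: "pr (ix 0 q) (ix 0 0) (\<gamma> q) \<beta> = right_embed C \<Lambda> B q \<cdot> Braid C (gobj \<Lambda> q) b"
  using outer.gprod_inD_inA[of "inner.inD ()" "(0, ())" "Ide C (gobj \<Lambda> q)" q]
  by (simp add: \<beta>_def \<gamma>_def right_embed_eq)

lemma \<alpha>\<gamma>: "pr (ix p 0) (ix 0 q) (\<alpha> p) (\<gamma> q) = inner.inA p \<boxtimes> Ide C (gobj \<Lambda> q)"
  using outer.gprod_inA_inD[of "inner.inA p" "(p, ())" "Ide C (gobj \<Lambda> q)" q]
  by (simp add: \<alpha>_def \<gamma>_def)

lemma \<gamma>\<alpha>: "pr (ix 0 q) (ix p 0) (\<gamma> q) (\<alpha> p) =
    signed C (gdeg \<Lambda> q * gdeg \<Lambda> p) (pr (ix p 0) (ix 0 q) (\<alpha> p) (\<gamma> q) \<cdot> Braid C (gobj \<Lambda> q) (gobj \<Lambda> p))"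
  using outer.gprod_inD_inA[of "inner.inA p" "(p, ())" "Ide C (gobj \<Lambda> q)" q]
  by (simp add: \<alpha>\<gamma>) (simp add: \<alpha>_def \<gamma>_def)

lemma \<alpha>\<beta>\<gamma>: "pr (ix p 0) (ix 0 q) (left_embed C \<Lambda> B p) (\<gamma> q) = Ide C (gobj \<Lambda> p \<boxdot> b \<boxdot> gobj \<Lambda> q)"
  using outer.inA_inD[of "(p, ())" q] by (simp add: left_embed_eq \<gamma>_def)

sublocale over: graded_algebra_over C \<Omega> outer.addS "((0, ()), 0)" B \<beta>
proof
  show "is_algebra C B"
    by (rule algebra)
  show "pr (ix 0 0) (ix 0 0) \<beta> \<beta> = \<beta> \<cdot> mul B"
    using outer.gprod_inA_inA[of "inner.inD ()" "(0, ())" "inner.inD ()" "(0, ())"] inner.inD_inD[of "()" "()"]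
      algebra_arr[OF algebra]
    by (simp add: \<beta>_def)
  show "\<beta> \<cdot> uni B = guni \<Omega>"
  proof -
    note [simp] = algebra_arr(5-7)[OF algebra]
    have "inner.inD () \<cdot> uni B = tensor_unit (guni \<Lambda>) (uni B)"
      by (simp add: inner.inD_def right_incl_comp)
    then have "\<beta> \<cdot> uni B = outer.inA (0, ()) \<cdot> tensor_unit (guni \<Lambda>) (uni B)"
      by (simp add: \<beta>_def)
    \<comment> \<open>\<open>left_incl\<close> produces \<open>RUnit\<close> of 1 where the unit of
      a super tensor product has \<open>LUnit\<close> of 1; the two agree.\<close>
    also have "\<dots> = guni \<Omega>"
      by (simp add: outer.inA_def left_incl_comp) (simp add: tensor_unit_def lunit_unit_eq_runit_unit)
    finally show ?thesis .
  qed
qed auto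

lemma wedge_eq: "wedge C \<Lambda> B p q p' q' = gmul \<Omega> (ix p q) (ix p' q')"
  by (simp only: wedge_def Omega_alg_def)

lemma Omega_eq [simp]: "Omega C \<Lambda> B p q = gobj \<Lambda> p \<boxdot> b \<boxdot> gobj \<Lambda> q"
  by (simp add: Omega_def Omega_alg_def)

lemma Omega_bimodule_eq: "Omega_bimodule C \<Lambda> B p q = over.bimod (ix p q)"
  unfolding Omega_bimodule_def over.bimod_def wedge_eq middle_embed_eq outer.super.gprod_def
  by simp

text \<open>Invertibility is carried from (x b) y, which is the identity, along x (b y), x (y b), (x
  y) b, (y x) b, y (x b), y (b x) to (y b) x. Only associators, braidings and one sign
  intervene.\<close>

lemma \<gamma>\<beta>\<alpha>_invertible:
  "is_invertible C (pr (ix 0 q) (ix p 0) (pr (ix 0 q) (ix 0 0) (\<gamma> q) \<beta>) (\<alpha> p))"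
proof -
  note inv_assoc = outer.super.invertible_gprod_assoc
  have "is_invertible C (pr (ix p 0) (ix 0 q) (pr (ix p 0) (ix 0 0) (\<alpha> p) \<beta>) (\<gamma> q))"
    by (simp add: \<alpha>\<beta> \<alpha>\<beta>\<gamma>)
  then have "is_invertible C (pr (ix p 0) (ix 0 q) (\<alpha> p) (pr (ix 0 0) (ix 0 q) \<beta> (\<gamma> q)))"
    using inv_assoc[of "\<alpha> p" "ix p 0" \<beta> "ix 0 0" "\<gamma> q" "ix 0 q"] by simp
  then have "is_invertible C (pr (ix p 0) (ix 0 q) (\<alpha> p) (pr (ix 0 q) (ix 0 0) (\<gamma> q) \<beta>))"
    unfolding \<beta>\<gamma> \<gamma>\<beta> by (rule outer.super.invertible_gprod_comp(2)) (simp_all flip: \<beta>\<gamma>)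
  then have "is_invertible C (pr (ix p q) (ix 0 0) (pr (ix p 0) (ix 0 q) (\<alpha> p) (\<gamma> q)) \<beta>)"
    using inv_assoc[of "\<alpha> p" "ix p 0" "\<gamma> q" "ix 0 q" \<beta> "ix 0 0"] by simp
  then have "is_invertible C (pr (ix p q) (ix 0 0)
      (pr (ix p 0) (ix 0 q) (\<alpha> p) (\<gamma> q) \<cdot> Braid C (gobj \<Lambda> q) (gobj \<Lambda> p)) \<beta>)"
    by (rule outer.super.invertible_gprod_comp(1)) simp_all
  then have "is_invertible C (pr (ix p q) (ix 0 0) (pr (ix 0 q) (ix p 0) (\<gamma> q) (\<alpha> p)) \<beta>)"
    unfolding \<gamma>\<alpha> by (subst outer.super.gprod_signed) simp_all
  then have "is_invertible C (pr (ix 0 q) (ix p 0) (\<gamma> q) (pr (ix p 0) (ix 0 0) (\<alpha> p) \<beta>))"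
    using inv_assoc[of "\<gamma> q" "ix 0 q" "\<alpha> p" "ix p 0" \<beta> "ix 0 0"] by simp
  then have "is_invertible C (pr (ix 0 q) (ix p 0) (\<gamma> q) (pr (ix 0 0) (ix p 0) \<beta> (\<alpha> p)))"
    unfolding \<alpha>\<beta> \<beta>\<alpha> by (rule outer.super.invertible_gprod_comp(2)) (simp_all flip: \<alpha>\<beta>)
  then show ?thesis
    using inv_assoc[of "\<gamma> q" "ix 0 q" \<beta> "ix 0 0" "\<alpha> p" "ix p 0"] by simp
qed

lemma descends_wedge_left:
  "descends_to_bimodule_iso C B (Omega_bimodule C \<Lambda> B p 0) (Omega_bimodule C \<Lambda> B 0 q) (Omega_bimodule C \<Lambda> B p q)
    (wedge C \<Lambda> B p 0 0 q)"
  using over.descends_gmul[of "\<alpha> p" "ix p 0" "\<gamma> q" "ix 0 q"] embed_invertible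
  by (simp add: Omega_bimodule_eq wedge_eq \<alpha>\<beta> \<beta>\<gamma> \<alpha>\<beta>\<gamma> del: outer.super_tensor_simps(2))

lemma descends_wedge_right:
  "descends_to_bimodule_iso C B (Omega_bimodule C \<Lambda> B 0 q) (Omega_bimodule C \<Lambda> B p 0) (Omega_bimodule C \<Lambda> B p q)
    (wedge C \<Lambda> B 0 q p 0)"
proof -
  have "is_invertible C (pr (ix 0 q) (ix 0 0) (\<gamma> q) \<beta>)" "is_invertible C (pr (ix 0 0) (ix p 0) \<beta> (\<alpha> p))"
    unfolding \<gamma>\<beta> \<beta>\<alpha> using embed_invertible by (auto intro!: invertible_comp simp: left_embed_eq right_embed_eq)
  then show ?thesis
    using over.descends_gmul[of "\<gamma> q" "ix 0 q" "\<alpha> p" "ix p 0"] \<gamma>\<beta>\<alpha>_invertible[of q p]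
    by (simp add: Omega_bimodule_eq wedge_eq del: outer.super_tensor_simps(2))
qed

text \<open>In elements: (x b)(b' y) = (x (b b')) y by associativity, and (x b) y stands for x
  \<otimes> b \<otimes> y. This expresses that the first isomorphism is the identification B
  \<otimes>_B B = B in the middle factor.\<close>

lemma wedge_embed: "wedge C \<Lambda> B p 0 0 q \<cdot> (left_embed C \<Lambda> B p \<boxtimes> right_embed C \<Lambda> B q) = middle_mult C \<Lambda> B p q"
proof -
  note [simp] = algebra_arr(2-4)[OF algebra]
  let ?p = "gobj \<Lambda> p" and ?q = "gobj \<Lambda> q" and ?l = "left_embed C \<Lambda> B p" and ?r = "right_embed C \<Lambda> B q"
  let ?\<kappa> = "(Ide C ?p \<boxtimes> mul B) \<cdot> Assoc C ?p b b"
  have l [simp]: "?l \<in> Arr C" "Dom C ?l = ?p \<boxdot> b" "Cod C ?l = ?p \<boxdot> b \<boxdot> gobj \<Lambda> 0"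
    by (simp_all add: left_embed_eq)
  have r [simp]: "?r \<in> Arr C" "Dom C ?r = b \<boxdot> ?q" "Cod C ?r = gobj \<Lambda> 0 \<boxdot> b \<boxdot> ?q"
    by (simp_all add: right_embed_eq)
  have "pr (ix p 0) (ix 0 0) ?l \<beta> = pr (ix p 0) (ix 0 0) (\<alpha> p) (\<beta> \<cdot> mul B) \<cdot> Assoc C ?p b b"
    using outer.super.gprod_assoc[of "\<alpha> p" "ix p 0" \<beta> "ix 0 0" \<beta> "ix 0 0"] over.emb_mul
    by (simp add: \<alpha>\<beta>)
  also have "\<dots> = ?l \<cdot> ?\<kappa>"
    using outer.super.gprod_whisk(2)[of "\<alpha> p" "ix p 0" \<beta> "ix 0 0" "mul B" ?p]
    by (simp add: \<alpha>\<beta> comp_apply)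
  finally have lb: "pr (ix p 0) (ix 0 0) ?l \<beta> = ?l \<cdot> ?\<kappa>" .
  have "pr (ix p 0) (ix 0 q) ?l ?r \<cdot> Assoc C (?p \<boxdot> b) b ?q = pr (ix p 0) (ix 0 q) (?l \<cdot> ?\<kappa>) (\<gamma> q)"
    using outer.super.gprod_assoc[of ?l "ix p 0" \<beta> "ix 0 0" "\<gamma> q" "ix 0 q"]
    by (simp add: lb \<beta>\<gamma>)
  also have "\<dots> = ?\<kappa> \<boxtimes> Ide C ?q"
    using outer.super.gprod_whisk(1)[of ?l "ix p 0" "\<gamma> q" "ix 0 q" ?\<kappa> ?q] by (simp add: \<alpha>\<beta>\<gamma>)
  finally have "(pr (ix p 0) (ix 0 q) ?l ?r \<cdot> Assoc C (?p \<boxdot> b) b ?q) \<cdot> Inv C (Assoc C (?p \<boxdot> b) b ?q) =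
      (?\<kappa> \<boxtimes> Ide C ?q) \<cdot> Inv C (Assoc C (?p \<boxdot> b) b ?q)"
    by (simp only:)
  then have "pr (ix p 0) (ix 0 q) ?l ?r = (?\<kappa> \<boxtimes> Ide C ?q) \<cdot> Inv C (Assoc C (?p \<boxdot> b) b ?q)"
    by simp
  moreover have "?\<kappa> \<boxtimes> Ide C ?q = ((Ide C ?p \<boxtimes> mul B) \<boxtimes> Ide C ?q) \<cdot> (Assoc C ?p b b \<boxtimes> Ide C ?q)"
    by (simp add: tensor_comp')
  ultimately show ?thesis
    unfolding wedge_eq middle_mult_def Let_def outer.super.gprod_def by simp
qed

end


theorem corollary3p2:
  fixes C :: "('o, 'a) braided_data" and V :: 'o
    and B :: "('o, 'a) algebra_data" and \<Lambda> :: "(nat, 'o, 'a) graded_algebra"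
    and p q :: nat
  assumes "abelian_braided_category C" and "V \<in> Obj C"
    and "is_B_plus C V B" and "is_Lambda C V \<Lambda>"
  shows
    "descends_to_bimodule_iso C B
       (Omega_bimodule C \<Lambda> B p 0) (Omega_bimodule C \<Lambda> B 0 q) (Omega_bimodule C \<Lambda> B p q)
       (wedge C \<Lambda> B p 0 0 q)
     \<and> (descends_to_bimodule_iso C B
          (regular_bimodule B) (regular_bimodule B) (regular_bimodule B) (mul B)
        \<and> left_embed C \<Lambda> B p \<in> Hom C (gobj \<Lambda> p \<boxdot>\<^bsub>C\<^esub> carr B) (Omega C \<Lambda> B p 0)
        \<and> is_invertible C (left_embed C \<Lambda> B p)
        \<and> right_embed C \<Lambda> B q \<in> Hom C (carr B \<boxdot>\<^bsub>C\<^esub> gobj \<Lambda> q) (Omega C \<Lambda> B 0 q)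
        \<and> is_invertible C (right_embed C \<Lambda> B q)
        \<and> wedge C \<Lambda> B p 0 0 q \<cdot>\<^bsub>C\<^esub> (left_embed C \<Lambda> B p \<boxtimes>\<^bsub>C\<^esub> right_embed C \<Lambda> B q)
            = middle_mult C \<Lambda> B p q)
     \<and> descends_to_bimodule_iso C B
         (Omega_bimodule C \<Lambda> B 0 q) (Omega_bimodule C \<Lambda> B p 0) (Omega_bimodule C \<Lambda> B p q)
         (wedge C \<Lambda> B 0 q p 0)"
proof -
  interpret abelian_braided_category C
    by fact
  have algebra: "is_algebra C B"
    using assms(3) by (auto simp: is_B_plus_def)
  interpret L: braided_graded_algebra C \<Lambda> "(+)" 0
    using assms(2,4) by (intro Lambda_graded_algebra)
  interpret omega_algebra C \<Lambda> B
    using assms(2,4) algebra by unfold_locales (auto intro: Lambda_graded_algebra)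
  show ?thesis
    using descends_wedge_left descends_wedge_right descends_regular[OF algebra] embed_invertible wedge_embed
    by (auto intro!: homI simp: left_embed_eq right_embed_eq)
qed

end
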